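(* Let $n\ge 1$ be an integer, $\mu>0$, $\beta>2$ and $1<p\le p_G(n)$ (meaning $1<p<\infty$ when $n=1$). Let $f\in H^1(\mathbf{R}^n)$ and $g\in L^2(\mathbf{R}^n)$ both be non-negative and not vanish identically, with $\mathrm{supp}\, f,\ \mathrm{supp}\, g\subset\{x:|x|\le 1\}$. Then there exist a constant $\varepsilon_0=\varepsilon_0(f,g,n,p,\mu,\beta)>0$ and a constant $C>0$ independent of $\varepsilon$ such that the following holds. For every $0<\varepsilon\le\varepsilon_0$, if $u$ is an energy solution on $[0,T)$ of $$u_{tt}-\Delta u+\frac{\mu}{(1+|x|)^\beta}u_t=|u_t|^p,\qquad u(0,x)=\varepsilon f(x),\quad u_t(0,x)=\varepsilon g(x),$$ satisfying $$\mathrm{supp}\, u\subset\{(x,t)\in\mathbf{R}^n\times[0,T):|x|\le t+1\},$$ then $$T\le\begin{cases} C\varepsilon^{-\left(\frac{1}{p-1}-\frac{n-1}{2}\right)^{-1}} & \text{if } 1<p<p_G(n),\\[2pt] \exp\left(C\varepsilon^{-(p-1)}\right) & \text{if } p=p_G(n).\end{cases}$$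
   Context: The Glassey exponent is $p_G(n)=\frac{n+1}{n-1}$ for $n\ge2$ and $p_G(1)=\infty$. Energy solution: $u$ is an energy solution on $[0,T)$ of the Cauchy problem $u_{tt}-\Delta u+\frac{\mu}{(1+|x|)^\beta}u_t=|u_t|^p$ in $[0,T)\times\mathbf{R}^n$, $u(0,x)=\varepsilon f(x)$, $u_t(0,x)=\varepsilon g(x)$, if $$u\in C([0,T),H^1(\mathbf{R}^n))\cap C^1([0,T),L^2(\mathbf{R}^n)),\qquad u_t\in L^p_{\rm loc}(\mathbf{R}^n\times(0,T)),$$ satisfies $u(0,x)=\varepsilon f(x)$, $u_t(0,x)=\varepsilon g(x)$ and $$\varepsilon\int_{\mathbf{R}^n}g(x)\Psi(0,x)\,dx+\varepsilon\int_{\mathbf{R}^n}\frac{\mu}{(1+|x|)^\beta}f(x)\Psi(0,x)\,dx+\int_0^T\!\int_{\mathbf{R}^n}|u_t|^p\Psi\,dx\,dt$$ $$=-\int_0^T\!\int_{\mathbf{R}^n}u_t\Psi_t\,dx\,dt+\int_0^T\!\int_{\mathbf{R}^n}\nabla u\cdot\nabla\Psi\,dx\,dt-\int_0^T\!\int_{\mathbf{R}^n}\frac{\mu}{(1+|x|)^\beta}u\,\Psi_t\,dx\,dt$$ for every $\Psi\in C_0^\infty([0,T)\times\mathbf{R}^n)$ (all integrals being understood as convergent). *)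

theory Defs
  imports "HOL-Analysis.Analysis"
begin

text \<open>Points of $\mathbf{R}^n$ are elements of a type of class \<open>euclidean_space\<close> of dimension $n$;
  space-time points are pairs \<open>(t, x)\<close>. Elements of $L^2$ and $H^1$ are represented by functions;
  equality, sign and support are understood almost everywhere.\<close>


subsection \<open>Smooth functions and test functions\<close>

definition pderivative :: "'a \<Rightarrow> ('a::euclidean_space \<Rightarrow> real) \<Rightarrow> 'a \<Rightarrow> real" where
  "pderivative b f = (\<lambda>x. frechet_derivative f (at x) b)"

primrec C_k :: "nat \<Rightarrow> ('a::euclidean_space \<Rightarrow> real) \<Rightarrow> bool" where
  "C_k 0 f \<longleftrightarrow> continuous_on UNIV f"
| "C_k (Suc k) f \<longleftrightarrow>
     (\<forall>x. f differentiable (at x)) \<and> (\<forall>b\<in>Basis. C_k k (pderivative b f))"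

definition smooth :: "('a::euclidean_space \<Rightarrow> real) \<Rightarrow> bool" where
  "smooth f \<longleftrightarrow> (\<forall>k. C_k k f)"

definition test_function :: "'a::euclidean_space set \<Rightarrow> ('a \<Rightarrow> real) \<Rightarrow> bool" where
  "test_function S \<phi> \<longleftrightarrow>
     smooth \<phi> \<and> compact (closure {x. \<phi> x \<noteq> 0}) \<and> closure {x. \<phi> x \<noteq> 0} \<subseteq> S"


subsection \<open>Lebesgue and Sobolev spaces\<close>

definition L2 :: "('a::euclidean_space \<Rightarrow> 'b::euclidean_space) set" where
  "L2 = {f. f \<in> borel_measurable lebesgue \<and> integrable lebesgue (\<lambda>x. (norm (f x))\<^sup>2)}"

definition L2_norm :: "('a::euclidean_space \<Rightarrow> 'b::euclidean_space) \<Rightarrow> real" where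
  "L2_norm f = sqrt (LINT x|lebesgue. (norm (f x))\<^sup>2)"

definition has_weak_gradient :: "('a::euclidean_space \<Rightarrow> real) \<Rightarrow> ('a \<Rightarrow> 'a) \<Rightarrow> bool" where
  "has_weak_gradient f G \<longleftrightarrow>
     (\<forall>\<phi>. test_function UNIV \<phi> \<longrightarrow> (\<forall>b\<in>Basis.
        (LINT x|lebesgue. f x * pderivative b \<phi> x) = - (LINT x|lebesgue. (G x \<bullet> b) * \<phi> x)))"

definition H1 :: "('a::euclidean_space \<Rightarrow> real) set" where
  "H1 = {f. f \<in> L2 \<and> (\<exists>G\<in>L2. has_weak_gradient f G)}"

text \<open>The weak gradient of an element of $H^1$, which is determined up to null sets.\<close>

definition weak_gradient :: "('a::euclidean_space \<Rightarrow> real) \<Rightarrow> 'a \<Rightarrow> 'a" where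
  "weak_gradient f = (SOME G. G \<in> L2 \<and> has_weak_gradient f G)"

definition H1_norm :: "('a::euclidean_space \<Rightarrow> real) \<Rightarrow> real" where
  "H1_norm f = sqrt ((L2_norm f)\<^sup>2 + (L2_norm (weak_gradient f))\<^sup>2)"

definition Lp_loc :: "real \<Rightarrow> 'a::euclidean_space set \<Rightarrow> ('a \<Rightarrow> real) set" where
  "Lp_loc p S = {f. f \<in> borel_measurable (lebesgue_on S) \<and>
     (\<forall>K. compact K \<and> K \<subseteq> S \<longrightarrow> set_integrable lebesgue K (\<lambda>x. \<bar>f x\<bar> powr p))}"

text \<open>The support, in \<open>S\<close>, of the almost-everywhere class of \<open>f\<close>.\<close>

definition ess_support_on ::
    "'a::euclidean_space set \<Rightarrow> ('a \<Rightarrow> 'b::zero) \<Rightarrow> 'a set" where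
  "ess_support_on S f =
     {x\<in>S. \<forall>U. open U \<and> x \<in> U \<longrightarrow> \<not> (AE y in lebesgue. y \<in> U \<inter> S \<longrightarrow> f y = 0)}"


subsection \<open>Functions of time with values in $L^2$ and $H^1$\<close>

definition continuous_H1 :: "real set \<Rightarrow> (real \<Rightarrow> 'a::euclidean_space \<Rightarrow> real) \<Rightarrow> bool" where
  "continuous_H1 I u \<longleftrightarrow>
     (\<forall>t\<in>I. u t \<in> H1 \<and> ((\<lambda>s. H1_norm (\<lambda>x. u s x - u t x)) \<longlongrightarrow> 0) (at t within I))"

definition continuous_L2 :: "real set \<Rightarrow> (real \<Rightarrow> 'a::euclidean_space \<Rightarrow> real) \<Rightarrow> bool" where
  "continuous_L2 I u \<longleftrightarrow>
     (\<forall>t\<in>I. u t \<in> L2 \<and> ((\<lambda>s. L2_norm (\<lambda>x. u s x - u t x)) \<longlongrightarrow> 0) (at t within I))"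

text \<open>\<open>u\<close> is of class $C^1$ on \<open>I\<close> with values in $L^2$, with derivative \<open>v\<close>.\<close>

definition C1_L2 ::
    "real set \<Rightarrow> (real \<Rightarrow> 'a::euclidean_space \<Rightarrow> real) \<Rightarrow> (real \<Rightarrow> 'a \<Rightarrow> real) \<Rightarrow> bool" where
  "C1_L2 I u v \<longleftrightarrow> continuous_L2 I u \<and> continuous_L2 I v \<and>
     (\<forall>t\<in>I. ((\<lambda>s. L2_norm (\<lambda>x. (u s x - u t x) / (s - t) - v t x)) \<longlongrightarrow> 0) (at t within I))"


subsection \<open>Energy solutions\<close>

definition time_interval :: "ereal \<Rightarrow> real set" where
  "time_interval T = {t. 0 \<le> t \<and> ereal t < T}"

definition time_derivative :: "(real \<times> 'a::euclidean_space \<Rightarrow> real) \<Rightarrow> real \<times> 'a \<Rightarrow> real" where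
  "time_derivative \<Psi> = pderivative (1, 0) \<Psi>"

definition space_gradient :: "(real \<times> 'a::euclidean_space \<Rightarrow> real) \<Rightarrow> real \<times> 'a \<Rightarrow> 'a" where
  "space_gradient \<Psi> z = (\<Sum>b\<in>Basis. pderivative (0, b) \<Psi> z *\<^sub>R b)"

definition damping :: "real \<Rightarrow> real \<Rightarrow> 'a::euclidean_space \<Rightarrow> real" where
  "damping \<mu> \<beta> x = \<mu> / (1 + norm x) powr \<beta>"

text \<open>The weak form of the Cauchy problem, where \<open>v\<close> and \<open>G\<close> stand for $u_t$ and $\nabla u$.
  The class $C_0^\infty([0,T)\times\mathbf{R}^n)$ consists of the restrictions to $t\ge 0$ of
  functions in $C_0^\infty((-\infty,T)\times\mathbf{R}^n)$, so \<open>\<Psi>\<close> need not vanish at time 0.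
  The double integrals are Lebesgue integrals over space-time.\<close>

definition weak_form ::
    "real \<Rightarrow> real \<Rightarrow> real \<Rightarrow> real \<Rightarrow> ('a::euclidean_space \<Rightarrow> real) \<Rightarrow> ('a \<Rightarrow> real) \<Rightarrow> ereal \<Rightarrow>
     (real \<Rightarrow> 'a \<Rightarrow> real) \<Rightarrow> (real \<Rightarrow> 'a \<Rightarrow> real) \<Rightarrow> (real \<Rightarrow> 'a \<Rightarrow> 'a) \<Rightarrow> bool" where
  "weak_form \<mu> \<beta> p \<epsilon> f g T u v G \<longleftrightarrow>
     (let Q = time_interval T \<times> UNIV in
      \<forall>\<Psi>. test_function {(t, x). ereal t < T} \<Psi> \<longrightarrow>
        integrable lebesgue (\<lambda>x. g x * \<Psi> (0, x)) \<and>
        integrable lebesgue (\<lambda>x. damping \<mu> \<beta> x * f x * \<Psi> (0, x)) \<and>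
        set_integrable lebesgue Q (\<lambda>(t, x). \<bar>v t x\<bar> powr p * \<Psi> (t, x)) \<and>
        set_integrable lebesgue Q (\<lambda>(t, x). v t x * time_derivative \<Psi> (t, x)) \<and>
        set_integrable lebesgue Q (\<lambda>(t, x). G t x \<bullet> space_gradient \<Psi> (t, x)) \<and>
        set_integrable lebesgue Q (\<lambda>(t, x). damping \<mu> \<beta> x * u t x * time_derivative \<Psi> (t, x)) \<and>
        \<epsilon> * (LINT x|lebesgue. g x * \<Psi> (0, x))
          + \<epsilon> * (LINT x|lebesgue. damping \<mu> \<beta> x * f x * \<Psi> (0, x))
          + set_lebesgue_integral lebesgue Q (\<lambda>(t, x). \<bar>v t x\<bar> powr p * \<Psi> (t, x))
        = - set_lebesgue_integral lebesgue Q (\<lambda>(t, x). v t x * time_derivative \<Psi> (t, x))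
          + set_lebesgue_integral lebesgue Q (\<lambda>(t, x). G t x \<bullet> space_gradient \<Psi> (t, x))
          - set_lebesgue_integral lebesgue Q
              (\<lambda>(t, x). damping \<mu> \<beta> x * u t x * time_derivative \<Psi> (t, x)))"

text \<open>The functions \<open>u\<close>, \<open>v\<close> and \<open>G\<close> are representatives that are jointly measurable in
  \<open>(t, x)\<close>; every continuous curve in $L^2$ has such a representative, which may be
  prescribed to agree almost everywhere in \<open>x\<close> with the given curve at every time. The lifespan
  \<open>T\<close> is allowed to be infinite.\<close>

definition energy_solution ::
    "real \<Rightarrow> real \<Rightarrow> real \<Rightarrow> real \<Rightarrow> ('a::euclidean_space \<Rightarrow> real) \<Rightarrow> ('a \<Rightarrow> real) \<Rightarrow> ereal \<Rightarrow>
     (real \<Rightarrow> 'a \<Rightarrow> real) \<Rightarrow> bool" where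
  "energy_solution \<mu> \<beta> p \<epsilon> f g T u \<longleftrightarrow> 0 < T \<and>
     (let I = time_interval T in
      continuous_H1 I u \<and>
      (\<lambda>(t, x). u t x) \<in> borel_measurable (lebesgue_on (I \<times> UNIV)) \<and>
      (\<exists>v G.
         C1_L2 I u v \<and>
         (\<lambda>(t, x). v t x) \<in> borel_measurable (lebesgue_on (I \<times> UNIV)) \<and>
         (\<lambda>(t, x). v t x) \<in> Lp_loc p ({t. 0 < t \<and> ereal t < T} \<times> UNIV) \<and>
         (\<forall>t\<in>I. G t \<in> L2 \<and> has_weak_gradient (u t) (G t)) \<and>
         (\<lambda>(t, x). G t x) \<in> borel_measurable (lebesgue_on (I \<times> UNIV)) \<and>
         (AE x in lebesgue. u 0 x = \<epsilon> * f x) \<and>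
         (AE x in lebesgue. v 0 x = \<epsilon> * g x) \<and>
         weak_form \<mu> \<beta> p \<epsilon> f g T u v G))"


definition glassey_exponent :: "nat \<Rightarrow> ereal" where
  "glassey_exponent n = (if n = 1 then \<infinity> else ereal ((real n + 1) / (real n - 1)))"

end

theory Submission
  imports Defs "HOL-Computational_Algebra.Polynomial"
begin

text \<open>Let $a(x) = \mu (1+|x|)^{-\beta}$ and let $\phi > 0$ be radial with $\Delta\phi = (1 + a)\phi$, so that
  $e^{-t}\phi$ solves the adjoint linear equation. For a cutoff $\eta(t)$ put $K = e^{-t}\eta$ and test the
  equation with $-K'(t)\phi(x)$. Integrating by parts in time removes $u$ in favour of $u_t$, and all
  remaining terms contain a derivative of $\eta$:
  \[ \varepsilon \int (g + (1+a) f)\phi + \int\!\!\int |u_t|^p (-K')\phi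
     = \int\!\!\int u_t\, e^{-t} (\eta'' - (2 + a)\eta')\phi . \]
  If $|\eta'| + |\eta''| \le B(t)\,\eta^{1/p}$, then Young's inequality absorbs the right-hand side up to a multiple
  of $\int B^{p'} e^{-t} \int_{|x|\le t+1} \phi \,dx\,dt$. The function
  $e^{r - \kappa/(1+r)} (1+r)^{-(n-1)/2}$ is a supersolution because $\beta \ge 2$, whence
  $\int_{|x|\le t+1}\phi \lesssim (1+t)^{(n-1)/2} e^t$, and
  $\varepsilon \lesssim \int_0^M B^{p'} (1+t)^{(n-1)/2} dt$ for every $M < T$. The choice $B \sim 1/M$ gives
  the subcritical bound, and $B \sim 1/((1+t) \log M)$, which comes from a cutoff in $\log t$, the critical one.
  Since $a$ is not smooth at the origin, $\phi$ is replaced by polynomials in $|x|^2$ that solve the equation on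
  $|x| \le M+2$ up to an arbitrarily small error.\<close>

subsection \<open>Smooth functions and cutoffs\<close>

text \<open>Testing with K \<Phi> would leave terms in u itself, which |u_t|^p cannot absorb. With
  -K' \<Phi> every term in u carries a t-derivative of K that can be moved onto u; of the initial
  values this produces, one cancels the damping datum and the other has a favourable sign. Moreover
  -K' = e^{-t} (\<eta> - \<eta>') is at least e^{-t} \<eta>, because \<eta> decreases, and this is
  what pays for the Young term. The damping is so weak at infinity that it changes \<phi> only by a
  bounded factor: the corrector e^{-\<kappa>/(1+r)} lies between two positive constants, so \<phi>
  is allowed no faster growth than e^r (1+r)^{-(n-1)/2}, as without damping. The error of the
  polynomial approximation enters as \<delta> times an integral of |u_t| over a compact region. That
  integral depends on the solution but not on \<delta>, so letting \<delta> tend to 0 for a fixed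
  solution leaves a constant that does not depend on the solution. Since p' - 1 = 1/(p - 1), the
  condition p \<le> p_G says p' \<ge> (n-1)/2 + 1, so the power of M left by the first choice of B
  is negative or, at p_G, zero; only then is the logarithm needed.\<close>

lemma pderivative_eq:
  assumes "(f has_derivative f') (at x)"
  shows "pderivative b f x = f' b"
  using frechet_derivative_at[OF assms] by (simp add: pderivative_def)

text \<open>\<open>frechet_derivative\<close> is defined by choice; any derivative found by the
  calculus rules may stand in for it here, so the closure properties become inductions on explicit
  derivative formulas.\<close>

lemma C_k_SucI:
  assumes "\<And>x. (f has_derivative f' x) (at x)"
    and "\<And>b. b \<in> Basis \<Longrightarrow> C_k k (\<lambda>x. f' x b)"
  shows "C_k (Suc k) f"
proof -
  have "pderivative b f = (\<lambda>x. f' x b)" for b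
    using pderivative_eq[OF assms(1)] by fast
  then show ?thesis
    using assms by (auto simp: differentiable_def)
qed

lemma C_k_continuous: "C_k k f \<Longrightarrow> continuous_on UNIV f"
  by (cases k) (auto intro!: continuous_at_imp_continuous_on differentiable_imp_continuous_within)

text \<open>\<open>C_k (Suc k) f\<close> asks for \<open>C_k k\<close> of the derivatives, not of f,
  so the descent needs an induction. The product and chain rules use it for the factor left
  undifferentiated.\<close>

lemma C_k_SucD: "C_k (Suc k) f \<Longrightarrow> C_k k f"
proof (induction k arbitrary: f)
  case 0
  then show ?case using C_k_continuous[of "Suc 0" f] by simp
next
  case (Suc k)
  then show ?case by (metis C_k.simps(2))
qed

lemma C_k_derivative:
  assumes "C_k (Suc k) f"
  shows "(f has_derivative frechet_derivative f (at x)) (at x)"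
    and "b \<in> Basis \<Longrightarrow> C_k k (\<lambda>x. frechet_derivative f (at x) b)"
  using assms frechet_derivative_works by (auto simp: pderivative_def)

lemma C_k_const: "C_k k (\<lambda>_. c)"
proof (induction k arbitrary: c)
  case (Suc k)
  show ?case by (rule C_k_SucI[OF has_derivative_const]) (rule Suc)
qed simp

lemma C_k_add: "C_k k f \<Longrightarrow> C_k k g \<Longrightarrow> C_k k (\<lambda>x. f x + g x)"
proof (induction k arbitrary: f g)
  case 0
  then show ?case by (auto intro: continuous_intros)
next
  case (Suc k)
  show ?case
    by (rule C_k_SucI[OF has_derivative_add[OF C_k_derivative(1)[OF Suc.prems(1)]
            C_k_derivative(1)[OF Suc.prems(2)]]])
       (intro Suc.IH C_k_derivative(2)[OF Suc.prems(1)] C_k_derivative(2)[OF Suc.prems(2)])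
qed

lemma C_k_mult: "C_k k f \<Longrightarrow> C_k k g \<Longrightarrow> C_k k (\<lambda>x. f x * g x)"
proof (induction k arbitrary: f g)
  case 0
  then show ?case by (auto intro: continuous_intros)
next
  case (Suc k)
  show ?case
    by (rule C_k_SucI[OF has_derivative_mult[OF C_k_derivative(1)[OF Suc.prems(1)]
            C_k_derivative(1)[OF Suc.prems(2)]]])
       (intro C_k_add Suc.IH C_k_derivative(2)[OF Suc.prems(1)] C_k_derivative(2)[OF Suc.prems(2)]
          C_k_SucD[OF Suc.prems(1)] C_k_SucD[OF Suc.prems(2)])
qed

lemma C_k_linear:
  assumes "bounded_linear f"
  shows "C_k k f"
proof (cases k)
  case 0
  then show ?thesis
    using assms by (simp add: linear_continuous_on)
next
  case (Suc j)
  show ?thesis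
    unfolding Suc using bounded_linear_imp_has_derivative[OF assms]
    by (rule C_k_SucI) (rule C_k_const)
qed

lemma C_k_norm_square: "C_k k (\<lambda>x. x \<bullet> x)"
proof (cases k)
  case 0
  then show ?thesis by (auto intro: continuous_intros)
next
  case (Suc j)
  have "((\<lambda>x. x \<bullet> x) has_derivative (\<lambda>h. 2 * (x \<bullet> h))) (at x)" for x :: 'a
    by (auto intro!: derivative_eq_intros simp: inner_commute)
  then show ?thesis
    unfolding Suc
    by (rule C_k_SucI) (intro C_k_mult C_k_const C_k_linear bounded_linear_inner_left)
qed

lemma C_k_fst:
  fixes f :: "'a::euclidean_space \<Rightarrow> real"
  shows "C_k k f \<Longrightarrow> C_k k (\<lambda>z::'a \<times> 'b::euclidean_space. f (fst z))"
proof (induction k arbitrary: f)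
  case 0
  then show ?case
    by (auto intro!: continuous_on_compose2[OF _ continuous_on_fst[OF continuous_on_id]])
next
  case (Suc k)
  have d: "((\<lambda>z::'a \<times> 'b. f (fst z)) has_derivative
      (\<lambda>h. frechet_derivative f (at (fst z)) (fst h))) (at z)" for z
    by (rule has_derivative_compose[OF has_derivative_fst[OF has_derivative_ident]
          C_k_derivative(1)[OF Suc.prems]])
  \<comment> \<open>A basis vector of the product has first component in \<open>Basis\<close> or 0;
    the second kind gives derivative 0 by linearity.\<close>
  have z: "frechet_derivative f (at x) 0 = 0" for x
    using C_k_derivative(1)[OF Suc.prems] by (metis has_derivative_zero_unique linear_0 has_derivative_linear)
  show ?case
  proof (rule C_k_SucI[OF d])
    fix b :: "'a \<times> 'b" assume "b \<in> Basis"
    then consider "fst b \<in> Basis" | "fst b = 0"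
      by (auto simp: Basis_prod_def)
    then show "C_k k (\<lambda>z::'a \<times> 'b. frechet_derivative f (at (fst z)) (fst b))"
      by cases (auto simp: z C_k_const intro: Suc.IH C_k_derivative(2)[OF Suc.prems])
  qed
qed

lemma C_k_snd:
  fixes f :: "'b::euclidean_space \<Rightarrow> real"
  shows "C_k k f \<Longrightarrow> C_k k (\<lambda>z::'a::euclidean_space \<times> 'b. f (snd z))"
proof (induction k arbitrary: f)
  case 0
  then show ?case
    by (auto intro!: continuous_on_compose2[OF _ continuous_on_snd[OF continuous_on_id]])
next
  case (Suc k)
  have d: "((\<lambda>z::'a \<times> 'b. f (snd z)) has_derivative
      (\<lambda>h. frechet_derivative f (at (snd z)) (snd h))) (at z)" for z
    by (rule has_derivative_compose[OF has_derivative_snd[OF has_derivative_ident]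
          C_k_derivative(1)[OF Suc.prems]])
  have z: "frechet_derivative f (at x) 0 = 0" for x
    using C_k_derivative(1)[OF Suc.prems] by (metis linear_0 has_derivative_linear)
  show ?case
  proof (rule C_k_SucI[OF d])
    fix b :: "'a \<times> 'b" assume "b \<in> Basis"
    then consider "snd b \<in> Basis" | "snd b = 0"
      by (auto simp: Basis_prod_def)
    then show "C_k k (\<lambda>z::'a \<times> 'b. frechet_derivative f (at (snd z)) (snd b))"
      by cases (auto simp: z C_k_const intro: Suc.IH C_k_derivative(2)[OF Suc.prems])
  qed
qed

lemma has_derivative_real_compose:
  assumes "(f has_derivative f') (at x)" "(h has_real_derivative d) (at (f x))"
  shows "((\<lambda>x. h (f x)) has_derivative (\<lambda>y. d * f' y)) (at x)"
  using has_derivative_compose[OF assms(1) assms(2)[unfolded has_field_derivative_def]] by simp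

lemma C_k_exp: "C_k k f \<Longrightarrow> C_k k (\<lambda>x. exp (f x))"
proof (induction k)
  case 0
  then show ?case by (auto intro: continuous_intros)
next
  case (Suc k)
  show ?case
    by (rule C_k_SucI[OF has_derivative_real_compose[OF C_k_derivative(1)[OF Suc.prems] DERIV_exp]])
       (intro C_k_mult Suc.IH C_k_SucD[OF Suc.prems] C_k_derivative(2)[OF Suc.prems])
qed

lemma C_k_inverse:
  assumes nz: "\<And>x. f x \<noteq> 0"
  shows "C_k k f \<Longrightarrow> C_k k (\<lambda>x. inverse (f x))"
proof (induction k)
  case 0
  then show ?case using nz by (auto intro: continuous_intros)
next
  case (Suc k)
  have I: "C_k k (\<lambda>x. inverse (f x))"
    by (rule Suc.IH[OF C_k_SucD[OF Suc.prems]])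
  have "C_k k (\<lambda>x. (- 1) * (inverse (f x) * inverse (f x)) * frechet_derivative f (at x) b)"
    if "b \<in> Basis" for b
    by (intro C_k_mult C_k_const I C_k_derivative(2)[OF Suc.prems that])
  then show ?case
    by (intro C_k_SucI[OF has_derivative_real_compose[OF C_k_derivative(1)[OF Suc.prems] DERIV_inverse[OF nz]]])
       (simp add: power2_eq_square)
qed

lemma C_k_ln:
  assumes pos: "\<And>x. f x > 0"
  shows "C_k k f \<Longrightarrow> C_k k (\<lambda>x. ln (f x))"
proof (cases k)
  case 0
  assume "C_k k f"
  then show ?thesis
    unfolding 0 C_k.simps by (intro continuous_intros) (auto simp: pos less_imp_neq[symmetric])
next
  case (Suc j)
  assume *: "C_k k f"
  have nz: "\<And>x. f x \<noteq> 0" using pos by (metis less_irrefl)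
  show ?thesis
    unfolding Suc
    by (rule C_k_SucI[OF has_derivative_real_compose[OF C_k_derivative(1)[OF *[unfolded Suc]] DERIV_ln[OF pos]]])
       (intro C_k_mult C_k_inverse nz C_k_SucD[OF *[unfolded Suc]] C_k_derivative(2)[OF *[unfolded Suc]])
qed

lemma C_k_poly: "C_k k f \<Longrightarrow> C_k k (\<lambda>x. poly P (f x))"
  by (induction P) (auto intro: C_k_const C_k_add C_k_mult)

section \<open>Functions flat at the origin, built from exp(-1/z)\<close>

definition bump :: "real poly \<Rightarrow> real \<Rightarrow> real" where
  "bump Q z = (if z > 0 then poly Q (1 / z) * exp (- (1 / z)) else 0)"

text \<open>With y = 1/z, the z-derivative of Q(y) e^{-y} is y^2 (Q - Q')(y) e^{-y}. Hence the
  family \<open>bump Q\<close> is closed under differentiation, and its smoothness is an induction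
  over all Q at once.\<close>

definition bump_deriv :: "real poly \<Rightarrow> real poly" where
  "bump_deriv Q = monom 1 2 * (Q - pderiv Q)"

text \<open>Horner induction: the rate c is halved at each step, and one half pays for the extra
  factor y. The freedom in c is needed because \<open>bump_le_root\<close> takes c = 1 -
  1/p.\<close>

lemma poly_le_exp:
  fixes Q :: "real poly"
  assumes "c > 0"
  shows "\<exists>D>0. \<forall>y\<ge>0. \<bar>poly Q y\<bar> \<le> D * exp (c * y)"
  using assms
proof (induction Q arbitrary: c)
  case 0
  then show ?case by (intro exI[of _ 1]) auto
next
  case (pCons a P)
  obtain D where D: "D > 0" "\<And>y. y \<ge> 0 \<Longrightarrow> \<bar>poly P y\<bar> \<le> D * exp (c / 2 * y)"
    using pCons.IH[of "c / 2"] pCons.prems by auto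
  have "\<bar>poly (pCons a P) y\<bar> \<le> (\<bar>a\<bar> + 2 * D / c) * exp (c * y)" if y: "y \<ge> 0" for y
  proof -
    have "c / 2 * y \<le> exp (c / 2 * y)"
      using exp_ge_add_one_self[of "c / 2 * y"] by linarith
    then have 1: "y \<le> 2 / c * exp (c / 2 * y)"
      using pCons.prems by (simp add: field_simps)
    have "\<bar>poly (pCons a P) y\<bar> \<le> \<bar>a\<bar> + y * \<bar>poly P y\<bar>"
      using y abs_triangle_ineq[of a "y * poly P y"] by (simp add: abs_mult)
    also have "\<dots> \<le> \<bar>a\<bar> + (2 / c * exp (c / 2 * y)) * (D * exp (c / 2 * y))"
      using D(2)[OF y] 1 y D(1) by (intro add_left_mono mult_mono) auto
    also have "\<dots> = \<bar>a\<bar> + 2 * D / c * exp (c * y)"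
      by (simp add: mult_exp_exp)
    also have "\<dots> \<le> (\<bar>a\<bar> + 2 * D / c) * exp (c * y)"
      using y pCons.prems by (simp add: distrib_right mult_le_cancel_left1)
    finally show ?thesis .
  qed
  moreover have "\<bar>a\<bar> + 2 * D / c > 0"
    using D(1) pCons.prems by (simp add: add_nonneg_pos)
  ultimately show ?case by blast
qed

lemma bump_tendsto_0: "(bump Q \<longlongrightarrow> 0) (at 0)"
proof -
  obtain D where D: "D > 0" "\<And>y. y \<ge> 0 \<Longrightarrow> \<bar>poly Q y\<bar> \<le> D * exp (1 / 2 * y)"
    using poly_le_exp[of "1 / 2" Q] by auto
  have R: "(bump Q \<longlongrightarrow> 0) (at_right 0)"
  proof (rule Lim_null_comparison)
    show "\<forall>\<^sub>F z in at_right 0. norm (bump Q z) \<le> D * exp (- (1 / 2 * inverse z))"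
    proof (rule eventually_at_right_less[THEN eventually_mono])
      fix z :: real assume z: "0 < z"
      have "norm (bump Q z) \<le> D * exp (1 / 2 * (1 / z)) * exp (- (1 / z))"
        using D(2)[of "1 / z"] z by (simp add: bump_def abs_mult)
      also have "\<dots> = D * exp (- (1 / 2 * inverse z))"
        by (simp add: mult.assoc mult_exp_exp field_simps)
      finally show "norm (bump Q z) \<le> D * exp (- (1 / 2 * inverse z))" .
    qed
    have "filterlim (\<lambda>z::real. 1 / 2 * inverse z) at_top (at_right 0)"
      by (intro filterlim_tendsto_pos_mult_at_top[OF tendsto_const _ filterlim_inverse_at_top_right]) simp
    then have "((\<lambda>z::real. exp (- (1 / 2 * inverse z))) \<longlongrightarrow> 0) (at_right 0)"
      by (intro filterlim_compose[OF exp_at_bot] filterlim_compose[OF filterlim_uminus_at_bot_at_top])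
    then show "((\<lambda>z::real. D * exp (- (1 / 2 * inverse z))) \<longlongrightarrow> 0) (at_right 0)"
      by (rule tendsto_mult_right_zero)
  qed
  have L: "(bump Q \<longlongrightarrow> 0) (at_left 0)"
    by (rule tendsto_eventually) (auto simp: bump_def eventually_at_left_field intro!: exI[of _ "-1"])
  show ?thesis
    using L R by (simp add: filterlim_at_split)
qed

lemma bump_has_derivative: "(bump Q has_real_derivative bump (bump_deriv Q) z) (at z)"
proof (cases z "0::real" rule: linorder_cases)
  case less
  have "((\<lambda>_. 0) has_real_derivative bump (bump_deriv Q) z) (at z)"
    using less by (simp add: bump_def)
  then show ?thesis
    by (rule has_field_derivative_transform_within_open[where S = "{..<0}"])
       (use less in \<open>auto simp: bump_def\<close>)
next
  case equal
  \<comment> \<open>Division by h shifts the polynomial: the quotient is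
    \<open>bump (pCons 0 Q) h\<close>, which tends to 0 as well.\<close>
  have "((\<lambda>h. (bump Q h - bump Q 0) / (h - 0)) \<longlongrightarrow> 0) (at 0)"
    using bump_tendsto_0[of "pCons 0 Q"]
    by (rule Lim_transform_eventually) (auto simp: bump_def eventually_at_filter)
  then show ?thesis
    unfolding equal has_field_derivative_iff by (simp add: bump_def)
next
  case greater
  have "((\<lambda>z. poly Q (1 / z) * exp (- (1 / z))) has_real_derivative bump (bump_deriv Q) z) (at z)"
    using greater
    by (auto intro!: derivative_eq_intros DERIV_chain2[OF poly_DERIV]
        simp: bump_def bump_deriv_def poly_monom power2_eq_square field_simps)
  then show ?thesis
    by (rule has_field_derivative_transform_within_open[where S = "{0<..}"])
       (use greater in \<open>auto simp: bump_def\<close>)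
qed

lemma C_k_bump: "C_k k f \<Longrightarrow> C_k k (\<lambda>x. bump Q (f x))"
proof (induction k arbitrary: Q)
  case 0
  have "continuous_on UNIV (bump Q)"
    by (intro DERIV_continuous_on[OF has_field_derivative_at_within[OF bump_has_derivative]])
  then show ?case
    using 0 continuous_on_compose2[of UNIV "bump Q" UNIV f] by auto
next
  case (Suc k)
  show ?case
    by (rule C_k_SucI[OF has_derivative_real_compose[OF C_k_derivative(1)[OF Suc.prems] bump_has_derivative]])
       (intro C_k_mult Suc.IH C_k_SucD[OF Suc.prems] C_k_derivative(2)[OF Suc.prems])
qed

lemma bump_nonneg: "bump 1 z \<ge> 0"
  by (simp add: bump_def)

lemma bump_eq_0: "z \<le> 0 \<Longrightarrow> bump Q z = 0"
  by (simp add: bump_def)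

lemma bump_1_1: "bump 1 1 = exp (- 1)"
  by (simp add: bump_def)

lemma bump_mono: "z \<le> w \<Longrightarrow> bump 1 z \<le> bump 1 w"
  by (auto simp: bump_def field_simps)

text \<open>For p > 1, exp(-1/z) is its own p-th root times the surplus exp(-(1 - 1/p)/z), and the
  surplus beats any polynomial in 1/z. The factor \<open>exp 1\<close> anticipates the normalisation
  of the cutoff to the value 1 at z = 1.\<close>

lemma bump_le_root:
  assumes p: "p > 1"
  shows "\<exists>D>0. \<forall>z\<le>1. \<bar>bump Q z\<bar> \<le> D * (exp 1 * bump 1 z) powr (1 / p)"
proof -
  obtain D where D: "D > 0" "\<And>y. y \<ge> 0 \<Longrightarrow> \<bar>poly Q y\<bar> \<le> D * exp ((1 - 1 / p) * y)"
    using poly_le_exp[of "1 - 1 / p" Q] p by auto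
  have "\<bar>bump Q z\<bar> \<le> D * (exp 1 * bump 1 z) powr (1 / p)" if "z \<le> 1" for z
  proof (cases "z > 0")
    case True
    have "\<bar>bump Q z\<bar> \<le> D * exp ((1 - 1 / p) * (1 / z)) * exp (- (1 / z))"
      using D(2)[of "1 / z"] True by (simp add: bump_def abs_mult)
    also have "\<dots> = D * exp (- (1 / z) * (1 / p))"
      unfolding mult.assoc mult_exp_exp by (simp add: algebra_simps)
    also have "\<dots> \<le> D * exp ((1 - 1 / z) * (1 / p))"
      using D(1) p by (intro mult_left_mono iffD2[OF exp_le_cancel_iff] mult_right_mono) auto
    also have "\<dots> = D * (exp 1 * bump 1 z) powr (1 / p)"
      using True by (simp add: bump_def mult_exp_exp powr_def)
    finally show ?thesis .
  qed (simp add: bump_def)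
  with D(1) show ?thesis by blast
qed

text \<open>The last condition is what allows Young's inequality to absorb the derivatives of the cutoff.\<close>

definition time_cutoff ::
    "real \<Rightarrow> real \<Rightarrow> (real \<Rightarrow> real) \<Rightarrow> (real \<Rightarrow> real) \<Rightarrow> (real \<Rightarrow> real) \<Rightarrow> (real \<Rightarrow> real) \<Rightarrow> bool" where
  "time_cutoff p M B \<eta> \<eta>1 \<eta>2 \<longleftrightarrow> smooth \<eta> \<and>
     (\<forall>t. (\<eta> has_real_derivative \<eta>1 t) (at t)) \<and> (\<forall>t. (\<eta>1 has_real_derivative \<eta>2 t) (at t)) \<and>
     \<eta> 0 = 1 \<and> \<eta>1 0 = 0 \<and> (\<forall>t. 0 \<le> \<eta> t \<and> \<eta> t \<le> 1) \<and> (\<forall>t. M \<le> \<bar>t\<bar> \<longrightarrow> \<eta> t = 0) \<and>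
     (\<forall>t\<ge>0. \<eta>1 t \<le> 0) \<and> (\<forall>t\<ge>0. \<bar>\<eta>1 t\<bar> + \<bar>\<eta>2 t\<bar> \<le> B t * \<eta> t powr (1 / p))"

section \<open>Time cutoffs built from a gauge function\<close>

lemma time_cutoff_bump:
  assumes p: "p > 1"
  obtains D where "D > 0" and "\<And>M c b l l1 l2. 0 \<le> c \<Longrightarrow> smooth l \<Longrightarrow>
     (\<And>t. (l has_real_derivative l1 t) (at t)) \<Longrightarrow> (\<And>t. (l1 has_real_derivative l2 t) (at t)) \<Longrightarrow>
     l 0 = 0 \<Longrightarrow> l1 0 = 0 \<Longrightarrow> (\<And>t. 0 \<le> l t) \<Longrightarrow> (\<And>t. t\<ge>0 \<Longrightarrow> 0 \<le> l1 t) \<Longrightarrow>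
     (\<And>t. M \<le> \<bar>t\<bar> \<Longrightarrow> 1 \<le> c * l t) \<Longrightarrow>
     (\<And>t. 0 \<le> t \<Longrightarrow> c * l t < 1 \<Longrightarrow> c * l1 t \<le> b t \<and> c * \<bar>l2 t\<bar> \<le> b t \<and> b t \<le> 8) \<Longrightarrow>
     (\<And>t. 0 \<le> t \<Longrightarrow> 0 \<le> b t) \<Longrightarrow>
     \<exists>\<eta> \<eta>1 \<eta>2. time_cutoff p M (\<lambda>t. D * b t) \<eta> \<eta>1 \<eta>2"
proof -
  define Q1 where "Q1 = bump_deriv 1"
  define Q2 where "Q2 = bump_deriv Q1"
  obtain D1 where D1: "D1 > 0" "\<And>z. z \<le> 1 \<Longrightarrow> \<bar>bump Q1 z\<bar> \<le> D1 * (exp 1 * bump 1 z) powr (1 / p)"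
    using bump_le_root[OF p, of Q1] by auto
  obtain D2 where D2: "D2 > 0" "\<And>z. z \<le> 1 \<Longrightarrow> \<bar>bump Q2 z\<bar> \<le> D2 * (exp 1 * bump 1 z) powr (1 / p)"
    using bump_le_root[OF p, of Q2] by auto
  \<comment> \<open>D1 occurs once in \<eta>' and once in the l'' part of \<eta>''; the part with (c
    l')^2 is at most 8 b because c l' \<le> b \<le> 8.\<close>
  define D where "D = exp 1 * (2 * D1 + 8 * D2)"
  have D0: "D > 0" using D1(1) D2(1) by (auto simp: D_def intro!: mult_pos_pos)
  \<comment> \<open>\<open>bump_deriv 1\<close> is the polynomial y^2. Its sign is what makes the
    cutoff decrease for t \<ge> 0.\<close>
  have Q1nn: "bump Q1 z \<ge> 0" for z
    by (auto simp: bump_def Q1_def bump_deriv_def poly_monom)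
  show thesis
  proof (rule that[OF D0])
    fix M c :: real and b l l1 l2 :: "real \<Rightarrow> real"
    assume c: "0 \<le> c" and sl: "smooth l"
      and l1: "\<And>t. (l has_real_derivative l1 t) (at t)"
      and l2: "\<And>t. (l1 has_real_derivative l2 t) (at t)"
      and z: "l 0 = 0" "l1 0 = 0" and nn: "\<And>t. 0 \<le> l t" and nn1: "\<And>t. t \<ge> 0 \<Longrightarrow> 0 \<le> l1 t"
      and M: "\<And>t. M \<le> \<bar>t\<bar> \<Longrightarrow> 1 \<le> c * l t"
      and b: "\<And>t. 0 \<le> t \<Longrightarrow> c * l t < 1 \<Longrightarrow> c * l1 t \<le> b t \<and> c * \<bar>l2 t\<bar> \<le> b t \<and> b t \<le> 8"
      and b0: "\<And>t. 0 \<le> t \<Longrightarrow> 0 \<le> b t"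
    \<comment> \<open>At t = 0 the argument is 1 and \<eta> is e * e^{-1} = 1, with \<eta>' = 0
      because l' vanishes there; once c l \<ge> 1 the argument is nonpositive and \<eta> is 0 with
      all its derivatives.\<close>
    define \<eta> where "\<eta> t = exp 1 * bump 1 (1 - c * l t)" for t
    define \<eta>1 where "\<eta>1 t = - exp 1 * (bump Q1 (1 - c * l t) * (c * l1 t))" for t
    define \<eta>2 where "\<eta>2 t = exp 1 * (bump Q2 (1 - c * l t) * (c * l1 t)\<^sup>2 - bump Q1 (1 - c * l t) * (c * l2 t))" for t
    have d1: "(\<eta> has_real_derivative \<eta>1 t) (at t)" for t
      unfolding \<eta>_def \<eta>1_def Q1_def
      by (auto intro!: derivative_eq_intros DERIV_chain2[OF bump_has_derivative] l1)
    have d2: "(\<eta>1 has_real_derivative \<eta>2 t) (at t)" for t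
      unfolding \<eta>2_def \<eta>1_def Q2_def
      by (auto intro!: derivative_eq_intros DERIV_chain2[OF bump_has_derivative] l1 l2
          simp: power2_eq_square algebra_simps)
    have sm: "smooth \<eta>"
      unfolding smooth_def \<eta>_def
    proof (intro allI C_k_mult C_k_const C_k_bump)
      fix k
      have "C_k k (\<lambda>t. 1 + (- c) * l t)"
        using sl by (intro C_k_add C_k_mult C_k_const) (auto simp: smooth_def)
      then show "C_k k (\<lambda>t. 1 - c * l t)" by simp
    qed
    have le1: "1 - c * l t \<le> 1" for t using c nn by simp
    have \<eta>01: "0 \<le> \<eta> t" "\<eta> t \<le> 1" for t
    proof -
      have "exp 1 * bump 1 (1 - c * l t) \<le> exp 1 * bump 1 1"
        by (intro mult_left_mono bump_mono le1) auto
      then show "\<eta> t \<le> 1" by (simp add: \<eta>_def bump_1_1 mult_exp_exp)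
    qed (simp add: \<eta>_def bump_nonneg)
    have "\<bar>\<eta>1 t\<bar> + \<bar>\<eta>2 t\<bar> \<le> D * b t * \<eta> t powr (1 / p)" if t: "t \<ge> 0" for t
    proof (cases "c * l t < 1")
      case True
      note b' = b[OF t True]
      define r where "r = \<eta> t powr (1 / p)"
      have r0: "r \<ge> 0" by (simp add: r_def)
      have q1: "\<bar>bump Q1 (1 - c * l t)\<bar> \<le> D1 * r" and q2: "\<bar>bump Q2 (1 - c * l t)\<bar> \<le> D2 * r"
        using D1(2)[OF le1] D2(2)[OF le1] by (auto simp: r_def \<eta>_def)
      have l1b: "\<bar>c * l1 t\<bar> \<le> b t" using b' c nn1 t by simp
      have l2b: "\<bar>c * l2 t\<bar> \<le> b t" using b' c by (simp add: abs_mult)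
      have sq: "(c * l1 t)\<^sup>2 \<le> 8 * b t"
      proof -
        have "(c * l1 t)\<^sup>2 = \<bar>c * l1 t\<bar> * \<bar>c * l1 t\<bar>" by (simp add: power2_eq_square)
        also have "\<dots> \<le> 8 * b t"
          using l1b b' by (intro mult_mono) auto
        finally show ?thesis .
      qed
      have "\<bar>\<eta>1 t\<bar> = exp 1 * (\<bar>bump Q1 (1 - c * l t)\<bar> * \<bar>c * l1 t\<bar>)"
        by (simp add: \<eta>1_def abs_mult)
      also have "\<dots> \<le> exp 1 * (D1 * r * b t)"
        using D1(1) r0 by (intro mult_left_mono mult_mono q1 l1b) auto
      finally have 1: "\<bar>\<eta>1 t\<bar> \<le> exp 1 * (D1 * r * b t)" .
      have "\<bar>\<eta>2 t\<bar> \<le> exp 1 * (\<bar>bump Q2 (1 - c * l t)\<bar> * (c * l1 t)\<^sup>2 + \<bar>bump Q1 (1 - c * l t)\<bar> * \<bar>c * l2 t\<bar>)"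
        unfolding \<eta>2_def abs_mult[of "exp 1"] by (simp add: abs_mult[symmetric] order.trans[OF abs_triangle_ineq4])
           (metis abs_mult abs_power2 abs_triangle_ineq4)
      also have "\<dots> \<le> exp 1 * (D2 * r * (8 * b t) + D1 * r * b t)"
        using D1(1) D2(1) r0 by (intro mult_left_mono add_mono mult_mono q1 q2 l2b sq) auto
      finally have 2: "\<bar>\<eta>2 t\<bar> \<le> exp 1 * (D2 * r * (8 * b t) + D1 * r * b t)" .
      show ?thesis
        using 1 2 by (simp add: D_def r_def[symmetric] algebra_simps)
    next
      case False
      then show ?thesis
        using D0 b0 t by (simp add: \<eta>1_def \<eta>2_def bump_eq_0)
    qed
    then have "time_cutoff p M (\<lambda>t. D * b t) \<eta> \<eta>1 \<eta>2"
      unfolding time_cutoff_def using sm d1 d2 \<eta>01 M c nn1 Q1nn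
      by (auto simp: \<eta>_def \<eta>1_def z bump_1_1 mult_exp_exp bump_eq_0 intro!: mult_nonneg_nonneg)
    then show "\<exists>\<eta> \<eta>1 \<eta>2. time_cutoff p M (\<lambda>t. D * b t) \<eta> \<eta>1 \<eta>2" by blast
  qed
qed

text \<open>Gauge t^2 with c = 1/M^2: it is even, so it also cuts off at t \<le> -M, and it is
  critical at 0, so \<eta>'(0) = 0.\<close>

lemma time_cutoff_power:
  assumes p: "p > 1"
  shows "\<exists>D>0. \<forall>M\<ge>1. \<exists>\<eta> \<eta>1 \<eta>2. time_cutoff p M (\<lambda>t. D / M) \<eta> \<eta>1 \<eta>2"
proof (rule time_cutoff_bump[OF p])
  fix D :: real
  assume D: "D > 0" and cut: "\<And>M c b l l1 l2. 0 \<le> c \<Longrightarrow> smooth l \<Longrightarrow>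
     (\<And>t. (l has_real_derivative l1 t) (at t)) \<Longrightarrow> (\<And>t. (l1 has_real_derivative l2 t) (at t)) \<Longrightarrow>
     l 0 = 0 \<Longrightarrow> l1 0 = 0 \<Longrightarrow> (\<And>t. 0 \<le> l t) \<Longrightarrow> (\<And>t. t\<ge>0 \<Longrightarrow> 0 \<le> l1 t) \<Longrightarrow>
     (\<And>t. M \<le> \<bar>t\<bar> \<Longrightarrow> 1 \<le> c * l t) \<Longrightarrow>
     (\<And>t. 0 \<le> t \<Longrightarrow> c * l t < 1 \<Longrightarrow> c * l1 t \<le> b t \<and> c * \<bar>l2 t\<bar> \<le> b t \<and> b t \<le> 8) \<Longrightarrow>
     (\<And>t. 0 \<le> t \<Longrightarrow> 0 \<le> b t) \<Longrightarrow>
     \<exists>\<eta> \<eta>1 \<eta>2. time_cutoff p M (\<lambda>t. D * b t) \<eta> \<eta>1 \<eta>2"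
  have "\<exists>\<eta> \<eta>1 \<eta>2. time_cutoff p M (\<lambda>t. D * (2 / M)) \<eta> \<eta>1 \<eta>2" if M: "M \<ge> 1" for M
  proof (rule cut[where c = "1 / M\<^sup>2" and l = "\<lambda>t. t\<^sup>2" and ?l1.0 = "\<lambda>t. 2 * t" and ?l2.0 = "\<lambda>_. 2"])
    show "smooth (\<lambda>t::real. t\<^sup>2)"
      using C_k_norm_square[where 'a = real] by (simp add: smooth_def power2_eq_square)
    show "M \<le> \<bar>t\<bar> \<Longrightarrow> 1 \<le> 1 / M\<^sup>2 * t\<^sup>2" for t
      using M abs_le_square_iff[of M t] by (simp add: field_simps)
    show "1 / M\<^sup>2 * (2 * t) \<le> 2 / M \<and> 1 / M\<^sup>2 * \<bar>2\<bar> \<le> 2 / M \<and> 2 / M \<le> 8"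
      if "0 \<le> t" "1 / M\<^sup>2 * t\<^sup>2 < 1" for t
    proof -
      have "t\<^sup>2 < M\<^sup>2" using that M by (simp add: field_simps)
      then have "t < M" using M by (simp add: power2_less_imp_less)
      then show ?thesis using M that by (simp add: power2_eq_square field_simps)
    qed
  qed (use M in \<open>auto intro!: derivative_eq_intros\<close>)
  then show ?thesis
    using D by (intro exI[of _ "2 * D"]) (simp add: mult_ac)
qed

text \<open>Gauge ln(1 + t^2) with c = 1/L, L = ln(1 + M^2): the transition is spread over all
  scales up to M, which gains 1/L on a derivative of size 1/(1+t). Using t^2 inside the logarithm
  keeps the gauge even, smooth and critical at 0.\<close>

lemma time_cutoff_log:
  assumes p: "p > 1"
  shows "\<exists>D>0. \<forall>M\<ge>1. \<exists>\<eta> \<eta>1 \<eta>2. time_cutoff p M (\<lambda>t. D / ((1 + t) * ln (1 + M\<^sup>2))) \<eta> \<eta>1 \<eta>2"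
proof (rule time_cutoff_bump[OF p])
  fix D :: real
  assume D: "D > 0" and cut: "\<And>M c b l l1 l2. 0 \<le> c \<Longrightarrow> smooth l \<Longrightarrow>
     (\<And>t. (l has_real_derivative l1 t) (at t)) \<Longrightarrow> (\<And>t. (l1 has_real_derivative l2 t) (at t)) \<Longrightarrow>
     l 0 = 0 \<Longrightarrow> l1 0 = 0 \<Longrightarrow> (\<And>t. 0 \<le> l t) \<Longrightarrow> (\<And>t. t\<ge>0 \<Longrightarrow> 0 \<le> l1 t) \<Longrightarrow>
     (\<And>t. M \<le> \<bar>t\<bar> \<Longrightarrow> 1 \<le> c * l t) \<Longrightarrow>
     (\<And>t. 0 \<le> t \<Longrightarrow> c * l t < 1 \<Longrightarrow> c * l1 t \<le> b t \<and> c * \<bar>l2 t\<bar> \<le> b t \<and> b t \<le> 8) \<Longrightarrow>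
     (\<And>t. 0 \<le> t \<Longrightarrow> 0 \<le> b t) \<Longrightarrow>
     \<exists>\<eta> \<eta>1 \<eta>2. time_cutoff p M (\<lambda>t. D * b t) \<eta> \<eta>1 \<eta>2"
  have "\<exists>\<eta> \<eta>1 \<eta>2. time_cutoff p M (\<lambda>t. D * (4 / ((1 + t) * ln (1 + M\<^sup>2)))) \<eta> \<eta>1 \<eta>2"
    if M: "M \<ge> 1" for M
  proof -
    define L where "L = ln (1 + M\<^sup>2)"
    have "1 \<le> M\<^sup>2" using M by simp
    then have "ln 2 \<le> L" by (simp add: L_def)
    then have L: "L \<ge> 1 / 2" using ln2_ge_two_thirds by linarith
    have p1: "1 + t\<^sup>2 > 0" for t :: real by (simp add: add_pos_nonneg)
    have nz: "1 + t\<^sup>2 \<noteq> 0" for t :: real using p1[of t] by linarith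
    show ?thesis
      unfolding L_def[symmetric]
    proof (rule cut[where c = "1 / L" and l = "\<lambda>t. ln (1 + t\<^sup>2)" and ?l1.0 = "\<lambda>t. 2 * t / (1 + t\<^sup>2)"
          and ?l2.0 = "\<lambda>t. (2 - 2 * t\<^sup>2) / (1 + t\<^sup>2)\<^sup>2"])
      have "C_k k (\<lambda>t::real. 1 + t * t)" for k
        using C_k_norm_square[where 'a = real, of k] by (intro C_k_add C_k_const) simp
      then show "smooth (\<lambda>t::real. ln (1 + t\<^sup>2))"
        unfolding smooth_def power2_eq_square
        by (intro allI C_k_ln) (auto simp: add_pos_nonneg)
      show "((\<lambda>t. ln (1 + t\<^sup>2)) has_real_derivative 2 * t / (1 + t\<^sup>2)) (at t)" for t :: real
        using p1[of t] by (auto intro!: derivative_eq_intros)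
      show "((\<lambda>t. 2 * t / (1 + t\<^sup>2)) has_real_derivative (2 - 2 * t\<^sup>2) / (1 + t\<^sup>2)\<^sup>2) (at t)" for t :: real
        using nz[of t] by (auto intro!: derivative_eq_intros simp: power2_eq_square algebra_simps)
      show "M \<le> \<bar>t\<bar> \<Longrightarrow> 1 \<le> 1 / L * ln (1 + t\<^sup>2)" for t
        using M L abs_le_square_iff[of M t] p1 by (simp add: field_simps L_def)
      show "1 / L * (2 * t / (1 + t\<^sup>2)) \<le> 4 / ((1 + t) * L) \<and>
          1 / L * \<bar>(2 - 2 * t\<^sup>2) / (1 + t\<^sup>2)\<^sup>2\<bar> \<le> 4 / ((1 + t) * L) \<and> 4 / ((1 + t) * L) \<le> 8"
        if t: "0 \<le> t" for t
      proof (intro conjI)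
        have "2 * t / (1 + t\<^sup>2) \<le> 4 / (1 + t)"
        proof -
          have "4 * (1 + t\<^sup>2) - 2 * t * (1 + t) = (t - 1)\<^sup>2 + t\<^sup>2 + 3"
            by (simp add: power2_eq_square algebra_simps)
          then have "2 * t * (1 + t) \<le> 4 * (1 + t\<^sup>2)"
            using zero_le_power2[of "t - 1"] zero_le_power2[of t] by linarith
          then show ?thesis using t p1[of t] by (simp add: field_simps)
        qed
        then have "1 / L * (2 * t / (1 + t\<^sup>2)) \<le> 1 / L * (4 / (1 + t))"
          using L by (intro mult_left_mono) auto
        then show "1 / L * (2 * t / (1 + t\<^sup>2)) \<le> 4 / ((1 + t) * L)"
          by (simp add: mult.commute)
        have "\<bar>(2 - 2 * t\<^sup>2) / (1 + t\<^sup>2)\<^sup>2\<bar> \<le> 2 / (1 + t\<^sup>2)"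
        proof -
          have "\<bar>2 - 2 * t\<^sup>2\<bar> \<le> 2 * (1 + t\<^sup>2)" by (auto simp: abs_le_iff)
          then have "\<bar>2 - 2 * t\<^sup>2\<bar> / (1 + t\<^sup>2)\<^sup>2 \<le> 2 * (1 + t\<^sup>2) / (1 + t\<^sup>2)\<^sup>2"
            by (intro divide_right_mono) auto
          also have "2 * (1 + t\<^sup>2) / (1 + t\<^sup>2)\<^sup>2 = 2 / (1 + t\<^sup>2)"
            unfolding power2_eq_square[of "1 + t\<^sup>2"] using nz[of t]
            by (rule nonzero_mult_divide_mult_cancel_right)
          finally show ?thesis by (simp add: abs_divide)
        qed
        also have "\<dots> \<le> 4 / (1 + t)"
        proof -
          have "4 * (1 + t\<^sup>2) - 2 * (1 + t) = (t - 1)\<^sup>2 + 3 * t\<^sup>2 + 1"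
            by (simp add: power2_eq_square algebra_simps)
          then have "2 * (1 + t) \<le> 4 * (1 + t\<^sup>2)"
            using zero_le_power2[of "t - 1"] zero_le_power2[of t] by linarith
          then show ?thesis using t p1[of t] by (simp add: field_simps)
        qed
        finally have "1 / L * \<bar>(2 - 2 * t\<^sup>2) / (1 + t\<^sup>2)\<^sup>2\<bar> \<le> 1 / L * (4 / (1 + t))"
          using L by (intro mult_left_mono) auto
        then show "1 / L * \<bar>(2 - 2 * t\<^sup>2) / (1 + t\<^sup>2)\<^sup>2\<bar> \<le> 4 / ((1 + t) * L)"
          by (simp add: mult.commute)
        \<comment> \<open>L \<ge> 1/2 gives the bound 8; this is the origin of that constant in
          \<open>time_cutoff_bump\<close>.\<close>
        have "1 * (1 / 2) \<le> (1 + t) * L" using t L by (intro mult_mono) auto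
        then show "4 / ((1 + t) * L) \<le> 8"
          using t L by (simp add: field_simps)
      qed
    qed (use L in auto)
  qed
  then show ?thesis
    using D by (intro exI[of _ "4 * D"]) (simp add: mult_ac)
qed

subsection \<open>Radial approximate eigenfunctions\<close>

text \<open>The Laplacian on $\mathbf{R}^n$, acting on radial functions written as polynomials in $|x|^2$.\<close>

definition radial_laplacian :: "nat \<Rightarrow> real poly \<Rightarrow> real poly" where
  "radial_laplacian n P = smult 4 (monom 1 1 * pderiv (pderiv P)) + smult (2 * real n) (pderiv P)"

lemma radial_laplacian_diff:
  "radial_laplacian n (P - Q) = radial_laplacian n P - radial_laplacian n Q"
  by (simp add: radial_laplacian_def pderiv_diff algebra_simps smult_diff_right)

lemma radial_laplacian_add:
  "radial_laplacian n (P + Q) = radial_laplacian n P + radial_laplacian n Q"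
  by (simp add: radial_laplacian_def pderiv_add algebra_simps smult_add_right)

lemma radial_laplacian_const [simp]: "radial_laplacian n [:c:] = 0" "radial_laplacian n 0 = 0"
  by (simp_all add: radial_laplacian_def)

lemma radial_laplacian_smult: "radial_laplacian n (smult c P) = smult c (radial_laplacian n P)"
  by (simp add: radial_laplacian_def pderiv_smult smult_add_right mult.commute)

section \<open>Inverting the Laplacian on radial polynomials\<close>

lemma radial_laplacian_monom:
  "radial_laplacian n (monom 1 (Suc k)) = monom (real (Suc k) * (4 * real k + 2 * real n)) k"
proof -
  have 1: "pderiv (monom 1 (Suc k)) = monom (real (Suc k)) k"
    and 2: "pderiv (monom (real (Suc k)) k) = monom (real k * real (Suc k)) (k - 1)"
    by (simp_all add: pderiv_monom)
  show ?thesis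
  proof (cases k)
    case 0
    then show ?thesis unfolding radial_laplacian_def 1 2 smult_monom mult_monom by (simp add: monom_0)
  next
    case (Suc j)
    then show ?thesis unfolding radial_laplacian_def 1 2 smult_monom mult_monom
      by (simp add: add_monom) (simp add: algebra_simps)
  qed
qed

text \<open>Each monomial s^k is attained because its factor (k+1)(4k+2n) does not vanish for n
  \<ge> 1. Prescribing the value 0 at the origin keeps the Picard iterates equal to 1 there.\<close>

lemma radial_laplacian_solvable:
  assumes n: "n \<ge> 1"
  shows "\<exists>P. radial_laplacian n P = Q \<and> poly P 0 = 0"
proof -
  have "\<exists>P. radial_laplacian n P = (\<Sum>i<k. monom (coeff Q i) i) \<and> poly P 0 = 0" for k
  proof (induction k)
    case (Suc k)
    then obtain P where P: "radial_laplacian n P = (\<Sum>i<k. monom (coeff Q i) i)" "poly P 0 = 0"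
      by blast
    define d where "d = real (Suc k) * (4 * real k + 2 * real n)"
    have d: "d \<noteq> 0" using n by (simp add: d_def)
    show ?case
    proof (intro exI conjI)
      show "radial_laplacian n (P + smult (coeff Q k / d) (monom 1 (Suc k))) = (\<Sum>i<Suc k. monom (coeff Q i) i)"
        using d unfolding radial_laplacian_add radial_laplacian_smult radial_laplacian_monom d_def[symmetric]
        by (simp add: P smult_monom)
      show "poly (P + smult (coeff Q k / d) (monom 1 (Suc k))) 0 = 0"
        by (simp add: P poly_monom)
    qed
  qed (auto intro!: exI[of _ 0])
  from this[of "Suc (degree Q)"] show ?thesis
    by (simp add: lessThan_Suc_atMost poly_as_sum_of_monoms)
qed

definition inverse_laplacian :: "nat \<Rightarrow> real poly \<Rightarrow> real poly" where
  "inverse_laplacian n Q = (SOME P. radial_laplacian n P = Q \<and> poly P 0 = 0)"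

lemma inverse_laplacian:
  assumes "n \<ge> 1"
  shows "radial_laplacian n (inverse_laplacian n Q) = Q" "poly (inverse_laplacian n Q) 0 = 0"
  using someI_ex[OF radial_laplacian_solvable[OF assms, of Q]] by (simp_all add: inverse_laplacian_def)

lemma radial_poly_derivative:
  "((\<lambda>r. poly P (r\<^sup>2)) has_real_derivative 2 * r * poly (pderiv P) (r\<^sup>2)) (at r)"
  by (auto intro!: derivative_eq_intros DERIV_chain2[OF poly_DERIV])

text \<open>The radial Laplacian in divergence form: $(r^{n-1} N')' = r^{n-1} \Delta N$ for $N(r) = P(r^2)$.\<close>

lemma radial_flux_derivative:
  assumes "n \<ge> 1"
  shows "((\<lambda>r. 2 * r ^ n * poly (pderiv P) (r\<^sup>2)) has_real_derivative
    r ^ (n - 1) * poly (radial_laplacian n P) (r\<^sup>2)) (at r)"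
proof -
  have "((\<lambda>r. 2 * r ^ n * poly (pderiv P) (r\<^sup>2)) has_real_derivative
      2 * (real n * r ^ (n - Suc 0)) * poly (pderiv P) (r\<^sup>2) + 2 * r * poly (pderiv (pderiv P)) (r\<^sup>2) * (2 * r ^ n)) (at r)"
    by (rule DERIV_mult[OF DERIV_cmult[OF DERIV_pow] radial_poly_derivative])
  then show ?thesis
    using assms by (cases n)
      (auto simp: radial_laplacian_def poly_monom power2_eq_square algebra_simps elim!: DERIV_cong)
qed

text \<open>The sign is required only in the interior: the differential inequalities below are
  assumed for r > 0, and r = 0 is reached by continuity.\<close>

lemma DERIV_nonneg_mono:
  fixes f :: "real \<Rightarrow> real"
  assumes "\<And>x. a \<le> x \<Longrightarrow> x \<le> b \<Longrightarrow> continuous (at x within {a..b}) f"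
    and "\<And>x. a < x \<Longrightarrow> x < b \<Longrightarrow> \<exists>y. (f has_real_derivative y) (at x) \<and> 0 \<le> y"
    and "a \<le> b"
  shows "f a \<le> f b"
  using assms DERIV_nonneg_imp_increasing_open[of a b f]
  by (auto simp: continuous_on_eq_continuous_within)

text \<open>Comparison with a supersolution. Its flux at the origin need not vanish, so it may have a convex
  corner there.\<close>

lemma radial_comparison:
  assumes n: "n \<ge> 1" and R: "0 \<le> r" "r \<le> R"
    and W: "\<And>r. 0 \<le> r \<Longrightarrow> r \<le> R \<Longrightarrow> (W has_real_derivative W1 r) (at r)"
    and E: "\<And>r. 0 \<le> r \<Longrightarrow> r \<le> R \<Longrightarrow> ((\<lambda>r. r ^ (n - 1) * W1 r) has_real_derivative E1 r) (at r)"
    and W0: "0 \<le> W1 0" "poly P 0 \<le> W 0"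
    and le: "\<And>r. 0 < r \<Longrightarrow> r \<le> R \<Longrightarrow> r ^ (n - 1) * poly (radial_laplacian n P) (r\<^sup>2) \<le> E1 r"
    and s: "0 \<le> s" "s \<le> r"
  shows "W s - poly P (s\<^sup>2) \<le> W r - poly P (r\<^sup>2)"
proof -
  \<comment> \<open>First integration, of the equation in divergence form: it compares the fluxes. A
    second one compares the functions after the weight has been divided out.\<close>
  have flux: "2 * \<rho> ^ n * poly (pderiv P) (\<rho>\<^sup>2) \<le> \<rho> ^ (n - 1) * W1 \<rho>" if \<rho>: "0 \<le> \<rho>" "\<rho> \<le> R" for \<rho>
  proof -
    have d: "((\<lambda>r. r ^ (n - 1) * W1 r - 2 * r ^ n * poly (pderiv P) (r\<^sup>2)) has_real_derivative
        E1 r - r ^ (n - 1) * poly (radial_laplacian n P) (r\<^sup>2)) (at r)" if "0 \<le> r" "r \<le> \<rho>" for r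
      using that \<rho> by (intro DERIV_diff E radial_flux_derivative n) auto
    have "0 ^ (n - 1) * W1 0 - 2 * 0 ^ n * poly (pderiv P) (0\<^sup>2) \<le>
      \<rho> ^ (n - 1) * W1 \<rho> - 2 * \<rho> ^ n * poly (pderiv P) (\<rho>\<^sup>2)"
    proof (rule DERIV_nonneg_mono[OF _ _ \<rho>(1)])
      show "continuous (at x within {0..\<rho>}) (\<lambda>r. r ^ (n - 1) * W1 r - 2 * r ^ n * poly (pderiv P) (r\<^sup>2))"
        if "0 \<le> x" "x \<le> \<rho>" for x
        by (rule continuous_at_imp_continuous_at_within[OF DERIV_isCont[OF d[OF that]]])
      show "\<exists>y. ((\<lambda>r. r ^ (n - 1) * W1 r - 2 * r ^ n * poly (pderiv P) (r\<^sup>2)) has_real_derivative y) (at x) \<and> 0 \<le> y"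
        if "0 < x" "x < \<rho>" for x
        using d[of x] le[of x] that \<rho> by (intro exI conjI) auto
    qed
    \<comment> \<open>For n = 1 the weight \<open>0 ^ (n - 1)\<close> is 1 and the corner of W
      contributes \<open>W1 0\<close>; for larger n both fluxes vanish at 0.\<close>
    moreover have "0 \<le> 0 ^ (n - 1) * W1 0 - 2 * 0 ^ n * poly (pderiv P) (0\<^sup>2)"
      using n W0(1) by (cases n) (auto simp: power_0_left)
    ultimately show ?thesis by linarith
  qed
  have d: "((\<lambda>r. W r - poly P (r\<^sup>2)) has_real_derivative W1 \<rho> - 2 * \<rho> * poly (pderiv P) (\<rho>\<^sup>2)) (at \<rho>)"
    if "s \<le> \<rho>" "\<rho> \<le> r" for \<rho>
    using that s(1) R by (intro DERIV_diff W radial_poly_derivative) auto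
  show ?thesis
  proof (rule DERIV_nonneg_mono[OF _ _ s(2)])
    show "continuous (at x within {s..r}) (\<lambda>r. W r - poly P (r\<^sup>2))" if "s \<le> x" "x \<le> r" for x
      by (rule continuous_at_imp_continuous_at_within[OF DERIV_isCont[OF d[OF that]]])
    show "\<exists>y. ((\<lambda>r. W r - poly P (r\<^sup>2)) has_real_derivative y) (at x) \<and> 0 \<le> y" if "s < x" "x < r" for x
    proof -
      have x: "x > 0" "x \<le> R" using that s(1) R by auto
      have "x ^ (n - 1) * (2 * x * poly (pderiv P) (x\<^sup>2)) = 2 * x ^ n * poly (pderiv P) (x\<^sup>2)"
        using n by (cases n) auto
      also have "\<dots> \<le> x ^ (n - 1) * W1 x" using flux[of x] x by simp
      finally have "0 \<le> W1 x - 2 * x * poly (pderiv P) (x\<^sup>2)"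
        using x by simp
      with d[of x] that show ?thesis by auto
    qed
  qed
qed

text \<open>Comparison of -P with the constant equal to its value at the origin.\<close>

lemma radial_mono:
  assumes "n \<ge> 1" "0 \<le> r" "r \<le> R"
    and "\<And>r. 0 < r \<Longrightarrow> r \<le> R \<Longrightarrow> 0 \<le> poly (radial_laplacian n P) (r\<^sup>2)"
    and "0 \<le> s" "s \<le> r"
  shows "poly P (s\<^sup>2) \<le> poly P (r\<^sup>2)"
proof -
  have "(\<lambda>_. poly (- P) 0) s - poly (- P) (s\<^sup>2) \<le> (\<lambda>_. poly (- P) 0) r - poly (- P) (r\<^sup>2)"
    using assms
    by (intro radial_comparison[where n = n and R = R and ?W1.0 = "\<lambda>_. 0" and ?E1.0 = "\<lambda>_. 0"])
       (auto simp: radial_laplacian_smult[of n "-1", simplified])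
  then show ?thesis by simp
qed


text \<open>The supersolution, its logarithmic derivative and the derivative of the latter.\<close>

definition eigen_bound :: "real \<Rightarrow> real \<Rightarrow> real \<Rightarrow> real" where
  "eigen_bound k m r = exp (r + k - k / (1 + r)) * (1 + r) powr (- m)"

definition eigen_slope :: "real \<Rightarrow> real \<Rightarrow> real \<Rightarrow> real" where
  "eigen_slope k m r = 1 - m * (1 / (1 + r)) + k * (1 / (1 + r))\<^sup>2"

definition eigen_slope' :: "real \<Rightarrow> real \<Rightarrow> real \<Rightarrow> real" where
  "eigen_slope' k m r = m * (1 / (1 + r))\<^sup>2 - 2 * k * (1 / (1 + r)) ^ 3"

lemma eigen_bound_pos: "r \<ge> 0 \<Longrightarrow> eigen_bound k m r > 0"
  by (simp add: eigen_bound_def)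

lemma eigen_bound_derivative:
  assumes "r \<ge> 0"
  shows "(eigen_bound k m has_real_derivative eigen_slope k m r * eigen_bound k m r) (at r)"
proof -
  have "((\<lambda>r. exp (r + k - k / (1 + r))) has_real_derivative
      exp (r + k - k / (1 + r)) * (1 + k * (1 / (1 + r))\<^sup>2)) (at r)"
    using assms by (auto intro!: derivative_eq_intros simp: power2_eq_square)
  moreover have "((\<lambda>r. (1 + r) powr (- m)) has_real_derivative
      (1 + r) powr (- m) * (- m * (1 / (1 + r)))) (at r)"
  proof -
    have "((\<lambda>r. (1 + r) powr (- m)) has_real_derivative (- m) * (1 + r) powr (- m - 1) * 1) (at r)"
      using assms by (auto intro!: derivative_eq_intros)
    then show ?thesis
      using assms by (simp add: powr_diff mult.commute)
  qed
  ultimately have "(eigen_bound k m has_real_derivative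
      exp (r + k - k / (1 + r)) * (1 + k * (1 / (1 + r))\<^sup>2) * (1 + r) powr (- m) +
      (1 + r) powr (- m) * (- m * (1 / (1 + r))) * exp (r + k - k / (1 + r))) (at r)"
    unfolding eigen_bound_def[abs_def] by (rule DERIV_mult)
  then show ?thesis
    by (rule DERIV_cong) (simp add: eigen_bound_def eigen_slope_def ring_distribs)
qed

lemma eigen_slope_derivative:
  assumes "r \<ge> 0"
  shows "(eigen_slope k m has_real_derivative eigen_slope' k m r) (at r)"
proof -
  have z: "((\<lambda>r. 1 / (1 + r)) has_real_derivative - (1 / (1 + r))\<^sup>2) (at r)"
    using assms by (auto intro!: derivative_eq_intros simp: power2_eq_square)
  show ?thesis
    unfolding eigen_slope_def[abs_def]
    by (rule DERIV_cong, (rule derivative_eq_intros z refl)+)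
       (simp add: eigen_slope'_def power2_eq_square power3_eq_cube)
qed

text \<open>With z = 1/(1+r) the terms of order z cancel, which reflects that m is half of n - 1. At
  order z^2 the corrector supplies 2k - m^2 - 1 = \<mu>, and the remainder z^2 (m + (kz - 1)^2) is
  nonnegative. The sign of the slope, from completing the square with k \<ge> m^2/4, later allows
  1/(1+r) to be enlarged to 1/r.\<close>

lemma eigen_slope_inequality:
  assumes k: "2 * k = m\<^sup>2 + \<mu> + 1" and m: "m \<ge> 0" and mu: "\<mu> > 0"
  shows "eigen_slope k m r \<ge> 0"
    and "1 + \<mu> * (1 / (1 + r))\<^sup>2 \<le>
      eigen_slope' k m r + (eigen_slope k m r)\<^sup>2 + 2 * m * (1 / (1 + r)) * eigen_slope k m r"
proof -
  define z where "z = 1 / (1 + r)"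
  have "1 - m * z + k * z\<^sup>2 = (1 - m * z / 2)\<^sup>2 + (k - m\<^sup>2 / 4) * z\<^sup>2"
    by (simp add: power2_eq_square algebra_simps)
  moreover have "k - m\<^sup>2 / 4 \<ge> 0" using k mu zero_le_power2[of m] by (simp; linarith)
  ultimately show "eigen_slope k m r \<ge> 0"
    by (simp add: eigen_slope_def z_def[symmetric])
  have "m * z\<^sup>2 - 2 * k * z ^ 3 + (1 - m * z + k * z\<^sup>2)\<^sup>2 + 2 * m * z * (1 - m * z + k * z\<^sup>2) =
    1 + z\<^sup>2 * (m + (k * z - 1)\<^sup>2 + (2 * k - m\<^sup>2 - 1))"
    by (simp add: power2_eq_square power3_eq_cube algebra_simps)
  also have "2 * k - m\<^sup>2 - 1 = \<mu>" using k by simp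
  finally have "m * z\<^sup>2 - 2 * k * z ^ 3 + (1 - m * z + k * z\<^sup>2)\<^sup>2 + 2 * m * z * (1 - m * z + k * z\<^sup>2) =
    1 + \<mu> * z\<^sup>2 + z\<^sup>2 * (m + (k * z - 1)\<^sup>2)"
    by (simp add: algebra_simps)
  then show "1 + \<mu> * (1 / (1 + r))\<^sup>2 \<le>
      eigen_slope' k m r + (eigen_slope k m r)\<^sup>2 + 2 * m * (1 / (1 + r)) * eigen_slope k m r"
    unfolding eigen_slope_def eigen_slope'_def z_def[symmetric] using m by simp
qed

text \<open>One Picard step preserves the upper barrier. The damping is compared with \<mu>
  (1+r)^{-2}, the order that the corrector in \<open>eigen_bound\<close> can carry.\<close>

lemma below_eigen_bound:
  assumes n: "n \<ge> 1" and \<mu>: "\<mu> > 0" and \<beta>: "\<beta> > 2"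
    and m: "m = (real n - 1) / 2" and k: "k = (m\<^sup>2 + \<mu> + 1) / 2"
    and P0: "poly P 0 \<le> 1"
    and P: "\<And>r. 0 \<le> r \<Longrightarrow> r \<le> R \<Longrightarrow>
      poly (radial_laplacian n P) (r\<^sup>2) \<le> (1 + \<mu> / (1 + r) powr \<beta>) * eigen_bound k m r"
    and r: "0 \<le> r" "r \<le> R"
  shows "poly P (r\<^sup>2) \<le> eigen_bound k m r"
proof -
  have m0: "m \<ge> 0" using n m by simp
  have k2: "2 * k = m\<^sup>2 + \<mu> + 1" using k by simp
  define W where "W = eigen_bound k m"
  define y where "y = eigen_slope k m"
  define y' where "y' = eigen_slope' k m"
  define E1 where "E1 r = (real n - 1) * r ^ (n - 2) * (y r * W r) + r ^ (n - 1) * ((y' r + (y r)\<^sup>2) * W r)" for r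
  have Wd: "(W has_real_derivative y r * W r) (at r)" and yd: "(y has_real_derivative y' r) (at r)"
    if "r \<ge> 0" for r
    using eigen_bound_derivative[OF that] eigen_slope_derivative[OF that]
    by (simp_all add: W_def y_def y'_def)
  \<comment> \<open>For n = 1 the truncated exponent n - 2 is harmless, since the factor
    \<open>real n - 1\<close> is 0.\<close>
  have pd: "((\<lambda>r. r ^ (n - 1)) has_real_derivative (real n - 1) * r ^ (n - 2)) (at r)" for r :: real
    using n by (auto intro!: derivative_eq_intros simp: of_nat_diff numeral_2_eq_2)
  have "W 0 - poly P (0\<^sup>2) \<le> W r - poly P (r\<^sup>2)"
  proof (rule radial_comparison[OF n r])
    show "(W has_real_derivative y r * W r) (at r)" if "0 \<le> r" "r \<le> R" for r
      using Wd that by simp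
    show "((\<lambda>r. r ^ (n - 1) * (y r * W r)) has_real_derivative E1 r) (at r)" if "0 \<le> r" "r \<le> R" for r
      by (rule DERIV_cong[OF DERIV_mult[OF pd DERIV_mult[OF yd[OF that(1)] Wd[OF that(1)]]]])
         (simp add: E1_def power2_eq_square algebra_simps)
    show "0 \<le> y 0 * W 0"
      using eigen_slope_inequality(1)[OF k2 m0 \<mu>, of 0] eigen_bound_pos[of 0 k m]
      by (simp add: y_def W_def)
    show "poly P 0 \<le> W 0"
      using P0 by (simp add: W_def eigen_bound_def)
    show "r ^ (n - 1) * poly (radial_laplacian n P) (r\<^sup>2) \<le> E1 r" if r: "0 < r" "r \<le> R" for r
    proof -
      have W0: "W r > 0" using r by (simp add: W_def eigen_bound_pos)
      have y0: "y r \<ge> 0" using eigen_slope_inequality(1)[OF k2 m0 \<mu>, of r] by (simp add: y_def)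
      have "1 / (1 + r) powr \<beta> \<le> 1 / (1 + r) powr 2"
        using r \<beta> by (intro divide_left_mono powr_mono mult_pos_pos) auto
      also have "\<dots> = (1 / (1 + r))\<^sup>2" using r by (simp add: power_divide)
      finally have a: "\<mu> / (1 + r) powr \<beta> \<le> \<mu> * (1 / (1 + r))\<^sup>2"
        using mult_left_mono[of _ _ \<mu>] \<mu> by fastforce
      have "poly (radial_laplacian n P) (r\<^sup>2) \<le> (1 + \<mu> / (1 + r) powr \<beta>) * W r"
        using P r by (simp add: W_def)
      also have "\<dots> \<le> (y' r + (y r)\<^sup>2 + 2 * m * (1 / (1 + r)) * y r) * W r"
        using a eigen_slope_inequality(2)[OF k2 m0 \<mu>, of r] W0
        unfolding y_def y'_def by (intro mult_right_mono) linarith+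
      \<comment> \<open>The true first-order coefficient is 2m/r; passing to it from 2m/(1+r) is an
        increase because m, the slope and W are nonnegative.\<close>
      also have "\<dots> \<le> (y' r + (y r)\<^sup>2 + 2 * m * (1 / r) * y r) * W r"
        using W0 y0 m0 r
        by (intro mult_right_mono add_left_mono mult_left_mono divide_left_mono) auto
      finally have "r ^ (n - 1) * poly (radial_laplacian n P) (r\<^sup>2) \<le>
        r ^ (n - 1) * ((y' r + (y r)\<^sup>2 + 2 * m * (1 / r) * y r) * W r)"
        using r by (intro mult_left_mono) auto
      also have "\<dots> = E1 r"
      proof -
        have "r ^ (n - 1) * (2 * m * (1 / r)) = (real n - 1) * r ^ (n - 2)"
        proof (cases "n = 1")
          case False
          then obtain j where "n = Suc (Suc j)" using n by (metis One_nat_def Suc_le_D not0_implies_Suc)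
          then show ?thesis using r m by simp
        qed (use m in simp)
        moreover have "r ^ (n - 1) * ((y' r + (y r)\<^sup>2 + 2 * m * (1 / r) * y r) * W r) =
          (r ^ (n - 1) * (2 * m * (1 / r))) * (y r * W r) + r ^ (n - 1) * ((y' r + (y r)\<^sup>2) * W r)"
          by (simp only: ring_distribs mult_ac add_ac)
        ultimately show ?thesis unfolding E1_def by simp
      qed
      finally show ?thesis .
    qed
  qed (use r in auto)
  then show ?thesis
    using P0 by (simp add: W_def eigen_bound_def)
qed

section \<open>Polynomial approximation and Picard iteration\<close>

lemma poly_approx_below:
  fixes h :: "real \<Rightarrow> real"
  assumes "continuous_on {0..S} h" "d > 0"
  shows "\<exists>Q. \<forall>s\<in>{0..S}. h s - d \<le> poly Q s \<and> poly Q s \<le> h s"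
proof -
  \<comment> \<open>Approximating h - d/2 to within d/2 makes the error one-sided, so that the
    iterates can be kept below the supersolution.\<close>
  have "continuous_on {0..S} (\<lambda>s. h s - d / 2)"
    using assms by (intro continuous_intros)
  then obtain g where g: "real_polynomial_function g" "\<And>s. s \<in> {0..S} \<Longrightarrow> \<bar>h s - d / 2 - g s\<bar> < d / 2"
    using Stone_Weierstrass_real_polynomial_function[of "{0..S}" "\<lambda>s. h s - d / 2" "d / 2"] assms(2)
    by auto
  obtain a N where "g = (\<lambda>x. \<Sum>i\<le>N. a i * x ^ i)"
    using g(1) unfolding real_polynomial_function_iff_sum by blast
  then have gp: "g s = poly (\<Sum>i\<le>N. monom (a i) i) s" for s
    by (simp add: poly_sum poly_monom)
  have "h s - d \<le> g s \<and> g s \<le> h s" if "s \<in> {0..S}" for s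
    using g(2)[OF that] by linarith
  then show ?thesis unfolding gp by blast
qed

text \<open>Picard iteration for $\Delta\phi = (1 + q)\phi$, where the polynomial $q$ approximates the damping
  coefficient from below; all iterates stay below the supersolution and increase with the iteration.\<close>

lemma approximate_eigenfunction:
  assumes n: "n \<ge> 1" and \<mu>: "\<mu> > 0" and \<beta>: "\<beta> > 2"
    and m: "m = (real n - 1) / 2" and k: "k = (m\<^sup>2 + \<mu> + 1) / 2"
    and R: "R > 0" and \<delta>: "\<delta> > 0"
  obtains P where "\<And>r. 0 \<le> r \<Longrightarrow> r \<le> R \<Longrightarrow> 1 \<le> poly P (r\<^sup>2) \<and> poly P (r\<^sup>2) \<le> eigen_bound k m r \<and>
    \<bar>poly (radial_laplacian n P) (r\<^sup>2) - (1 + \<mu> / (1 + r) powr \<beta>) * poly P (r\<^sup>2)\<bar> \<le> \<delta>"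
proof -
  define W where "W = eigen_bound k m"
  define a where "a r = \<mu> / (1 + r) powr \<beta>" for r
  have Wpos: "W r > 0" if "r \<ge> 0" for r using that by (simp add: W_def eigen_bound_pos)
  have "continuous_on {0..R} W"
    by (intro continuous_at_imp_continuous_on ballI)
       (auto simp: W_def intro: DERIV_isCont[OF eigen_bound_derivative])
  then have "compact (W ` {0..R})" by (intro compact_continuous_image) auto
  then have "bounded (W ` {0..R})" by (rule compact_imp_bounded)
  then obtain B where B: "B > 0" "\<And>r. 0 \<le> r \<Longrightarrow> r \<le> R \<Longrightarrow> W r \<le> B"
    unfolding bounded_pos by force
  have apos: "a r > 0" if "r \<ge> 0" for r using that \<mu> by (simp add: a_def)
  have amono: "a r \<le> a s" if "0 \<le> s" "s \<le> r" for r s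
    unfolding a_def using that \<mu> \<beta> by (intro divide_left_mono powr_mono2 mult_pos_pos) auto
  \<comment> \<open>\<open>a R\<close> is the least value of the damping on [0, R] and keeps q
    nonnegative; the other entry makes the error from q at most \<delta>/2.\<close>
  define d where "d = min (a R) (\<delta> / (2 * B))"
  have d: "d > 0" using apos[of R] R \<delta> B by (simp add: d_def)
  \<comment> \<open>q has to be a polynomial in s = r^2; the square root costs differentiability at
    0 but not continuity.\<close>
  have "continuous_on {0..R\<^sup>2} (\<lambda>s. a (sqrt s))"
    unfolding a_def by (intro continuous_intros) (auto simp: add_nonneg_eq_0_iff)
  then obtain q where q0: "\<And>s. s \<in> {0..R\<^sup>2} \<Longrightarrow> a (sqrt s) - d \<le> poly q s \<and> poly q s \<le> a (sqrt s)"
    using poly_approx_below[OF _ d] by blast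
  have q: "a r - d \<le> poly q (r\<^sup>2)" "poly q (r\<^sup>2) \<le> a r" if "0 \<le> r" "r \<le> R" for r
    using q0[of "r\<^sup>2"] that by (auto simp: power_mono)
  have qnn: "0 \<le> poly q (r\<^sup>2)" if "0 \<le> r" "r \<le> R" for r
    using q(1)[OF that] amono[OF that] by (simp add: d_def)
  define w where "w = rec_nat [:1:] (\<lambda>_ P. [:1:] + inverse_laplacian n ((1 + q) * P))"
  have w0: "w 0 = [:1:]" and wS: "w (Suc j) = [:1:] + inverse_laplacian n ((1 + q) * w j)" for j
    by (simp_all add: w_def)
  have lapS: "radial_laplacian n (w (Suc j)) = (1 + q) * w j" for j
    by (simp add: wS radial_laplacian_add inverse_laplacian[OF n])
  have at0: "poly (w j) 0 = 1" for j
    by (cases j) (simp_all add: w0 wS inverse_laplacian[OF n])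
  have inc: "0 \<le> poly (radial_laplacian n (w (Suc j) - w j)) (r\<^sup>2)" if "0 \<le> r" "r \<le> R" for j r
    using that
  proof (induction j arbitrary: r)
    case 0
    then show ?case using qnn[of r] by (simp add: radial_laplacian_diff lapS w0)
  next
    case (Suc j)
    have "poly (w (Suc j) - w j) (0\<^sup>2) \<le> poly (w (Suc j) - w j) (r\<^sup>2)"
      using Suc by (intro radial_mono[OF n, where R = R]) auto
    then have "0 \<le> poly (w (Suc j)) (r\<^sup>2) - poly (w j) (r\<^sup>2)"
      by (simp add: at0)
    then have "0 \<le> (1 + poly q (r\<^sup>2)) * (poly (w (Suc j)) (r\<^sup>2) - poly (w j) (r\<^sup>2))"
      using qnn[of r] Suc.prems by simp
    then show ?case
      by (simp add: radial_laplacian_diff lapS right_diff_distrib)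
  qed
  have mono: "poly (w (Suc j) - w j) (s\<^sup>2) \<le> poly (w (Suc j) - w j) (r\<^sup>2)"
    if "0 \<le> s" "s \<le> r" "r \<le> R" for j r s
    using that inc by (intro radial_mono[OF n, where R = R]) auto
  have nn: "poly (w j) (r\<^sup>2) \<le> poly (w (Suc j)) (r\<^sup>2)" if "0 \<le> r" "r \<le> R" for j r
    using mono[of 0 r j] that by (simp add: at0)
  have ge1: "1 \<le> poly (w j) (r\<^sup>2)" if "0 \<le> r" "r \<le> R" for j r
  proof (induction j)
    case (Suc j)
    then show ?case using nn[OF that, of j] by linarith
  qed (simp add: w0)
  have leW: "poly (w j) (r\<^sup>2) \<le> W r" if "0 \<le> r" "r \<le> R" for j r
    using that
  proof (induction j arbitrary: r)
    case 0
    then show ?case unfolding W_def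
      by (intro below_eigen_bound[OF n \<mu> \<beta> m k, where R = R])
         (use \<mu> less_imp_le[OF eigen_bound_pos] in \<open>auto simp: w0 intro!: mult_nonneg_nonneg add_nonneg_nonneg\<close>)
  next
    case (Suc j)
    show ?case unfolding W_def
    proof (rule below_eigen_bound[OF n \<mu> \<beta> m k _ _ Suc.prems])
      fix r assume r: "0 \<le> r" "r \<le> R"
      have "(1 + poly q (r\<^sup>2)) * poly (w j) (r\<^sup>2) \<le> (1 + a r) * W r"
        using q[OF r] qnn[OF r] Suc.IH[OF r] ge1[OF r, of j] apos[OF r(1)] by (intro mult_mono) auto
      then show "poly (radial_laplacian n (w (Suc j))) (r\<^sup>2) \<le> (1 + \<mu> / (1 + r) powr \<beta>) * eigen_bound k m r"
        by (simp add: lapS a_def W_def)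
    qed (simp add: at0)
  qed
  \<comment> \<open>By \<open>mono\<close> an increment of the iteration is largest at r = R, so
    smallness at this single radius gives smallness on all of [0, R].\<close>
  have conv: "convergent (\<lambda>j. poly (w j) (R\<^sup>2))"
  proof (rule Bseq_mono_convergent)
    have "norm (poly (w j) (R\<^sup>2)) \<le> W R" for j
      using leW[of R j] ge1[of R j] R by simp
    then show "Bseq (\<lambda>j. poly (w j) (R\<^sup>2))" by (rule BseqI')
    have "poly (w j) (R\<^sup>2) \<le> poly (w (Suc j)) (R\<^sup>2)" for j
      using nn[of R] R by simp
    then show "\<forall>i. \<forall>j\<ge>i. poly (w i) (R\<^sup>2) \<le> poly (w j) (R\<^sup>2)"
      using lift_Suc_mono_le[of "\<lambda>j. poly (w j) (R\<^sup>2)"] by blast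
  qed
  \<comment> \<open>The other half of the error: the damping is largest at 0, so (1 + a) times an
    increment of size e is at most \<delta>/2.\<close>
  define e where "e = \<delta> / (2 * (1 + a 0))"
  have e: "e > 0" using \<delta> apos[of 0] by (simp add: e_def)
  obtain N where "\<forall>i\<ge>N. \<forall>j\<ge>N. norm (poly (w i) (R\<^sup>2) - poly (w j) (R\<^sup>2)) < e"
    using CauchyD[OF convergent_Cauchy[OF conv] e] by blast
  then have N: "norm (poly (w (Suc N)) (R\<^sup>2) - poly (w N) (R\<^sup>2)) < e"
    by simp
  show thesis
  proof (rule that[of "w (Suc N)"], intro conjI)
    fix r assume r: "0 \<le> r" "r \<le> R"
    show "1 \<le> poly (w (Suc N)) (r\<^sup>2)" by (rule ge1[OF r])
    show "poly (w (Suc N)) (r\<^sup>2) \<le> eigen_bound k m r" using leW[OF r] by (simp add: W_def)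
    define x where "x = poly (w N) (r\<^sup>2)"
    define y where "y = poly (w (Suc N)) (r\<^sup>2)"
    have xy: "x \<le> y" "y - x \<le> e" "1 \<le> x" "x \<le> W r"
      using nn[OF r, of N] mono[of r R N] r N ge1[OF r, of N] leW[OF r, of N] by (auto simp: x_def y_def)
    \<comment> \<open>The Laplacian of the last iterate is (1 + q) times the previous one, so the
      residual splits into the error of q and one increment.\<close>
    have "(1 + poly q (r\<^sup>2)) * x - (1 + a r) * y = - ((a r - poly q (r\<^sup>2)) * x + (1 + a r) * (y - x))"
      by (simp add: algebra_simps)
    moreover have "0 \<le> (a r - poly q (r\<^sup>2)) * x" "0 \<le> (1 + a r) * (y - x)"
      using q[OF r] xy apos[OF r(1)] by auto
    moreover have "(a r - poly q (r\<^sup>2)) * x \<le> d * B"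
      using q[OF r] xy B(2)[OF r] d by (intro mult_mono) auto
    moreover have "d * B \<le> \<delta> / (2 * B) * B" using B(1) by (intro mult_right_mono) (auto simp: d_def)
    moreover have "(1 + a r) * (y - x) \<le> (1 + a 0) * e"
      using amono[of 0 r] apos[OF r(1)] r xy by (intro mult_mono) auto
    moreover have "(1 + a 0) * e = \<delta> / 2" using apos[of 0] by (simp add: e_def field_simps)
    moreover have "\<delta> / (2 * B) * B = \<delta> / 2" using B(1) by simp
    ultimately have "\<bar>(1 + poly q (r\<^sup>2)) * x - (1 + a r) * y\<bar> \<le> \<delta>" by linarith
    then show "\<bar>poly (radial_laplacian n (w (Suc N))) (r\<^sup>2) - (1 + \<mu> / (1 + r) powr \<beta>) * poly (w (Suc N)) (r\<^sup>2)\<bar> \<le> \<delta>"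
      by (simp add: lapS a_def x_def y_def)
  qed
qed

subsection \<open>Lebesgue measure on a product\<close>

lemma AE_lebesgue_pair:
  fixes P :: "'a::euclidean_space \<times> 'b::euclidean_space \<Rightarrow> bool"
  assumes "AE z in lebesgue. P z"
  shows "AE t in lborel. AE x in lebesgue. P (t, x)"
  using lborel_pair.AE_pair[of P] assms unfolding lborel_prod AE_completion_iff by blast

lemma lebesgue_measurable_cong_AE:
  fixes f g :: "'a::euclidean_space \<Rightarrow> 'b::topological_space"
  assumes g: "g \<in> borel_measurable lebesgue" and ae: "AE x in lebesgue. f x = g x"
  shows "f \<in> borel_measurable lebesgue"
proof (rule measurableI)
  fix A :: "'b set" assume "A \<in> sets borel"
  then have 1: "g -` A \<in> sets lebesgue"
    using measurable_sets[OF g, of A] by simp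
  have "AE x in lebesgue. x \<in> g -` A \<longleftrightarrow> x \<in> f -` A"
    using ae by eventually_elim auto
  from completion.in_sets_AE[OF this 1] show "f -` A \<inter> space lebesgue \<in> sets lebesgue"
    by simp
qed simp

text \<open>Lebesgue measure on the product is the completion of the product measure, so slices of a
  measurable function are measurable only for almost every t. A Borel representative has measurable
  slices throughout and carries Fubini's theorem over.\<close>

lemma lebesgue_slices:
  fixes F :: "'a::euclidean_space \<times> 'b::euclidean_space \<Rightarrow> real"
  assumes "F \<in> borel_measurable lebesgue"
  obtains F' where "F' \<in> borel_measurable (lborel \<Otimes>\<^sub>M lborel)" "AE z in lebesgue. F z = F' z"
    "AE t in lborel. AE x in lebesgue. F (t, x) = F' (t, x)"
    "\<And>t. (\<lambda>x. F' (t, x)) \<in> borel_measurable lborel"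
    "AE t in lborel. (\<lambda>x. F (t, x)) \<in> borel_measurable lebesgue"
proof -
  obtain F' where F': "F' \<in> borel_measurable lborel" "AE z in lborel. F z = F' z"
    using completion_ex_borel_measurable_real[OF assms] by blast
  have 1: "AE z in lebesgue. F z = F' z" using F'(2) by (simp add: AE_completion_iff)
  have m[measurable]: "F' \<in> borel_measurable (lborel \<Otimes>\<^sub>M lborel)"
    using F'(1) by (simp only: lborel_prod)
  have ms: "(\<lambda>x. F' (t, x)) \<in> borel_measurable lborel" for t
    using measurable_Pair2[OF m, of t] by simp
  have 2: "AE t in lborel. AE x in lebesgue. F (t, x) = F' (t, x)"
    by (rule AE_lebesgue_pair[OF 1])
  then have 3: "AE t in lborel. (\<lambda>x. F (t, x)) \<in> borel_measurable lebesgue"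
    by eventually_elim (rule lebesgue_measurable_cong_AE[OF measurable_completion[OF ms]])
  show thesis
    by (rule that[OF m 1 2 ms 3])
qed

lemma integrable_lebesgue_pair:
  fixes F :: "'a::euclidean_space \<times> 'b::euclidean_space \<Rightarrow> real"
  assumes F: "integrable lebesgue F"
  shows "AE t in lborel. integrable lebesgue (\<lambda>x. F (t, x))"
    and "integral\<^sup>L lebesgue F = (LINT t|lebesgue. LINT x|lebesgue. F (t, x))"
proof -
  obtain F' where m[measurable]: "F' \<in> borel_measurable (lborel \<Otimes>\<^sub>M lborel)" and ae: "AE z in lebesgue. F z = F' z"
    and ae2: "AE t in lborel. AE x in lebesgue. F (t, x) = F' (t, x)"
    and ms: "\<And>t. (\<lambda>x. F' (t, x)) \<in> borel_measurable lborel"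
    and mF: "AE t in lborel. (\<lambda>x. F (t, x)) \<in> borel_measurable lebesgue"
    using lebesgue_slices[OF borel_measurable_integrable[OF F]] by blast
  have m': "F' \<in> borel_measurable lborel" using m by (simp only: lborel_prod)
  have "integrable lebesgue F'"
    using integrable_cong_AE_imp[OF F measurable_completion[OF m']] ae by simp
  then have i: "integrable (lborel \<Otimes>\<^sub>M lborel) F'"
    using m' by (simp add: lborel_prod integrable_completion)
  have ms': "(\<lambda>x. F' (t, x)) \<in> borel_measurable lebesgue" for t
    by (rule measurable_completion[OF ms])
  show "AE t in lborel. integrable lebesgue (\<lambda>x. F (t, x))"
    using lborel_pair.AE_integrable_fst'[OF i] mF ae2
  proof eventually_elim
    case (elim t)
    have "integrable lebesgue (\<lambda>x. F' (t, x))"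
      using elim(1) ms by (simp add: integrable_completion)
    then show ?case
      using integrable_cong_AE_imp[OF _ elim(2)] elim(3) by (simp add: eq_commute)
  qed
  have s: "AE t in lborel. (LINT x|lborel. F' (t, x)) = (LINT x|lebesgue. F (t, x))"
    using mF ae2
  proof eventually_elim
    case (elim t)
    have "(LINT x|lebesgue. F (t, x)) = (LINT x|lebesgue. F' (t, x))"
      by (intro integral_cong_AE elim ms')
    then show ?case using ms by (simp add: integral_completion)
  qed
  have mI: "(\<lambda>t. LINT x|lborel. F' (t, x)) \<in> borel_measurable lborel"
    using borel_measurable_integrable[OF lborel_pair.integrable_fst'[OF i]] .
  have "integral\<^sup>L lebesgue F = integral\<^sup>L lborel F'"
    using integral_cong_AE[OF borel_measurable_integrable[OF F] measurable_completion[OF m'] ae] m'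
    by (simp add: integral_completion)
  also have "\<dots> = (LINT t|lborel. LINT x|lborel. F' (t, x))"
    using lborel_pair.integral_fst'[OF i] by (simp add: lborel_prod)
  also have "\<dots> = (LINT t|lebesgue. LINT x|lborel. F' (t, x))"
    using mI by (simp add: integral_completion)
  also have "\<dots> = (LINT t|lebesgue. LINT x|lebesgue. F (t, x))"
  proof (rule integral_cong_AE)
    show "AE t in lebesgue. (LINT x|lborel. F' (t, x)) = (LINT x|lebesgue. F (t, x))"
      unfolding AE_completion_iff by (rule s)
    then show "(\<lambda>t. LINT x|lebesgue. F (t, x)) \<in> borel_measurable lebesgue"
      by (intro lebesgue_measurable_cong_AE[OF measurable_completion[OF mI]]) (simp add: eq_commute)
  qed (rule measurable_completion[OF mI])
  finally show "integral\<^sup>L lebesgue F = (LINT t|lebesgue. LINT x|lebesgue. F (t, x))" .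
qed

text \<open>A majorant H of the slice norms replaces any measurability condition on the inner
  integral; for curves in L^2 it comes from Cauchy-Schwarz.\<close>

lemma integrable_lebesgue_pairI:
  fixes F :: "'a::euclidean_space \<times> 'b::euclidean_space \<Rightarrow> real"
  assumes F: "F \<in> borel_measurable lebesgue"
    and int: "AE t in lborel. integrable lebesgue (\<lambda>x. F (t, x))"
    and le: "AE t in lborel. (LINT x|lebesgue. \<bar>F (t, x)\<bar>) \<le> H t"
    and H: "integrable lborel H"
  shows "integrable lebesgue F"
proof -
  obtain F' where m[measurable]: "F' \<in> borel_measurable (lborel \<Otimes>\<^sub>M lborel)" and ae: "AE z in lebesgue. F z = F' z"
    and ae2: "AE t in lborel. AE x in lebesgue. F (t, x) = F' (t, x)"
    and ms: "\<And>t. (\<lambda>x. F' (t, x)) \<in> borel_measurable lborel"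
    using lebesgue_slices[OF F] by blast
  have "AE t in lborel. integrable lborel (\<lambda>x. F' (t, x)) \<and> (LINT x|lborel. \<bar>F' (t, x)\<bar>) \<le> H t"
    using int le ae2
  proof eventually_elim
    case (elim t)
    have ms': "(\<lambda>x. F' (t, x)) \<in> borel_measurable lebesgue"
      by (rule measurable_completion[OF ms])
    have "integrable lebesgue (\<lambda>x. F' (t, x))"
      using integrable_cong_AE_imp[OF elim(1) ms'] elim(3) by simp
    moreover have "(LINT x|lebesgue. \<bar>F (t, x)\<bar>) = (LINT x|lebesgue. \<bar>F' (t, x)\<bar>)"
      using elim(3) by (intro integral_cong_AE borel_measurable_abs borel_measurable_integrable[OF elim(1)] ms') auto
    ultimately show ?case
      using elim(2) ms by (simp add: integrable_completion integral_completion)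
  qed
  then have i: "AE t in lborel. integrable lborel (\<lambda>x. F' (t, x))"
    and l: "AE t in lborel. (LINT x|lborel. \<bar>F' (t, x)\<bar>) \<le> H t"
    by (auto elim: eventually_mono)
  have "integrable (lborel \<Otimes>\<^sub>M lborel) F'"
  proof (rule lborel_pair.Fubini_integrable[OF m _ i])
    show "integrable lborel (\<lambda>x. LINT y|lborel. norm (F' (x, y)))"
      by (rule Bochner_Integration.integrable_bound[OF H])
         (use l in \<open>auto elim!: eventually_mono simp: abs_of_nonneg\<close>)
  qed
  then have "integrable lebesgue F'"
    using F by (simp add: lborel_prod integrable_completion borel_measurable_integrable)
  then show ?thesis
    using integrable_cong_AE_imp[OF _ F] ae by (simp add: eq_commute)
qed

text \<open>Null slices alone do not make a set null; joint measurability of F is what makes this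
  converse of \<open>AE_lebesgue_pair\<close> true.\<close>

lemma AE_lebesgue_pairI:
  fixes F :: "'a::euclidean_space \<times> 'b::euclidean_space \<Rightarrow> real"
  assumes F: "F \<in> borel_measurable lebesgue"
    and z: "AE t in lborel. AE x in lebesgue. F (t, x) = 0"
  shows "AE z in lebesgue. F z = 0"
proof -
  obtain F' where m[measurable]: "F' \<in> borel_measurable (lborel \<Otimes>\<^sub>M lborel)" and ae: "AE z in lebesgue. F z = F' z"
    and ae2: "AE t in lborel. AE x in lebesgue. F (t, x) = F' (t, x)"
    using lebesgue_slices[OF F] by blast
  have "AE t in lborel. AE x in lborel. F' (t, x) = 0"
    using z ae2
  proof eventually_elim
    case (elim t)
    then have "AE x in lebesgue. F' (t, x) = 0" by eventually_elim simp
    then show ?case by (simp add: AE_completion_iff)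
  qed
  then have "AE z in lborel \<Otimes>\<^sub>M lborel. F' z = 0"
    by (intro lborel_pair.AE_pair_measure) measurable
  then have "AE z in lebesgue. F' z = 0"
    unfolding lborel_prod AE_completion_iff .
  with ae show ?thesis by eventually_elim simp
qed

text \<open>By Lindelof's theorem countably many of the open sets on which f vanishes almost
  everywhere cover the complement of the support, and countably many null sets add up to a null
  set.\<close>

lemma AE_not_in_ess_support:
  fixes f :: "'a::euclidean_space \<Rightarrow> 'b::zero"
  shows "AE y in lebesgue. y \<in> S \<and> y \<notin> ess_support_on S f \<longrightarrow> f y = 0"
proof -
  define \<F> where "\<F> = {U. open U \<and> (AE y in lebesgue. y \<in> U \<inter> S \<longrightarrow> f y = 0)}"
  obtain \<F>' where F': "\<F>' \<subseteq> \<F>" "countable \<F>'" "\<Union>\<F>' = \<Union>\<F>"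
    using Lindelof[of \<F>] by (auto simp: \<F>_def)
  have "AE y in lebesgue. \<forall>U\<in>\<F>'. y \<in> U \<inter> S \<longrightarrow> f y = 0"
    using F' by (subst AE_ball_countable) (auto simp: \<F>_def)
  then show ?thesis
  proof eventually_elim
    case (elim y)
    show ?case
    proof
      assume y: "y \<in> S \<and> y \<notin> ess_support_on S f"
      then obtain U where "U \<in> \<F>" "y \<in> U"
        by (auto simp: ess_support_on_def \<F>_def)
      then have "y \<in> \<Union>\<F>'" unfolding F'(3) by blast
      then show "f y = 0" using elim y by blast
    qed
  qed
qed

subsection \<open>The space $L^2$\<close>

lemma L2_measurable: "f \<in> L2 \<Longrightarrow> f \<in> borel_measurable lebesgue"
  and L2_integrable: "f \<in> L2 \<Longrightarrow> integrable lebesgue (\<lambda>x. (norm (f x))\<^sup>2)"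
  by (simp_all add: L2_def)

lemma L2_norm_nonneg: "0 \<le> L2_norm f"
  by (simp add: L2_norm_def)

lemma L2_norm_square: "(L2_norm f)\<^sup>2 = (LINT x|lebesgue. (norm (f x))\<^sup>2)"
  by (simp add: L2_norm_def)

lemma L2_mult_integrable:
  fixes f g :: "'a::euclidean_space \<Rightarrow> real"
  assumes "f \<in> L2" "g \<in> L2"
  shows "integrable lebesgue (\<lambda>x. f x * g x)"
proof (rule Bochner_Integration.integrable_bound)
  show "integrable lebesgue (\<lambda>x. (norm (f x))\<^sup>2 + (norm (g x))\<^sup>2)"
    using assms by (intro Bochner_Integration.integrable_add L2_integrable)
  show "(\<lambda>x. f x * g x) \<in> borel_measurable lebesgue"
    using assms[THEN L2_measurable] by simp
  show "AE x in lebesgue. norm (f x * g x) \<le> norm ((norm (f x))\<^sup>2 + (norm (g x))\<^sup>2)"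
  proof (intro AE_I2)
    fix x
    have 1: "2 * (\<bar>f x\<bar> * \<bar>g x\<bar>) \<le> (f x)\<^sup>2 + (g x)\<^sup>2"
      using zero_le_power2[of "\<bar>f x\<bar> - \<bar>g x\<bar>"] by (simp add: power2_diff)
    have 2: "0 \<le> \<bar>f x\<bar> * \<bar>g x\<bar>" by simp
    from 1 2 have "\<bar>f x\<bar> * \<bar>g x\<bar> \<le> (f x)\<^sup>2 + (g x)\<^sup>2" by linarith
    then show "norm (f x * g x) \<le> norm ((norm (f x))\<^sup>2 + (norm (g x))\<^sup>2)"
      by (simp add: abs_mult)
  qed
qed

lemma L2_Cauchy_Schwarz:
  fixes f g :: "'a::euclidean_space \<Rightarrow> real"
  assumes f: "f \<in> L2" and g: "g \<in> L2"
  shows "(LINT x|lebesgue. \<bar>f x * g x\<bar>) \<le> L2_norm f * L2_norm g"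
proof -
  have [measurable]: "f \<in> borel_measurable lebesgue" "g \<in> borel_measurable lebesgue"
    using f g by (auto intro: L2_measurable)
  have nn: "(\<integral>\<^sup>+x. (ennreal \<bar>h x\<bar>)\<^sup>2 \<partial>lebesgue) = ennreal ((L2_norm h)\<^sup>2)" if "h \<in> L2" for h :: "'a \<Rightarrow> real"
    unfolding L2_norm_square using nn_integral_eq_integral[OF L2_integrable[OF that]]
    by (simp add: ennreal_power)
  have i: "integrable lebesgue (\<lambda>x. \<bar>f x * g x\<bar>)"
    using L2_mult_integrable[OF f g] by simp
  have "ennreal ((LINT x|lebesgue. \<bar>f x * g x\<bar>)\<^sup>2) = (\<integral>\<^sup>+x. ennreal \<bar>f x * g x\<bar> \<partial>lebesgue)\<^sup>2"
    using nn_integral_eq_integral[OF i] by (simp add: ennreal_power)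
  also have "\<dots> = (\<integral>\<^sup>+x. ennreal \<bar>f x\<bar> * ennreal \<bar>g x\<bar> \<partial>lebesgue)\<^sup>2"
    by (simp add: abs_mult ennreal_mult)
  also have "\<dots> \<le> (\<integral>\<^sup>+x. (ennreal \<bar>f x\<bar>)\<^sup>2 \<partial>lebesgue) * (\<integral>\<^sup>+x. (ennreal \<bar>g x\<bar>)\<^sup>2 \<partial>lebesgue)"
    by (rule Cauchy_Schwarz_nn_integral) auto
  also have "\<dots> = ennreal ((L2_norm f * L2_norm g)\<^sup>2)"
    by (simp add: nn f g ennreal_mult power_mult_distrib)
  finally have "(LINT x|lebesgue. \<bar>f x * g x\<bar>)\<^sup>2 \<le> (L2_norm f * L2_norm g)\<^sup>2"
    by (simp add: ennreal_le_iff)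
  then show ?thesis
    by (rule power2_le_imp_le) (simp add: L2_norm_nonneg)
qed

lemma L2_inner_bound:
  fixes f g :: "'a::euclidean_space \<Rightarrow> real"
  assumes "f \<in> L2" "g \<in> L2"
  shows "\<bar>LINT x|lebesgue. f x * g x\<bar> \<le> L2_norm f * L2_norm g"
  using integral_abs_bound[of lebesgue "\<lambda>x. f x * g x"] L2_Cauchy_Schwarz[OF assms] by linarith

lemma L2_add:
  fixes f g :: "'a::euclidean_space \<Rightarrow> real"
  assumes f: "f \<in> L2" and g: "g \<in> L2"
  shows "(\<lambda>x. f x + g x) \<in> L2"
proof -
  have "integrable lebesgue (\<lambda>x. (norm (f x))\<^sup>2 + (norm (g x))\<^sup>2 + 2 * (f x * g x))"
    by (intro Bochner_Integration.integrable_add L2_integrable f g integrable_mult_right L2_mult_integrable)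
  then show ?thesis
    using f g by (auto simp: L2_def power2_sum algebra_simps)
qed

lemma L2_cmult:
  fixes f :: "'a::euclidean_space \<Rightarrow> real"
  assumes "f \<in> L2"
  shows "(\<lambda>x. c * f x) \<in> L2"
  using assms by (auto simp: L2_def abs_mult power_mult_distrib)

lemma L2_diff:
  fixes f g :: "'a::euclidean_space \<Rightarrow> real"
  assumes "f \<in> L2" "g \<in> L2"
  shows "(\<lambda>x. f x - g x) \<in> L2"
  using L2_add[OF assms(1) L2_cmult[OF assms(2), of "-1"]] by simp

lemma L2_norm_triangle:
  fixes f g :: "'a::euclidean_space \<Rightarrow> real"
  assumes f: "f \<in> L2" and g: "g \<in> L2"
  shows "L2_norm (\<lambda>x. f x + g x) \<le> L2_norm f + L2_norm g"
proof (rule power2_le_imp_le)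
  have "(L2_norm (\<lambda>x. f x + g x))\<^sup>2 = (LINT x|lebesgue. (norm (f x))\<^sup>2 + (norm (g x))\<^sup>2 + 2 * (f x * g x))"
    unfolding L2_norm_square by (simp add: power2_sum algebra_simps)
  also have "\<dots> = (L2_norm f)\<^sup>2 + (L2_norm g)\<^sup>2 + 2 * (LINT x|lebesgue. f x * g x)"
    unfolding L2_norm_square
    using L2_integrable[OF f] L2_integrable[OF g] L2_mult_integrable[OF f g] by simp
  also have "\<dots> \<le> (L2_norm f + L2_norm g)\<^sup>2"
    using L2_inner_bound[OF f g] by (simp add: power2_sum abs_le_iff)
  finally show "(L2_norm (\<lambda>x. f x + g x))\<^sup>2 \<le> (L2_norm f + L2_norm g)\<^sup>2" .
qed (simp add: L2_norm_nonneg)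

lemma L2_norm_minus_commute: "L2_norm (\<lambda>x. f x - g x) = L2_norm (\<lambda>x. g x - f x)"
  by (simp add: L2_norm_def norm_minus_commute)

lemma L2_norm_diff_le:
  fixes f g :: "'a::euclidean_space \<Rightarrow> real"
  assumes f: "f \<in> L2" and g: "g \<in> L2"
  shows "\<bar>L2_norm f - L2_norm g\<bar> \<le> L2_norm (\<lambda>x. f x - g x)"
  using L2_norm_triangle[OF L2_diff[OF f g] g] L2_norm_triangle[OF L2_diff[OF g f] f]
  by (simp add: L2_norm_minus_commute[of g f])

text \<open>On A the integrand |f|^2 equals |h - f|^2, so the mass of f on A is at most the square
  of its distance to h.\<close>

lemma L2_limit_vanishes:
  fixes f :: "'a::euclidean_space \<Rightarrow> real"
  assumes f: "f \<in> L2" and A: "A \<in> sets lebesgue"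
    and approx: "\<And>e. e > 0 \<Longrightarrow> \<exists>h\<in>L2. (AE x in lebesgue. x \<in> A \<longrightarrow> h x = 0) \<and> L2_norm (\<lambda>x. h x - f x) < e"
  shows "AE x in lebesgue. x \<in> A \<longrightarrow> f x = 0"
proof -
  have m: "f \<in> borel_measurable lebesgue" by (rule L2_measurable[OF f])
  have i: "integrable lebesgue (\<lambda>x. indicator A x * (f x)\<^sup>2)"
    using integrable_real_mult_indicator[OF A L2_integrable[OF f]] by (simp add: mult.commute)
  have "(LINT x|lebesgue. indicator A x * (f x)\<^sup>2) \<le> e\<^sup>2" if e: "e > 0" for e
  proof -
    obtain h where h: "h \<in> L2" "AE x in lebesgue. x \<in> A \<longrightarrow> h x = 0" "L2_norm (\<lambda>x. h x - f x) < e"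
      using approx[OF e] by blast
    have "(LINT x|lebesgue. indicator A x * (f x)\<^sup>2) \<le> (LINT x|lebesgue. (norm (h x - f x))\<^sup>2)"
    proof (rule integral_mono_AE[OF i L2_integrable[OF L2_diff[OF h(1) f]]])
      show "AE x in lebesgue. indicator A x * (f x)\<^sup>2 \<le> (norm (h x - f x))\<^sup>2"
        using h(2) by eventually_elim (auto simp: indicator_def)
    qed
    also have "\<dots> \<le> e\<^sup>2"
      unfolding L2_norm_square[symmetric] using h(3) by (intro power_mono L2_norm_nonneg) auto
    finally show ?thesis .
  qed
  then have "(LINT x|lebesgue. indicator A x * (f x)\<^sup>2) \<le> 0 + e" if "e > 0" for e
    using that by (metis add_0 real_sqrt_gt_0_iff real_sqrt_pow2 less_imp_le)
  then have "(LINT x|lebesgue. indicator A x * (f x)\<^sup>2) \<le> 0"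
    by (rule field_le_epsilon)
  then have "(LINT x|lebesgue. indicator A x * (f x)\<^sup>2) = 0"
    by (intro antisym integral_nonneg_AE) auto
  then have "AE x in lebesgue. indicator A x * (f x)\<^sup>2 = 0"
    using integral_nonneg_eq_0_iff_AE[OF i] by auto
  then show ?thesis
    by eventually_elim (auto simp: indicator_def)
qed

subsection \<open>Curves in $L^2$\<close>

lemma eventually_at_within_self: "\<forall>\<^sub>F s in at t within I. s \<in> I \<and> s \<noteq> t"
  by (auto simp: eventually_at_filter)

lemma continuous_L2_D:
  assumes "continuous_L2 I w" "t \<in> I"
  shows "w t \<in> L2" "((\<lambda>s. L2_norm (\<lambda>x. w s x - w t x)) \<longlongrightarrow> 0) (at t within I)"
  using assms by (auto simp: continuous_L2_def)

lemma continuous_L2_norm: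
  assumes w: "continuous_L2 I w"
  shows "continuous_on I (\<lambda>t. L2_norm (w t))"
  unfolding continuous_on_def
proof
  fix t assume t: "t \<in> I"
  have "((\<lambda>s. L2_norm (w s) - L2_norm (w t)) \<longlongrightarrow> 0) (at t within I)"
  proof (rule Lim_null_comparison[OF _ continuous_L2_D(2)[OF w t]])
    show "\<forall>\<^sub>F s in at t within I. norm (L2_norm (w s) - L2_norm (w t)) \<le> L2_norm (\<lambda>x. w s x - w t x)"
      using eventually_at_within_self
      by eventually_elim (simp add: L2_norm_diff_le continuous_L2_D(1)[OF w] t)
  qed
  then show "((\<lambda>t. L2_norm (w t)) \<longlongrightarrow> L2_norm (w t)) (at t within I)"
    by (simp add: Lim_null[symmetric])
qed

lemma continuous_L2_inner:
  assumes w: "continuous_L2 I w" and b: "b \<in> L2"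
  shows "continuous_on I (\<lambda>t. LINT x|lebesgue. w t x * b x)"
  unfolding continuous_on_def
proof
  fix t assume t: "t \<in> I"
  have "((\<lambda>s. (LINT x|lebesgue. w s x * b x) - (LINT x|lebesgue. w t x * b x)) \<longlongrightarrow> 0) (at t within I)"
  proof (rule Lim_null_comparison)
    show "\<forall>\<^sub>F s in at t within I. norm ((LINT x|lebesgue. w s x * b x) - (LINT x|lebesgue. w t x * b x))
      \<le> L2_norm (\<lambda>x. w s x - w t x) * L2_norm b"
      using eventually_at_within_self
    proof eventually_elim
      case (elim s)
      have L: "w s \<in> L2" "w t \<in> L2" using elim t continuous_L2_D(1)[OF w] by auto
      have "(LINT x|lebesgue. w s x * b x) - (LINT x|lebesgue. w t x * b x) =
          (LINT x|lebesgue. (w s x - w t x) * b x)"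
        using L2_mult_integrable[OF L(1) b] L2_mult_integrable[OF L(2) b] by (simp add: left_diff_distrib)
      then show ?case using L2_inner_bound[OF L2_diff[OF L] b] by simp
    qed
    show "((\<lambda>s. L2_norm (\<lambda>x. w s x - w t x) * L2_norm b) \<longlongrightarrow> 0) (at t within I)"
      by (rule tendsto_mult_left_zero[OF continuous_L2_D(2)[OF w t]])
  qed
  then show "((\<lambda>t. LINT x|lebesgue. w t x * b x) \<longlongrightarrow> (LINT x|lebesgue. w t x * b x)) (at t within I)"
    by (simp add: Lim_null[symmetric])
qed

text \<open>Pairing with a fixed b reduces calculus for curves in L^2 to real functions of t. The
  derivative is taken within I, so that t = 0 is included.\<close>

lemma C1_L2_inner:
  assumes uv: "C1_L2 I u v" and b: "b \<in> L2" and t: "t \<in> I"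
  shows "((\<lambda>s. LINT x|lebesgue. u s x * b x) has_real_derivative (LINT x|lebesgue. v t x * b x)) (at t within I)"
proof -
  have u: "continuous_L2 I u" and v: "continuous_L2 I v"
    and d: "((\<lambda>s. L2_norm (\<lambda>x. (u s x - u t x) / (s - t) - v t x)) \<longlongrightarrow> 0) (at t within I)"
    using uv t by (auto simp: C1_L2_def)
  have "((\<lambda>s. ((LINT x|lebesgue. u s x * b x) - (LINT x|lebesgue. u t x * b x)) / (s - t)
      - (LINT x|lebesgue. v t x * b x)) \<longlongrightarrow> 0) (at t within I)"
  proof (rule Lim_null_comparison)
    show "\<forall>\<^sub>F s in at t within I. norm (((LINT x|lebesgue. u s x * b x) - (LINT x|lebesgue. u t x * b x)) / (s - t)
      - (LINT x|lebesgue. v t x * b x)) \<le> L2_norm (\<lambda>x. (u s x - u t x) / (s - t) - v t x) * L2_norm b"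
      using eventually_at_within_self
    proof eventually_elim
      case (elim s)
      have L: "u s \<in> L2" "u t \<in> L2" "v t \<in> L2"
        using elim t continuous_L2_D(1)[OF u] continuous_L2_D(1)[OF v] by auto
      note i = L2_mult_integrable[OF L(1) b] L2_mult_integrable[OF L(2) b] L2_mult_integrable[OF L(3) b]
      have q: "(\<lambda>x. (u s x - u t x) / (s - t) - v t x) \<in> L2"
        using L2_diff[OF L2_cmult[OF L2_diff[OF L(1,2)], of "1 / (s - t)"] L(3)] by simp
      have "((LINT x|lebesgue. u s x * b x) - (LINT x|lebesgue. u t x * b x)) / (s - t) - (LINT x|lebesgue. v t x * b x)
        = (LINT x|lebesgue. (u s x * b x - u t x * b x) / (s - t) - v t x * b x)"
        using i by simp
      also have "\<dots> = (LINT x|lebesgue. ((u s x - u t x) / (s - t) - v t x) * b x)"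
        by (intro Bochner_Integration.integral_cong refl) (simp add: left_diff_distrib)
      finally show ?case using L2_inner_bound[OF q b] by simp
    qed
    show "((\<lambda>s. L2_norm (\<lambda>x. (u s x - u t x) / (s - t) - v t x) * L2_norm b) \<longlongrightarrow> 0) (at t within I)"
      by (rule tendsto_mult_left_zero[OF d])
  qed
  then show ?thesis
    unfolding has_field_derivative_iff by (simp add: Lim_null[symmetric])
qed

subsection \<open>Space-time integrals\<close>

lemma time_interval_downward:
  assumes "t \<in> time_interval T" "0 \<le> s" "s \<le> t"
  shows "s \<in> time_interval T"
  using assms by (auto simp: time_interval_def intro: le_less_trans[of "ereal s" "ereal t"])

lemma time_interval_right_nbhd:
  assumes "t \<in> time_interval T" "d > 0"
  obtains r where "t < r" "r < t + d" "\<And>s. t \<le> s \<Longrightarrow> s \<le> r \<Longrightarrow> s \<in> time_interval T"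
proof -
  have "ereal t < min T (ereal (t + d))" using assms by (auto simp: time_interval_def)
  then obtain r where "ereal t < ereal r" "ereal r < min T (ereal (t + d))"
    using ereal_dense2 by blast
  then show thesis
    using assms by (intro that[of r]) (auto simp: time_interval_def intro: le_less_trans[of _ "ereal r"])
qed

lemma spacetime_measurable: "time_interval T \<times> (UNIV :: 'a::euclidean_space set) \<in> sets lebesgue"
proof -
  have "time_interval T \<in> sets borel"
    unfolding time_interval_def by measurable
  then have "fst -` time_interval T \<inter> space borel \<in> sets (borel :: (real \<times> 'a) measure)"
    by (intro measurable_sets[of fst borel borel]) (auto intro: borel_measurable_continuous_onI[OF continuous_on_fst[OF continuous_on_id]])
  moreover have "fst -` time_interval T = time_interval T \<times> (UNIV :: 'a set)" by auto
  ultimately show ?thesis by (simp add: sets_completionI_sets)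
qed

text \<open>Reduces double integrals against separated functions to integrals over [0, M], where the
  fundamental theorem of calculus applies. The majorant |\<kappa>| times the two L^2 norms is
  continuous in t.\<close>

lemma spacetime_integral:
  fixes w :: "real \<Rightarrow> 'a::euclidean_space \<Rightarrow> real" and T :: ereal
  defines "Q \<equiv> time_interval T \<times> (UNIV :: 'a set)"
  assumes w: "continuous_L2 (time_interval T) w"
    and meas: "(\<lambda>(t, x). w t x) \<in> borel_measurable (lebesgue_on Q)"
    and \<kappa>: "continuous_on UNIV \<kappa>" "\<And>t. M \<le> t \<Longrightarrow> \<kappa> t = 0"
    and M: "M \<in> time_interval T"
    and b: "b \<in> L2" "b \<in> borel_measurable borel"
  shows "set_integrable lebesgue Q (\<lambda>(t, x). w t x * (\<kappa> t * b x))"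
    and "set_lebesgue_integral lebesgue Q (\<lambda>(t, x). w t x * (\<kappa> t * b x)) =
      (LINT t|lborel. indicator {0..M} t *\<^sub>R (\<kappa> t * (LINT x|lebesgue. w t x * b x)))"
proof -
  let ?I = "time_interval T"
  define F where "F z = indicator Q z *\<^sub>R (case z of (t, x) \<Rightarrow> w t x * (\<kappa> t * b x))" for z
  have sub: "{0..M} \<subseteq> ?I" using time_interval_downward[OF M] by auto
  have QI: "Q \<in> sets lebesgue" unfolding Q_def by (rule spacetime_measurable)
  have mF: "F \<in> borel_measurable lebesgue"
  proof -
    have "(\<lambda>z. indicator Q z *\<^sub>R (case z of (t, x) \<Rightarrow> w t x)) \<in> borel_measurable lebesgue"
      using meas QI by (subst (asm) borel_measurable_restrict_space_iff) auto
    moreover have "(\<lambda>z. \<kappa> (fst z) * b (snd z)) \<in> borel_measurable lebesgue"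
    proof (rule measurable_completion)
      have "(\<lambda>z. \<kappa> (fst z) * b (snd z)) \<in> borel_measurable (borel \<Otimes>\<^sub>M borel)"
        using b(2) borel_measurable_continuous_onI[OF \<kappa>(1)] by measurable
      then show "(\<lambda>z. \<kappa> (fst z) * b (snd z)) \<in> borel_measurable lborel"
        by (simp add: borel_prod)
    qed
    ultimately have "(\<lambda>z. (indicator Q z *\<^sub>R (case z of (t, x) \<Rightarrow> w t x)) * (\<kappa> (fst z) * b (snd z))) \<in> borel_measurable lebesgue"
      by (rule borel_measurable_times)
    then show ?thesis
      by (rule measurable_cong[THEN iffD1, rotated]) (auto simp: F_def split: prod.split)
  qed
  define H where "H t = indicator {0..M} t *\<^sub>R (\<bar>\<kappa> t\<bar> * (L2_norm (w t) * L2_norm b))" for t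
  \<comment> \<open>\<kappa> vanishes beyond M, so the indicator of the time interval may be
    replaced by that of {0..M}; M < T keeps this compact interval inside.\<close>
  have slice: "F (t, x) = indicator {0..M} t * (\<kappa> t * (w t x * b x))" for t x
  proof (cases "t \<in> {0..M}")
    case True
    then show ?thesis using sub by (auto simp: F_def Q_def)
  next
    case False
    then have "t \<notin> ?I \<or> \<kappa> t = 0" using \<kappa>(2)[of t] by (auto simp: time_interval_def)
    then show ?thesis using False by (auto simp: F_def Q_def)
  qed
  have wb: "integrable lebesgue (\<lambda>x. w t x * b x)" if "t \<in> {0..M}" for t
    using that sub continuous_L2_D(1)[OF w] by (intro L2_mult_integrable b) auto
  have iF: "integrable lebesgue F"
  proof (rule integrable_lebesgue_pairI[OF mF])
    show "AE t in lborel. integrable lebesgue (\<lambda>x. F (t, x))"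
    proof (intro AE_I2)
      fix t show "integrable lebesgue (\<lambda>x. F (t, x))"
        by (cases "t \<in> {0..M}") (auto simp: slice intro!: integrable_mult_right wb)
    qed
    show "AE t in lborel. (LINT x|lebesgue. \<bar>F (t, x)\<bar>) \<le> H t"
    proof (intro AE_I2)
      fix t show "(LINT x|lebesgue. \<bar>F (t, x)\<bar>) \<le> H t"
      proof (cases "t \<in> {0..M}")
        case True
        then have "w t \<in> L2" using sub continuous_L2_D(1)[OF w] by auto
        then show ?thesis using True L2_Cauchy_Schwarz[of "w t" b] b(1)
          by (simp add: slice H_def abs_mult mult_left_mono)
      qed (simp add: slice H_def)
    qed
    have "continuous_on {0..M} (\<lambda>t. \<bar>\<kappa> t\<bar> * (L2_norm (w t) * L2_norm b))"
      by (intro continuous_intros continuous_on_subset[OF continuous_L2_norm[OF w] sub]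
            continuous_on_subset[OF \<kappa>(1)]) auto
    then show "integrable lborel H"
      unfolding H_def by (intro borel_integrable_compact) auto
  qed
  then show "set_integrable lebesgue Q (\<lambda>(t, x). w t x * (\<kappa> t * b x))"
    by (simp add: set_integrable_def F_def[abs_def])
  have c: "continuous_on {0..M} (\<lambda>t. \<kappa> t * (LINT x|lebesgue. w t x * b x))"
    by (intro continuous_intros continuous_on_subset[OF continuous_L2_inner[OF w b(1)] sub]
          continuous_on_subset[OF \<kappa>(1)]) auto
  have m: "(\<lambda>t. indicator {0..M} t *\<^sub>R (\<kappa> t * (LINT x|lebesgue. w t x * b x))) \<in> borel_measurable lborel"
    by (rule borel_measurable_integrable[OF borel_integrable_compact[OF _ c]]) auto
  have "set_lebesgue_integral lebesgue Q (\<lambda>(t, x). w t x * (\<kappa> t * b x)) = integral\<^sup>L lebesgue F"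
    by (simp add: set_lebesgue_integral_def F_def[abs_def])
  also have "\<dots> = (LINT t|lebesgue. LINT x|lebesgue. F (t, x))"
    by (rule integrable_lebesgue_pair(2)[OF iF])
  also have "\<dots> = (LINT t|lebesgue. indicator {0..M} t *\<^sub>R (\<kappa> t * (LINT x|lebesgue. w t x * b x)))"
    by (simp add: slice)
  also have "\<dots> = (LINT t|lborel. indicator {0..M} t *\<^sub>R (\<kappa> t * (LINT x|lebesgue. w t x * b x)))"
    by (rule integral_completion[OF m])
  finally show "set_lebesgue_integral lebesgue Q (\<lambda>(t, x). w t x * (\<kappa> t * b x)) =
      (LINT t|lborel. indicator {0..M} t *\<^sub>R (\<kappa> t * (LINT x|lebesgue. w t x * b x)))" .
qed

text \<open>The fundamental theorem of calculus for \<kappa>(t) times the pairing of u(t) with b.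
  Only the boundary term at t = 0 survives, since \<kappa>(M) = 0.\<close>

lemma spacetime_by_parts:
  fixes u v :: "real \<Rightarrow> 'a::euclidean_space \<Rightarrow> real" and T :: ereal
  defines "Q \<equiv> time_interval T \<times> (UNIV :: 'a set)"
  assumes uv: "C1_L2 (time_interval T) u v"
    and mu: "(\<lambda>(t, x). u t x) \<in> borel_measurable (lebesgue_on Q)"
    and mv: "(\<lambda>(t, x). v t x) \<in> borel_measurable (lebesgue_on Q)"
    and \<kappa>: "\<And>t. (\<kappa> has_real_derivative \<kappa>1 t) (at t)" "continuous_on UNIV \<kappa>1"
    and z: "\<And>t. M \<le> t \<Longrightarrow> \<kappa> t = 0" "\<And>t. M \<le> t \<Longrightarrow> \<kappa>1 t = 0"
    and M: "M \<in> time_interval T"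
    and b: "b \<in> L2" "b \<in> borel_measurable borel"
  shows "set_lebesgue_integral lebesgue Q (\<lambda>(t, x). u t x * (\<kappa>1 t * b x)) =
    - \<kappa> 0 * (LINT x|lebesgue. u 0 x * b x) - set_lebesgue_integral lebesgue Q (\<lambda>(t, x). v t x * (\<kappa> t * b x))"
proof -
  have u: "continuous_L2 (time_interval T) u" and v: "continuous_L2 (time_interval T) v"
    using uv by (auto simp: C1_L2_def)
  have \<kappa>c: "continuous_on UNIV \<kappa>"
    by (intro DERIV_continuous_on[OF has_field_derivative_at_within[OF \<kappa>(1)]])
  define U where "U t = (LINT x|lebesgue. u t x * b x)" for t
  define V where "V t = (LINT x|lebesgue. v t x * b x)" for t
  have sub: "{0..M} \<subseteq> time_interval T" using time_interval_downward[OF M] by auto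
  have M0: "0 \<le> M" using M by (simp add: time_interval_def)
  have Uc: "continuous_on {0..M} U" and Vc: "continuous_on {0..M} V"
    unfolding U_def[abs_def] V_def[abs_def]
    using continuous_on_subset[OF continuous_L2_inner[OF u b(1)] sub]
      continuous_on_subset[OF continuous_L2_inner[OF v b(1)] sub] by simp_all
  have c1: "continuous_on {0..M} (\<lambda>t. \<kappa>1 t * U t)" and c2: "continuous_on {0..M} (\<lambda>t. \<kappa> t * V t)"
    by (auto intro!: continuous_intros Uc Vc continuous_on_subset[OF \<kappa>(2)] continuous_on_subset[OF \<kappa>c])
  have "(LINT t|lborel. indicator {0..M} t *\<^sub>R (\<kappa>1 t * U t + \<kappa> t * V t)) = \<kappa> M * U M - \<kappa> 0 * U 0"
  proof (rule integral_FTC_atLeastAtMost[OF M0])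
    fix t assume t: "0 \<le> t" "t \<le> M"
    then have "t \<in> time_interval T" using sub by auto
    from has_field_derivative_subset[OF C1_L2_inner[OF uv b(1) this] sub]
    have "(U has_real_derivative V t) (at t within {0..M})"
      by (simp add: U_def[abs_def] V_def)
    from DERIV_mult[OF has_field_derivative_at_within[OF \<kappa>(1)] this]
    show "((\<lambda>t. \<kappa> t * U t) has_vector_derivative \<kappa>1 t * U t + \<kappa> t * V t) (at t within {0..M})"
      by (simp add: has_real_derivative_iff_has_vector_derivative[symmetric] mult_ac)
  qed (intro continuous_on_add c1 c2)
  moreover have "(LINT t|lborel. indicator {0..M} t *\<^sub>R (\<kappa>1 t * U t + \<kappa> t * V t)) =
    (LINT t|lborel. indicator {0..M} t *\<^sub>R (\<kappa>1 t * U t)) + (LINT t|lborel. indicator {0..M} t *\<^sub>R (\<kappa> t * V t))"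
    unfolding scaleR_add_right
    by (intro Bochner_Integration.integral_add borel_integrable_compact c1 c2) auto
  ultimately show ?thesis
    unfolding Q_def
    using spacetime_integral(2)[OF u mu[unfolded Q_def] \<kappa>(2) z(2) M b]
      spacetime_integral(2)[OF v mv[unfolded Q_def] \<kappa>c z(1) M b] z(1)[of M]
    by (simp add: U_def V_def)
qed

subsection \<open>Finite speed of propagation\<close>

lemma AE_lborel_Ioo:
  fixes a b :: real
  assumes "AE t in lborel. P t" "a < b"
  obtains t where "a < t" "t < b" "P t"
proof -
  have "\<exists>t. a < t \<and> t < b \<and> P t"
  proof (rule ccontr)
    assume n: "\<not> ?thesis"
    have "AE t in lborel. t \<notin> {a<..<b}"
      using assms(1) by eventually_elim (use n in auto)
    then have "{a<..<b} \<in> null_sets lborel" by (subst (asm) AE_iff_null_sets[symmetric]) auto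
    then show False using assms(2) by (auto simp: null_sets_def)
  qed
  then show thesis using that by blast
qed

text \<open>The approximants live at slightly later times and vanish only outside slightly larger
  balls; the excess h is removed along h = 1/(k+1).\<close>

lemma L2_limit_cone:
  fixes f :: "'a::euclidean_space \<Rightarrow> real"
  assumes f: "f \<in> L2"
    and approx: "\<And>e h. e > 0 \<Longrightarrow> h > 0 \<Longrightarrow>
      \<exists>g\<in>L2. (AE x in lebesgue. r + h < norm x \<longrightarrow> g x = 0) \<and> L2_norm (\<lambda>x. g x - f x) < e"
  shows "AE x in lebesgue. r < norm x \<longrightarrow> f x = 0"
proof -
  have "AE x in lebesgue. x \<in> {x. r + 1 / real (Suc k) < norm x} \<longrightarrow> f x = 0" for k
  proof (rule L2_limit_vanishes[OF f])
    show "{x::'a. r + 1 / real (Suc k) < norm x} \<in> sets lebesgue"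
      by (intro sets_completionI_sets) simp
  qed (use approx[of _ "1 / real (Suc k)"] in auto)
  then have "AE x in lebesgue. \<forall>k. x \<in> {x. r + 1 / real (Suc k) < norm x} \<longrightarrow> f x = 0"
    unfolding AE_all_countable by blast
  then show ?thesis
  proof eventually_elim
    case (elim x)
    show ?case
    proof
      assume "r < norm x"
      then obtain k where "1 / real (Suc k) < norm x - r"
        using nat_approx_posE[of "norm x - r"] by auto
      then have "x \<in> {x. r + 1 / real (Suc k) < norm x}" by simp
      then show "f x = 0" using elim by blast
    qed
  qed
qed

text \<open>The support hypothesis ignores null sets of space-time, so by itself it controls u t
  only for almost every t. Continuity in L^2 extends it to every t, and the difference quotients
  then carry it over to v.\<close>

lemma solution_cone:
  fixes u v :: "real \<Rightarrow> 'a::euclidean_space \<Rightarrow> real" and T :: ereal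
  assumes uv: "C1_L2 (time_interval T) u v"
    and supp: "ess_support_on (time_interval T \<times> UNIV) (\<lambda>(t, x). u t x)
       \<subseteq> {(t, x). t \<in> time_interval T \<and> norm x \<le> t + 1}"
    and t: "t \<in> time_interval T"
  shows "AE x in lebesgue. t + 1 < norm x \<longrightarrow> u t x = 0"
    and "AE x in lebesgue. t + 1 < norm x \<longrightarrow> v t x = 0"
proof -
  let ?I = "time_interval T"
  have u: "continuous_L2 ?I u" and v: "continuous_L2 ?I v"
    and d: "\<And>t. t \<in> ?I \<Longrightarrow> ((\<lambda>s. L2_norm (\<lambda>x. (u s x - u t x) / (s - t) - v t x)) \<longlongrightarrow> 0) (at t within ?I)"
    using uv by (auto simp: C1_L2_def)
  have "AE z in lebesgue. z \<in> ?I \<times> UNIV \<and> fst z + 1 < norm (snd z) \<longrightarrow> (case z of (t, x) \<Rightarrow> u t x) = 0"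
    using AE_not_in_ess_support[of "?I \<times> UNIV" "\<lambda>(t, x). u t x"]
    by eventually_elim (use supp in force)
  from AE_lebesgue_pair[OF this]
  have good: "AE t in lborel. t \<in> ?I \<longrightarrow> (AE x in lebesgue. t + 1 < norm x \<longrightarrow> u t x = 0)"
    by eventually_elim auto
  \<comment> \<open>Times are chosen to the right of t: the interval is open on that side, and t = 0
    is covered.\<close>
  have near: "\<exists>r>t. \<forall>s. t < s \<longrightarrow> s < r \<longrightarrow> s \<in> ?I \<and> s < t + h \<and> dist (\<phi> s) 0 < e"
    if tI: "t \<in> ?I" and \<phi>: "(\<phi> \<longlongrightarrow> 0) (at t within ?I)" and e: "e > 0" and h: "h > 0" for t h e and \<phi> :: "real \<Rightarrow> real"
  proof -
    obtain \<delta> where \<delta>: "\<delta> > 0" "\<And>s. s \<in> ?I \<Longrightarrow> s \<noteq> t \<Longrightarrow> dist s t < \<delta> \<Longrightarrow> dist (\<phi> s) 0 < e"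
      using tendstoD[OF \<phi> e] by (auto simp: eventually_at)
    obtain r where r: "t < r" "r < t + min \<delta> h" "\<And>s. t \<le> s \<Longrightarrow> s \<le> r \<Longrightarrow> s \<in> ?I"
      using time_interval_right_nbhd[OF tI, of "min \<delta> h"] \<delta>(1) h by auto
    show ?thesis
      using r \<delta>(2) by (intro exI[of _ r]) (auto simp: dist_real_def)
  qed
  have U: "AE x in lebesgue. t + 1 < norm x \<longrightarrow> u t x = 0" if t: "t \<in> ?I" for t
  proof (rule L2_limit_cone[OF continuous_L2_D(1)[OF u t]])
    fix e h :: real assume e: "e > 0" and h: "h > 0"
    obtain r where r: "r > t" "\<And>s. t < s \<Longrightarrow> s < r \<Longrightarrow> s \<in> ?I \<and> s < t + h \<and> L2_norm (\<lambda>x. u s x - u t x) < e"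
      using near[OF t continuous_L2_D(2)[OF u t] e h] by (auto simp: abs_less_iff)
    obtain s where s: "t < s" "s < r" "s \<in> ?I \<longrightarrow> (AE x in lebesgue. s + 1 < norm x \<longrightarrow> u s x = 0)"
      using AE_lborel_Ioo[OF good r(1)] by blast
    have "AE x in lebesgue. s + 1 < norm x \<longrightarrow> u s x = 0" using s r(2)[OF s(1,2)] by blast
    then have "AE x in lebesgue. t + 1 + h < norm x \<longrightarrow> u s x = 0"
      by eventually_elim (use r(2)[OF s(1,2)] in auto)
    then show "\<exists>g\<in>L2. (AE x in lebesgue. t + 1 + h < norm x \<longrightarrow> g x = 0) \<and> L2_norm (\<lambda>x. g x - u t x) < e"
      using r(2)[OF s(1,2)] continuous_L2_D(1)[OF u] by blast
  qed
  show "AE x in lebesgue. t + 1 < norm x \<longrightarrow> u t x = 0" by (rule U[OF t])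
  show "AE x in lebesgue. t + 1 < norm x \<longrightarrow> v t x = 0"
  proof (rule L2_limit_cone[OF continuous_L2_D(1)[OF v t]])
    fix e h :: real assume e: "e > 0" and h: "h > 0"
    obtain r where r: "r > t" "\<And>s. t < s \<Longrightarrow> s < r \<Longrightarrow>
        s \<in> ?I \<and> s < t + h \<and> L2_norm (\<lambda>x. (u s x - u t x) / (s - t) - v t x) < e"
      using near[OF t d[OF t] e h] by (auto simp: abs_less_iff)
    define s where "s = (t + r) / 2"
    have s: "t < s" "s < r" using r(1) by (auto simp: s_def)
    note s' = r(2)[OF s]
    have "AE x in lebesgue. t + 1 + h < norm x \<longrightarrow> (u s x - u t x) / (s - t) = 0"
      using U[OF t] U[OF conjunct1[OF s']] by eventually_elim (use s' h in auto)
    moreover have "(\<lambda>x. (u s x - u t x) / (s - t)) \<in> L2"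
      using L2_cmult[OF L2_diff[of "u s" "u t"], of "1 / (s - t)"] continuous_L2_D(1)[OF u] s' t by simp
    ultimately show "\<exists>g\<in>L2. (AE x in lebesgue. t + 1 + h < norm x \<longrightarrow> g x = 0) \<and> L2_norm (\<lambda>x. g x - v t x) < e"
      using s' by (intro bexI[of _ "\<lambda>x. (u s x - u t x) / (s - t)"]) auto
  qed
qed

subsection \<open>Volume growth\<close>

lemma power_diff_le:
  fixes x :: real
  assumes "x \<ge> 0"
  shows "(x + 1) ^ n - x ^ n \<le> real n * (x + 1) ^ (n - 1)"
proof (cases n)
  case (Suc k)
  have "(x + 1) ^ n - x ^ n = (\<Sum>i<n. (x + 1) ^ i * x ^ (k - i))"
    using power_diff_sumr2[of "x + 1" n x] Suc by (simp add: mult.commute)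
  also have "\<dots> \<le> (\<Sum>i<n. (x + 1) ^ i * (x + 1) ^ (k - i))"
    using assms by (intro sum_mono mult_left_mono power_mono) auto
  also have "\<dots> = (\<Sum>i<n. (x + 1) ^ k)"
    using Suc by (intro sum.cong) (auto simp: power_add[symmetric])
  finally show ?thesis using Suc by simp
qed simp

lemma emeasure_shell_le:
  "emeasure lborel (cball (0::'a::euclidean_space) (real (Suc k)) - cball 0 (real k)) \<le>
    ennreal (unit_ball_vol (real DIM('a)) * (real DIM('a) * (real k + 1) ^ (DIM('a) - 1)))"
proof -
  let ?n = "DIM('a)" and ?v = "unit_ball_vol (real DIM('a))"
  have v: "?v \<ge> 0" by simp
  have "emeasure lborel (cball (0::'a) (real (Suc k)) - cball 0 (real k)) =
      emeasure lborel (cball (0::'a) (real (Suc k))) - emeasure lborel (cball (0::'a) (real k))"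
    by (rule emeasure_Diff) (auto simp: emeasure_cball)
  also have "\<dots> = ennreal (?v * (real k + 1) ^ ?n - ?v * real k ^ ?n)"
    using v by (simp add: emeasure_cball ennreal_minus add.commute)
  also have "\<dots> \<le> ennreal (?v * (real ?n * (real k + 1) ^ (?n - 1)))"
    unfolding right_diff_distrib[symmetric]
    by (intro ennreal_leI mult_left_mono power_diff_le v) simp
  finally show ?thesis .
qed

text \<open>The exponential $e^{|x|}$ makes the last unit shell dominate.\<close>

lemma ball_growth:
  assumes m: "m = (real DIM('a::euclidean_space) - 1) / 2"
  shows "\<exists>D>0. \<forall>\<rho>\<ge>0. (\<integral>\<^sup>+x. indicator (cball (0::'a) \<rho>) x * ennreal (exp (norm x) * (1 + norm x) powr (- m)) \<partial>lborel)
    \<le> ennreal (D * (1 + \<rho>) powr m * exp \<rho>)"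
proof -
  let ?n = "DIM('a)" and ?v = "unit_ball_vol (real DIM('a))"
  let ?h = "\<lambda>x::'a. ennreal (exp (norm x) * (1 + norm x) powr (- m))"
  define J where "J \<rho> = (\<integral>\<^sup>+x. indicator (cball (0::'a) \<rho>) x * ?h x \<partial>lborel)" for \<rho>
  define E where "E = ?v * real ?n * exp 1"
  have "0 \<le> (real N - 1) / 2" if "0 < N" for N
    using that by simp
  from this[OF DIM_positive[where 'a = 'a]] have m0: "m \<ge> 0" unfolding m .
  have E: "E \<ge> 0" by (simp add: E_def)
  have mh[measurable]: "?h \<in> borel_measurable borel" by measurable
  have mi[measurable]: "(indicator (cball (0::'a) \<rho>) :: 'a \<Rightarrow> ennreal) \<in> borel_measurable borel" for \<rho>
    by (intro borel_measurable_indicator) auto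
  have md[measurable]: "(indicator (cball (0::'a) \<rho> - cball 0 \<sigma>) :: 'a \<Rightarrow> ennreal) \<in> borel_measurable borel" for \<rho> \<sigma>
    by (intro borel_measurable_indicator) auto
  have shell: "(\<integral>\<^sup>+x. indicator (cball (0::'a) (real (Suc k)) - cball 0 (real k)) x * ?h x \<partial>lborel)
      \<le> ennreal (E * (1 + real k) powr m * exp (real k))" for k
  proof -
    have "(\<integral>\<^sup>+x. indicator (cball (0::'a) (real (Suc k)) - cball 0 (real k)) x * ?h x \<partial>lborel)
      \<le> (\<integral>\<^sup>+x. ennreal (exp (real k + 1) * (1 + real k) powr (- m)) * indicator (cball (0::'a) (real (Suc k)) - cball 0 (real k)) x \<partial>lborel)"
    proof (intro nn_integral_mono)
      fix x :: 'a
      have "exp (norm x) * (1 + norm x) powr (- m) \<le> exp (real k + 1) * (1 + real k) powr (- m)"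
        if "real k < norm x" "norm x \<le> real k + 1"
        using that m0 by (intro mult_mono powr_mono2') auto
      then show "indicator (cball (0::'a) (real (Suc k)) - cball 0 (real k)) x * ?h x \<le>
        ennreal (exp (real k + 1) * (1 + real k) powr (- m)) * indicator (cball (0::'a) (real (Suc k)) - cball 0 (real k)) x"
        by (auto simp: indicator_def ennreal_leI)
    qed
    also have "\<dots> = ennreal (exp (real k + 1) * (1 + real k) powr (- m)) *
        emeasure lborel (cball (0::'a) (real (Suc k)) - cball 0 (real k))"
      by (rule nn_integral_cmult_indicator) simp
    also have "\<dots> \<le> ennreal (exp (real k + 1) * (1 + real k) powr (- m)) *
        ennreal (?v * (real ?n * (real k + 1) ^ (?n - 1)))"
      by (intro mult_left_mono emeasure_shell_le) simp
    also have "\<dots> = ennreal (exp (real k + 1) * (1 + real k) powr (- m) * (?v * (real ?n * (real k + 1) ^ (?n - 1))))"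
      by (simp add: ennreal_mult)
    also have "exp (real k + 1) * (1 + real k) powr (- m) * (?v * (real ?n * (real k + 1) ^ (?n - 1))) =
      E * ((1 + real k) powr (- m) * (1 + real k) ^ (?n - 1)) * exp (real k)"
      by (simp add: E_def exp_add add.commute)
    also have "(1 + real k) ^ (?n - 1) = (1 + real k) powr (2 * m)"
    proof -
      have "2 * m = real (?n - 1)" using m DIM_positive[where 'a = 'a] by (simp add: of_nat_diff Suc_le_eq)
      then show ?thesis by (simp add: powr_realpow[symmetric])
    qed
    also have "(1 + real k) powr (- m) * (1 + real k) powr (2 * m) = (1 + real k) powr m"
      by (simp add: powr_add[symmetric])
    finally show ?thesis .
  qed
  \<comment> \<open>With E \<le> D one has D + E \<le> 2D \<le> eD, so the factor e gained from k to
    k + 1 pays for the new shell.\<close>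
  define D where "D = 2 * E + 1"
  have D: "D > 0" using E by (simp add: D_def)
  have J: "J (real k) \<le> ennreal (D * (1 + real k) powr m * exp (real k))" for k
  proof (induction k)
    case 0
    have "J 0 = (\<integral>\<^sup>+x. ?h 0 * indicator {0::'a} x \<partial>lborel)"
      unfolding J_def by (intro nn_integral_cong) (auto simp: indicator_def)
    also have "\<dots> = 0" by simp
    finally show ?case by simp
  next
    case (Suc k)
    have "J (real (Suc k)) = (\<integral>\<^sup>+x. indicator (cball (0::'a) (real k)) x * ?h x +
        indicator (cball (0::'a) (real (Suc k)) - cball 0 (real k)) x * ?h x \<partial>lborel)"
      unfolding J_def by (intro nn_integral_cong) (auto simp: indicator_def)
    also have "\<dots> = J (real k) + (\<integral>\<^sup>+x. indicator (cball (0::'a) (real (Suc k)) - cball 0 (real k)) x * ?h x \<partial>lborel)"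
      unfolding J_def by (rule nn_integral_add) (use mh mi md in simp_all)
    also have "\<dots> \<le> ennreal (D * (1 + real k) powr m * exp (real k)) + ennreal (E * (1 + real k) powr m * exp (real k))"
      by (intro add_mono Suc shell)
    also have "\<dots> = ennreal ((D + E) * ((1 + real k) powr m * exp (real k)))"
      using D E by (simp add: ennreal_plus[symmetric] distrib_right mult.assoc del: ennreal_plus)
    also have "\<dots> \<le> ennreal (D * ((1 + real (Suc k)) powr m * exp (real (Suc k))))"
    proof (rule ennreal_leI)
      have "D + E \<le> D * exp 1"
      proof -
        have "D + E \<le> D * 2" using E by (simp add: D_def)
        also have "\<dots> \<le> D * exp 1" using exp_ge_add_one_self[of 1] D by (intro mult_left_mono) auto
        finally show ?thesis .
      qed
      then have "(D + E) * ((1 + real k) powr m * exp (real k)) \<le> D * exp 1 * ((1 + real k) powr m * exp (real k))"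
        by (intro mult_right_mono) auto
      also have "\<dots> \<le> D * exp 1 * ((1 + real (Suc k)) powr m * exp (real k))"
        using D m0 by (intro mult_left_mono mult_right_mono powr_mono2) auto
      also have "\<dots> = D * ((1 + real (Suc k)) powr m * exp (real (Suc k)))"
        by (simp add: exp_add mult_ac)
      finally show "(D + E) * ((1 + real k) powr m * exp (real k)) \<le> D * ((1 + real (Suc k)) powr m * exp (real (Suc k)))" .
    qed
    finally show ?case by (simp add: mult.assoc)
  qed
  have "J \<rho> \<le> ennreal (D * 2 powr m * exp 1 * (1 + \<rho>) powr m * exp \<rho>)" if \<rho>: "\<rho> \<ge> 0" for \<rho>
  proof -
    define k where "k = nat \<lceil>\<rho>\<rceil>"
    have k: "\<rho> \<le> real k" "real k \<le> \<rho> + 1"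
      using \<rho> by (auto simp: k_def)
    have "J \<rho> \<le> J (real k)"
      unfolding J_def using k by (intro nn_integral_mono mult_right_mono) (auto simp: indicator_def)
    also have "\<dots> \<le> ennreal (D * (1 + real k) powr m * exp (real k))" by (rule J)
    also have "\<dots> \<le> ennreal (D * (2 * (1 + \<rho>)) powr m * exp (\<rho> + 1))"
      using k \<rho> D m0 by (intro ennreal_leI mult_mono powr_mono2) auto
    also have "D * (2 * (1 + \<rho>)) powr m * exp (\<rho> + 1) = D * 2 powr m * exp 1 * (1 + \<rho>) powr m * exp \<rho>"
    proof -
      have "(2 * (1 + \<rho>)) powr m = 2 powr m * (1 + \<rho>) powr m" by (rule powr_mult)
      then show ?thesis by (simp only: exp_add mult_ac)
    qed
    finally show ?thesis .
  qed
  moreover have "D * 2 powr m * exp 1 > 0" using D by simp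
  ultimately show ?thesis unfolding J_def by blast
qed

subsection \<open>Test functions\<close>

definition laplacian :: "('a::euclidean_space \<Rightarrow> real) \<Rightarrow> 'a \<Rightarrow> real" where
  "laplacian \<Phi> x = (\<Sum>b\<in>Basis. pderivative b (pderivative b \<Phi>) x)"

definition gradient :: "('a::euclidean_space \<Rightarrow> real) \<Rightarrow> 'a \<Rightarrow> 'a" where
  "gradient \<Phi> x = (\<Sum>b\<in>Basis. pderivative b \<Phi> x *\<^sub>R b)"

lemma smooth_pderivative: "smooth \<Phi> \<Longrightarrow> b \<in> Basis \<Longrightarrow> smooth (pderivative b \<Phi>)"
  unfolding smooth_def by (metis C_k.simps(2))

lemma smooth_continuous: "smooth \<Phi> \<Longrightarrow> continuous_on UNIV \<Phi>"
  unfolding smooth_def using C_k_continuous by blast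

lemma smooth_has_derivative: "smooth \<Phi> \<Longrightarrow> (\<Phi> has_derivative frechet_derivative \<Phi> (at x)) (at x)"
  unfolding smooth_def using C_k_derivative(1) by blast

lemma smooth_mult: "smooth f \<Longrightarrow> smooth g \<Longrightarrow> smooth (\<lambda>x. f x * g x)"
  by (simp add: smooth_def C_k_mult)

lemma laplacian_continuous:
  assumes "smooth \<Phi>"
  shows "continuous_on UNIV (laplacian \<Phi>)"
  unfolding laplacian_def[abs_def]
  by (intro continuous_on_sum smooth_continuous smooth_pderivative assms)

lemma pderivative_local:
  assumes "open S" "x \<in> S" "\<And>y. y \<in> S \<Longrightarrow> f y = g y"
  shows "pderivative b f x = pderivative b g x"
proof -
  have "(f has_derivative D) (at x) \<longleftrightarrow> (g has_derivative D) (at x)" for D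
    using assms by (auto intro: has_derivative_transform_within_open)
  then show ?thesis by (simp add: pderivative_def frechet_derivative_def)
qed

lemma test_function_bounded:
  fixes \<Phi> :: "'a::euclidean_space \<Rightarrow> real"
  assumes "smooth \<Phi>" and z: "\<And>x. x \<notin> K \<Longrightarrow> \<Phi> x = 0" and K: "compact K" "K \<subseteq> S"
  shows "test_function S \<Phi>"
proof -
  have "closure {x. \<Phi> x \<noteq> 0} \<subseteq> K"
    using z by (intro closure_minimal compact_imp_closed K) auto
  then show ?thesis
    unfolding test_function_def
    using assms(1) K compact_Int_closed[OF K(1) closed_closure, of "{x. \<Phi> x \<noteq> 0}"]
    by (auto simp: inf.absorb2)
qed

lemma radial_cutoff:
  fixes P :: "real poly" and R :: real
  assumes R: "R > 0"
  obtains \<Phi> :: "'a::euclidean_space \<Rightarrow> real" where "smooth \<Phi>"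
    "\<And>x. R + 1 \<le> norm x \<Longrightarrow> \<Phi> x = 0" "\<And>x. norm x \<le> R \<Longrightarrow> \<Phi> x = poly P (x \<bullet> x)"
    "\<And>x. norm x < R \<Longrightarrow> laplacian \<Phi> x = poly (radial_laplacian DIM('a) P) (x \<bullet> x)"
proof -
  \<comment> \<open>The inner bump is 0 for |x| \<le> R, which makes the outer factor exactly 1. For
    |x| \<ge> R + 1 its argument is at least 2R + 1, so the outer argument is nonpositive and the
    product vanishes.\<close>
  define \<Phi> where "\<Phi> x = poly P (x \<bullet> x) * (exp 1 * bump 1 (1 + (- exp 1) * bump 1 (x \<bullet> x + (- R\<^sup>2))))" for x :: 'a
  have sm: "smooth \<Phi>"
    unfolding smooth_def \<Phi>_def by (intro allI C_k_mult C_k_poly C_k_norm_square C_k_const C_k_bump C_k_add)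
  have z: "\<Phi> x = 0" if "R + 1 \<le> norm x" for x
  proof -
    have "(R + 1)\<^sup>2 \<le> (norm x)\<^sup>2" using that R by (intro power_mono) auto
    then have "1 \<le> x \<bullet> x + (- R\<^sup>2)" using R by (simp add: power2_sum dot_square_norm)
    then have "bump 1 1 \<le> bump 1 (x \<bullet> x + (- R\<^sup>2))" by (rule bump_mono)
    then have "exp 1 * exp (- 1) \<le> exp 1 * bump 1 (x \<bullet> x + (- R\<^sup>2))" by (simp add: bump_1_1)
    then have "1 + (- exp 1) * bump 1 (x \<bullet> x + (- R\<^sup>2)) \<le> 0" by (simp add: mult_exp_exp)
    then show ?thesis by (simp add: \<Phi>_def bump_eq_0)
  qed
  have eq: "\<Phi> x = poly P (x \<bullet> x)" if "norm x \<le> R" for x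
  proof -
    have "x \<bullet> x \<le> R\<^sup>2" using that R by (simp add: dot_square_norm power_mono)
    then show ?thesis by (simp add: \<Phi>_def bump_eq_0 bump_1_1 mult_exp_exp)
  qed
  have d1: "((\<lambda>x. poly p (x \<bullet> x)) has_derivative (\<lambda>h. poly (pderiv p) (x \<bullet> x) * (2 * (x \<bullet> h)))) (at x)"
    for p and x :: 'a
    by (rule has_derivative_real_compose[OF _ poly_DERIV])
       (auto intro!: derivative_eq_intros simp: inner_commute)
  have p1: "pderivative b \<Phi> x = poly (pderiv P) (x \<bullet> x) * (2 * (x \<bullet> b))" if "norm x < R" for x b
    using pderivative_local[of "ball 0 R" x \<Phi> "\<lambda>x. poly P (x \<bullet> x)" b] eq that pderivative_eq[OF d1]
    by simp
  have p2: "pderivative b (pderivative b \<Phi>) x =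
      4 * poly (pderiv (pderiv P)) (x \<bullet> x) * ((x \<bullet> b) * (x \<bullet> b)) + 2 * poly (pderiv P) (x \<bullet> x)"
    if "norm x < R" "b \<in> Basis" for x b
  proof -
    have "((\<lambda>x. poly (pderiv P) (x \<bullet> x) * (2 * (x \<bullet> b))) has_derivative
        (\<lambda>h. poly (pderiv P) (x \<bullet> x) * (2 * (h \<bullet> b)) +
          poly (pderiv (pderiv P)) (x \<bullet> x) * (2 * (x \<bullet> h)) * (2 * (x \<bullet> b)))) (at x)"
      by (rule has_derivative_mult[OF d1]) (auto intro!: derivative_eq_intros)
    from pderivative_eq[OF this, of b]
    have "pderivative b (\<lambda>x. poly (pderiv P) (x \<bullet> x) * (2 * (x \<bullet> b))) x =
      4 * poly (pderiv (pderiv P)) (x \<bullet> x) * ((x \<bullet> b) * (x \<bullet> b)) + 2 * poly (pderiv P) (x \<bullet> x)"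
      using that(2) by (simp add: inner_Basis algebra_simps)
    then show ?thesis
      using pderivative_local[of "ball 0 R" x "pderivative b \<Phi>" "\<lambda>x. poly (pderiv P) (x \<bullet> x) * (2 * (x \<bullet> b))" b] p1 that(1)
      by simp
  qed
  have lap: "laplacian \<Phi> x = poly (radial_laplacian DIM('a) P) (x \<bullet> x)" if "norm x < R" for x
  proof -
    have "laplacian \<Phi> x = (\<Sum>b\<in>Basis. 4 * poly (pderiv (pderiv P)) (x \<bullet> x) * ((x \<bullet> b) * (x \<bullet> b)) + 2 * poly (pderiv P) (x \<bullet> x))"
      unfolding laplacian_def by (intro sum.cong refl p2 that)
    also have "\<dots> = 4 * poly (pderiv (pderiv P)) (x \<bullet> x) * (x \<bullet> x) + real DIM('a) * (2 * poly (pderiv P) (x \<bullet> x))"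
      by (simp add: sum.distrib sum_distrib_left[symmetric] euclidean_inner[of x x, symmetric])
    also have "\<dots> = poly (radial_laplacian DIM('a) P) (x \<bullet> x)"
      by (simp add: radial_laplacian_def poly_monom)
    finally show ?thesis .
  qed
  show thesis by (rule that[OF sm z eq lap])
qed

lemma pderivative_outside:
  assumes z: "\<And>x. R \<le> norm x \<Longrightarrow> \<Phi> x = (0::real)" and x: "R < norm x"
  shows "pderivative b \<Phi> x = 0"
proof -
  have "open {x::'a. R < norm x}" by (intro open_Collect_less continuous_intros)
  then have "pderivative b \<Phi> x = pderivative b (\<lambda>_. 0) x"
    using assms by (intro pderivative_local[of "{x. R < norm x}"]) auto
  then show ?thesis using pderivative_eq[OF has_derivative_const[of 0]] by metis
qed

lemma laplacian_outside:
  assumes z: "\<And>x. R \<le> norm x \<Longrightarrow> \<Phi> x = (0::real)" and x: "R + 1 \<le> norm x"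
  shows "laplacian \<Phi> x = 0"
proof -
  \<comment> \<open>Locality of derivatives needs an open set, so each of the two differentiations
    is given half a unit of room.\<close>
  have "pderivative b (pderivative b \<Phi>) x = 0" for b
  proof (rule pderivative_outside[of "R + 1 / 2"])
    show "pderivative b \<Phi> y = 0" if "R + 1 / 2 \<le> norm y" for y
      by (rule pderivative_outside[of R]) (use z that in auto)
  qed (use x in auto)
  then show ?thesis by (simp add: laplacian_def)
qed

text \<open>Test functions live on all of space-time, so compact support also requires \<psi> to
  vanish for t \<le> -M; this is why the cutoffs are controlled for both signs of t.\<close>

lemma product_test_function:
  fixes \<Phi> :: "'a::euclidean_space \<Rightarrow> real"
  assumes \<psi>: "smooth \<psi>" "\<And>t. (\<psi> has_real_derivative \<psi>1 t) (at t)" "\<And>t. M \<le> \<bar>t\<bar> \<Longrightarrow> \<psi> t = 0"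
    and M: "ereal M < T"
    and \<Phi>: "smooth \<Phi>" "\<And>x. R \<le> norm x \<Longrightarrow> \<Phi> x = 0"
  shows "test_function {(t, x). ereal t < T} (\<lambda>(t, x). \<psi> t * \<Phi> x)"
    and "time_derivative (\<lambda>(t, x). \<psi> t * \<Phi> x) (t, x) = \<psi>1 t * \<Phi> x"
    and "space_gradient (\<lambda>(t, x). \<psi> t * \<Phi> x) (t, x) = \<psi> t *\<^sub>R gradient \<Phi> x"
proof -
  let ?\<Psi> = "\<lambda>(t, x). \<psi> t * \<Phi> x"
  have e: "?\<Psi> = (\<lambda>z. \<psi> (fst z) * \<Phi> (snd z))" by (auto simp: fun_eq_iff)
  show "test_function {(t, x). ereal t < T} ?\<Psi>"
  proof (rule test_function_bounded)
    show "smooth ?\<Psi>"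
      unfolding e using \<psi>(1) \<Phi>(1) by (simp add: smooth_def C_k_mult C_k_fst C_k_snd)
    show "z \<notin> {-M..M} \<times> cball 0 R \<Longrightarrow> ?\<Psi> z = 0" for z
      using \<psi>(3)[of "fst z"] \<Phi>(2)[of "snd z"] by (cases z) (auto simp: abs_if)
    show "compact ({-M..M} \<times> cball (0::'a) R)" by (intro compact_Times) auto
    show "{-M..M} \<times> cball (0::'a) R \<subseteq> {(t, x). ereal t < T}"
      using M by (auto intro: le_less_trans[of _ "ereal M"])
  qed
  have "((\<lambda>z. \<psi> (fst z) * \<Phi> (snd z)) has_derivative
      (\<lambda>h. \<psi> (fst z) * frechet_derivative \<Phi> (at (snd z)) (snd h) + \<psi>1 (fst z) * fst h * \<Phi> (snd z))) (at z)" for z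
  proof (rule has_derivative_mult)
    show "((\<lambda>z. \<psi> (fst z)) has_derivative (\<lambda>h. \<psi>1 (fst z) * fst h)) (at z)"
      by (rule has_derivative_real_compose[OF has_derivative_fst[OF has_derivative_ident] \<psi>(2)])
    show "((\<lambda>z. \<Phi> (snd z)) has_derivative (\<lambda>h. frechet_derivative \<Phi> (at (snd z)) (snd h))) (at z)"
      by (rule has_derivative_compose[OF has_derivative_snd[OF has_derivative_ident] smooth_has_derivative[OF \<Phi>(1)]])
  qed
  note d = pderivative_eq[OF this]
  have lin: "frechet_derivative \<Phi> (at x) 0 = 0" for x
    using smooth_has_derivative[OF \<Phi>(1)] by (metis linear_0 has_derivative_linear)
  show "time_derivative ?\<Psi> (t, x) = \<psi>1 t * \<Phi> x"
    unfolding time_derivative_def e d by (simp add: lin)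
  show "space_gradient ?\<Psi> (t, x) = \<psi> t *\<^sub>R gradient \<Phi> x"
    unfolding space_gradient_def e d
    by (simp add: gradient_def pderivative_def scaleR_sum_right)
qed

subsection \<open>The weak form with a separated test function\<close>

lemma continuous_compact_support_L2:
  fixes h :: "'a::euclidean_space \<Rightarrow> real"
  assumes c: "continuous_on UNIV h" and z: "\<And>x. R < norm x \<Longrightarrow> h x = 0"
  shows "h \<in> L2" "h \<in> borel_measurable borel"
proof -
  show m: "h \<in> borel_measurable borel" by (rule borel_measurable_continuous_onI[OF c])
  have "integrable lborel (\<lambda>x. indicator (cball 0 R) x *\<^sub>R (h x)\<^sup>2)"
    by (intro borel_integrable_compact continuous_intros continuous_on_subset[OF c]) auto
  moreover have "(\<lambda>x. indicator (cball 0 R) x *\<^sub>R (h x)\<^sup>2) = (\<lambda>x. (norm (h x))\<^sup>2)"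
    using z by (auto simp: fun_eq_iff indicator_def not_le[symmetric])
  ultimately show "h \<in> L2"
    using m by (simp add: L2_def integrable_completion measurable_completion)
qed

lemma damping_continuous: "continuous_on UNIV (damping \<mu> \<beta> :: 'a::euclidean_space \<Rightarrow> real)"
  unfolding damping_def[abs_def]
  by (intro continuous_intros) (auto simp: add_nonneg_eq_0_iff)

lemma damping_bounds:
  assumes "\<mu> > 0" "\<beta> > 2"
  shows "0 < damping \<mu> \<beta> x" "damping \<mu> \<beta> x \<le> \<mu>"
proof -
  have "1 powr \<beta> \<le> (1 + norm x) powr \<beta>" using assms by (intro powr_mono2) auto
  then have "1 \<le> (1 + norm x) powr \<beta>" by simp
  moreover from this have "0 < (1 + norm x) powr \<beta>" by linarith
  ultimately show "0 < damping \<mu> \<beta> x" "damping \<mu> \<beta> x \<le> \<mu>"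
    using assms unfolding damping_def by (simp_all add: divide_le_eq mult_le_cancel_left1)
qed

text \<open>The definition of the weak gradient, applied in each direction b to the test function
  \<open>pderivative b \<Phi>\<close> and summed.\<close>

lemma weak_gradient_laplacian:
  fixes w :: "'a::euclidean_space \<Rightarrow> real"
  assumes w: "w \<in> L2" and G: "G \<in> L2" "has_weak_gradient w G"
    and \<Phi>: "smooth \<Phi>" "\<And>x. R \<le> norm x \<Longrightarrow> \<Phi> x = 0"
  shows "(LINT x|lebesgue. G x \<bullet> gradient \<Phi> x) = - (LINT x|lebesgue. w x * laplacian \<Phi> x)"
proof -
  have d: "smooth (pderivative b \<Phi>)" if "b \<in> Basis" for b
    by (rule smooth_pderivative[OF \<Phi>(1) that])
  have z: "pderivative b \<Phi> x = 0" if "R < norm x" for b x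
    by (rule pderivative_outside[OF \<Phi>(2) that])
  have zz: "pderivative b (pderivative b \<Phi>) x = 0" if "R + 1 < norm x" for b x
    by (rule pderivative_outside[of "R + 1"]) (use z that in auto)
  have L: "pderivative b \<Phi> \<in> L2" if "b \<in> Basis" for b
    by (rule continuous_compact_support_L2[OF smooth_continuous[OF d[OF that]] z])
  have LL: "pderivative b (pderivative b \<Phi>) \<in> L2" if "b \<in> Basis" for b
    by (rule continuous_compact_support_L2[OF smooth_continuous[OF smooth_pderivative[OF d[OF that] that]] zz])
  have Gb: "(\<lambda>x. G x \<bullet> b) \<in> L2" if "b \<in> Basis" for b
  proof -
    have m: "G \<in> borel_measurable lebesgue" using G by (simp add: L2_def)
    have "integrable lebesgue (\<lambda>x. (norm (G x \<bullet> b))\<^sup>2)"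
    proof (rule Bochner_Integration.integrable_bound[OF L2_integrable[OF G(1)]])
      show "(\<lambda>x. (norm (G x \<bullet> b))\<^sup>2) \<in> borel_measurable lebesgue" using m by measurable
      show "AE x in lebesgue. norm ((norm (G x \<bullet> b))\<^sup>2) \<le> norm ((norm (G x))\<^sup>2)"
        using Basis_le_norm[OF that] by (intro AE_I2) (simp add: abs_le_square_iff[symmetric])
    qed
    then show ?thesis using m by (auto simp: L2_def)
  qed
  have tf: "test_function UNIV (pderivative b \<Phi>)" if "b \<in> Basis" for b
    by (rule test_function_bounded[OF d[OF that], of "cball 0 R"]) (use z in auto)
  have "(LINT x|lebesgue. G x \<bullet> gradient \<Phi> x) = (LINT x|lebesgue. (\<Sum>b\<in>Basis. (G x \<bullet> b) * pderivative b \<Phi> x))"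
    by (simp add: gradient_def inner_sum_right mult.commute)
  also have "\<dots> = (\<Sum>b\<in>Basis. LINT x|lebesgue. (G x \<bullet> b) * pderivative b \<Phi> x)"
    by (intro Bochner_Integration.integral_sum L2_mult_integrable Gb L)
  also have "\<dots> = (\<Sum>b\<in>Basis. - (LINT x|lebesgue. w x * pderivative b (pderivative b \<Phi>) x))"
    using G(2) tf by (intro sum.cong refl) (simp add: has_weak_gradient_def)
  also have "\<dots> = - (LINT x|lebesgue. (\<Sum>b\<in>Basis. w x * pderivative b (pderivative b \<Phi>) x))"
    by (simp add: sum_negf) (intro Bochner_Integration.integral_sum[symmetric] L2_mult_integrable w LL)
  finally show ?thesis
    by (simp add: laplacian_def sum_distrib_left)
qed

text \<open>Where $\Delta\Phi = (1 + a)\Phi$, the bracket on the right-hand side of the last identity is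
  $e^{-t} (\eta'' - (2 + a)\eta')\Phi$.\<close>

lemma weak_identity:
  fixes u v :: "real \<Rightarrow> 'a::euclidean_space \<Rightarrow> real" and T :: ereal and \<eta> \<eta>1 \<eta>2 :: "real \<Rightarrow> real"
  defines "Q \<equiv> time_interval T \<times> (UNIV :: 'a set)"
  defines "K \<equiv> (\<lambda>t. exp (- t) * \<eta> t)" and "K1 \<equiv> (\<lambda>t. exp (- t) * (\<eta>1 t - \<eta> t))"
    and "K2 \<equiv> (\<lambda>t. exp (- t) * (\<eta>2 t - 2 * \<eta>1 t + \<eta> t))"
  assumes \<mu>: "\<mu> > 0" "\<beta> > 2"
    and uv: "C1_L2 (time_interval T) u v"
    and mu: "(\<lambda>(t, x). u t x) \<in> borel_measurable (lebesgue_on Q)"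
    and mv: "(\<lambda>(t, x). v t x) \<in> borel_measurable (lebesgue_on Q)"
    and G: "\<And>t. t \<in> time_interval T \<Longrightarrow> G t \<in> L2 \<and> has_weak_gradient (u t) (G t)"
    and u0: "AE x in lebesgue. u 0 x = \<epsilon> * f x" and f: "f \<in> L2"
    and weak: "weak_form \<mu> \<beta> p \<epsilon> f g T u v G"
    and M: "M \<in> time_interval T"
    and cut: "time_cutoff p M B \<eta> \<eta>1 \<eta>2"
    and \<Phi>: "smooth \<Phi>" "\<And>x. R \<le> norm x \<Longrightarrow> \<Phi> x = 0"
  shows "set_integrable lebesgue Q (\<lambda>(t, x). \<bar>v t x\<bar> powr p * (- K1 t * \<Phi> x))"
    and "set_integrable lebesgue Q (\<lambda>(t, x). v t x * (K2 t * \<Phi> x - K1 t * (damping \<mu> \<beta> x * \<Phi> x) - K t * laplacian \<Phi> x))"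
    and "\<epsilon> * (LINT x|lebesgue. g x * \<Phi> x)
       + set_lebesgue_integral lebesgue Q (\<lambda>(t, x). \<bar>v t x\<bar> powr p * (- K1 t * \<Phi> x))
     = set_lebesgue_integral lebesgue Q (\<lambda>(t, x). v t x * (K2 t * \<Phi> x - K1 t * (damping \<mu> \<beta> x * \<Phi> x) - K t * laplacian \<Phi> x))
       - \<epsilon> * (LINT x|lebesgue. f x * laplacian \<Phi> x)"
proof -
  let ?a = "damping \<mu> \<beta> :: 'a \<Rightarrow> real"
  have M0: "0 \<le> M" and MT: "ereal M < T" using M by (auto simp: time_interval_def)
  have I0: "0 \<in> time_interval T" by (rule time_interval_downward[OF M]) (use M0 in auto)
  have \<eta>: "smooth \<eta>" "\<And>t. (\<eta> has_real_derivative \<eta>1 t) (at t)" "\<And>t. (\<eta>1 has_real_derivative \<eta>2 t) (at t)"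
    "\<eta> 0 = 1" "\<eta>1 0 = 0" "\<And>t. M \<le> \<bar>t\<bar> \<Longrightarrow> \<eta> t = 0"
    and \<eta>B: "\<And>t. t \<ge> 0 \<Longrightarrow> \<bar>\<eta>1 t\<bar> + \<bar>\<eta>2 t\<bar> \<le> B t * \<eta> t powr (1 / p)"
    using cut by (auto simp: time_cutoff_def)
  have z12: "\<eta>1 t = 0 \<and> \<eta>2 t = 0" if "M \<le> t" for t
    using \<eta>B[of t] \<eta>(6)[of t] that M0 by auto
  have kz: "K t = 0" "K1 t = 0" "K2 t = 0" if "M \<le> t" for t
    using z12[OF that] \<eta>(6)[of t] that M0 by (auto simp: K_def K1_def K2_def)
  have dK: "(K has_real_derivative K1 t) (at t)" for t
    unfolding K_def K1_def by (auto intro!: derivative_eq_intros \<eta>(2) simp: algebra_simps)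
  have dK1: "(K1 has_real_derivative K2 t) (at t)" for t
    unfolding K1_def K2_def by (auto intro!: derivative_eq_intros \<eta>(2,3) simp: algebra_simps)
  have smK: "smooth K"
    unfolding K_def smooth_def
  proof (intro allI C_k_mult C_k_exp)
    show "C_k k \<eta>" for k using \<eta>(1) by (simp add: smooth_def)
    show "C_k k (\<lambda>t. - t)" for k by (intro C_k_linear bounded_linear_minus bounded_linear_ident)
  qed
  \<comment> \<open>1 is the basis vector of the real line, so smoothness of K1 and K2 is inherited
    from K.\<close>
  have K1p: "pderivative 1 K = K1"
    using pderivative_eq[OF dK[unfolded has_field_derivative_def]] by (auto simp: fun_eq_iff)
  have smK1: "smooth K1" using smooth_pderivative[OF smK, of 1] by (simp add: K1p)
  have K2p: "pderivative 1 K1 = K2"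
    using pderivative_eq[OF dK1[unfolded has_field_derivative_def]] by (auto simp: fun_eq_iff)
  have smK2: "smooth K2" using smooth_pderivative[OF smK1, of 1] by (simp add: K2p)
  note cK = smooth_continuous[OF smK] and cK1 = smooth_continuous[OF smK1] and cK2 = smooth_continuous[OF smK2]
  \<comment> \<open>The bound on \<eta>' in \<open>time_cutoff\<close> concerns t \<ge> 0. For t
    \<le> -M the derivative is read off from the left, where K vanishes identically even when t =
    -M.\<close>
  have z1: "K1 t = 0" if "M \<le> \<bar>t\<bar>" for t
  proof (cases "t \<ge> 0")
    case True then show ?thesis using kz that by simp
  next
    case False
    have "\<forall>\<^sub>F s in at_left t. K s = 0"
      using False that by (auto simp: eventually_at_left_field K_def \<eta>(6) intro!: exI[of _ "t - 1"])
    moreover have "K t = 0" using that by (simp add: K_def \<eta>(6))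
    ultimately have "((\<lambda>s. (K s - K t) / (s - t)) \<longlongrightarrow> 0) (at_left t)"
      by (intro tendsto_eventually) (auto elim: eventually_mono)
    moreover have "((\<lambda>s. (K s - K t) / (s - t)) \<longlongrightarrow> K1 t) (at_left t)"
      using has_field_derivative_at_within[OF dK[of t], of "{..<t}"] by (simp add: has_field_derivative_iff)
    ultimately show ?thesis using tendsto_unique[OF trivial_limit_at_left_real] by blast
  qed
  \<comment> \<open>At t = 0 the factor -K1 is \<eta>(0) - \<eta>'(0) = 1, so the data are tested
    against \<Phi> itself.\<close>
  define \<Psi> where "\<Psi> = (\<lambda>(t, x). - K1 t * \<Phi> x)"
  have smN: "smooth (\<lambda>t. - K1 t)"
    using smooth_mult[OF _ smK1, of "\<lambda>_. -1"] by (simp add: smooth_def C_k_const)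
  note pt = product_test_function[OF smN DERIV_minus[OF dK1] _ MT \<Phi>, folded \<Psi>_def, simplified z1, simplified]
  have tf: "test_function {(t, x). ereal t < T} \<Psi>"
    and td: "\<And>t x. time_derivative \<Psi> (t, x) = - K2 t * \<Phi> x"
    and sg: "\<And>t x. space_gradient \<Psi> (t, x) = - K1 t *\<^sub>R gradient \<Phi> x"
    using pt by auto
  have \<Psi>: "\<Psi> (t, x) = - K1 t * \<Phi> x" for t x by (simp add: \<Psi>_def)
  have \<Psi>0: "\<Psi> (0, x) = \<Phi> x" for x by (simp add: \<Psi>_def K1_def \<eta>(4,5))
  note W = weak[unfolded weak_form_def Let_def, rule_format, OF tf, folded Q_def]
  have W1: "set_integrable lebesgue Q (\<lambda>(t, x). \<bar>v t x\<bar> powr p * (- K1 t * \<Phi> x))" (is ?w1)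
    and W2: "set_integrable lebesgue Q (\<lambda>(t, x). G t x \<bullet> (- K1 t *\<^sub>R gradient \<Phi> x))" (is ?w2)
    and W3: "\<epsilon> * (LINT x|lebesgue. g x * \<Phi> x) + \<epsilon> * (LINT x|lebesgue. ?a x * f x * \<Phi> x)
          + set_lebesgue_integral lebesgue Q (\<lambda>(t, x). \<bar>v t x\<bar> powr p * (- K1 t * \<Phi> x))
        = - set_lebesgue_integral lebesgue Q (\<lambda>(t, x). v t x * (- K2 t * \<Phi> x))
          + set_lebesgue_integral lebesgue Q (\<lambda>(t, x). G t x \<bullet> (- K1 t *\<^sub>R gradient \<Phi> x))
          - set_lebesgue_integral lebesgue Q (\<lambda>(t, x). ?a x * u t x * (- K2 t * \<Phi> x))" (is ?w3)
  proof -
    note W' = W[unfolded td sg, unfolded \<Psi>0, unfolded \<Psi>, THEN conjunct2, THEN conjunct2]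
    note W'' = W'[THEN conjunct2, THEN conjunct2]
    show ?w1 by (rule W'[THEN conjunct1])
    show ?w2 by (rule W''[THEN conjunct1])
    show ?w3 by (rule W''[THEN conjunct2, THEN conjunct2])
  qed
  show "set_integrable lebesgue Q (\<lambda>(t, x). \<bar>v t x\<bar> powr p * (- K1 t * \<Phi> x))" by (rule W1)
  have u: "continuous_L2 (time_interval T) u" and v: "continuous_L2 (time_interval T) v"
    using uv by (auto simp: C1_L2_def)
  have b1: "\<Phi> \<in> L2" "\<Phi> \<in> borel_measurable borel"
    using continuous_compact_support_L2[OF smooth_continuous[OF \<Phi>(1)], of R] \<Phi>(2) by auto
  have b2: "(\<lambda>x. ?a x * \<Phi> x) \<in> L2" "(\<lambda>x. ?a x * \<Phi> x) \<in> borel_measurable borel"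
    using continuous_compact_support_L2[OF continuous_on_mult[OF damping_continuous smooth_continuous[OF \<Phi>(1)]], of R] \<Phi>(2)
    by auto
  have b3: "laplacian \<Phi> \<in> L2" "laplacian \<Phi> \<in> borel_measurable borel"
    using continuous_compact_support_L2[OF laplacian_continuous[OF \<Phi>(1)], of "R + 1"] laplacian_outside[of R \<Phi>, OF \<Phi>(2)]
    by auto
  let ?J = "\<lambda>w \<kappa> b. set_lebesgue_integral lebesgue Q (\<lambda>(t, x). w t x * (\<kappa> t * b x))"
  have i1: "set_integrable lebesgue Q (\<lambda>(t, x). v t x * (K2 t * \<Phi> x))"
    and i2: "set_integrable lebesgue Q (\<lambda>(t, x). v t x * (K1 t * (?a x * \<Phi> x)))"
    and i3: "set_integrable lebesgue Q (\<lambda>(t, x). v t x * (K t * laplacian \<Phi> x))"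
    unfolding Q_def using spacetime_integral(1)[OF v mv[unfolded Q_def] _ _ M] cK cK1 cK2 kz b1 b2 b3 by auto
  have sum: "(\<lambda>(t, x). v t x * (K2 t * \<Phi> x - K1 t * (?a x * \<Phi> x) - K t * laplacian \<Phi> x)) =
    (\<lambda>z. (case z of (t, x) \<Rightarrow> v t x * (K2 t * \<Phi> x)) - (case z of (t, x) \<Rightarrow> v t x * (K1 t * (?a x * \<Phi> x)))
      - (case z of (t, x) \<Rightarrow> v t x * (K t * laplacian \<Phi> x)))"
    by (auto simp: fun_eq_iff algebra_simps)
  show "set_integrable lebesgue Q (\<lambda>(t, x). v t x * (K2 t * \<Phi> x - K1 t * (?a x * \<Phi> x) - K t * laplacian \<Phi> x))"
    unfolding sum by (intro set_integral_diff i1 i2 i3)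
  have J: "set_lebesgue_integral lebesgue Q (\<lambda>(t, x). v t x * (K2 t * \<Phi> x - K1 t * (?a x * \<Phi> x) - K t * laplacian \<Phi> x))
    = ?J v K2 \<Phi> - ?J v K1 (\<lambda>x. ?a x * \<Phi> x) - ?J v K (laplacian \<Phi>)"
    unfolding sum
      set_integral_diff(2)[OF set_integral_diff(1)[OF i1 i2] i3] set_integral_diff(2)[OF i1 i2] ..
  have u0L: "(LINT x|lebesgue. u 0 x * b x) = \<epsilon> * (LINT x|lebesgue. f x * b x)"
    if "b \<in> L2" for b
  proof -
    have "(LINT x|lebesgue. u 0 x * b x) = (LINT x|lebesgue. \<epsilon> * (f x * b x))"
    proof (rule integral_cong_AE)
      show "(\<lambda>x. u 0 x * b x) \<in> borel_measurable lebesgue"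
        using L2_mult_integrable[OF continuous_L2_D(1)[OF u I0] that] by (rule borel_measurable_integrable)
      show "(\<lambda>x. \<epsilon> * (f x * b x)) \<in> borel_measurable lebesgue"
        using integrable_mult_right[OF L2_mult_integrable[OF f that], of \<epsilon>] by (rule borel_measurable_integrable)
    qed (use u0 in eventually_elim, simp)
    then show ?thesis by simp
  qed
  have ibp1: "?J u K1 (laplacian \<Phi>) = - (\<epsilon> * (LINT x|lebesgue. f x * laplacian \<Phi> x)) - ?J v K (laplacian \<Phi>)"
    unfolding Q_def
    using spacetime_by_parts[OF uv mu[unfolded Q_def] mv[unfolded Q_def] dK cK1 kz(1,2) M b3] u0L[OF b3(1)]
    by (simp add: K_def \<eta>(4))
  \<comment> \<open>The boundary term produced here cancels the datum with the damping coefficient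
    in the weak form; the one in \<open>ibp1\<close> remains as the integral of f times the
    Laplacian of \<Phi>.\<close>
  have ibp2: "?J u K2 (\<lambda>x. ?a x * \<Phi> x) = \<epsilon> * (LINT x|lebesgue. f x * (?a x * \<Phi> x)) - ?J v K1 (\<lambda>x. ?a x * \<Phi> x)"
    unfolding Q_def
    using spacetime_by_parts[OF uv mu[unfolded Q_def] mv[unfolded Q_def] dK1 cK2 kz(2,3) M b2] u0L[OF b2(1)]
    by (simp add: K1_def \<eta>(4,5))
  \<comment> \<open>Fubini rests on the integrability supplied by \<open>weak_form\<close>;
    integration by parts in x is then done slice by slice.\<close>
  have GT: "set_lebesgue_integral lebesgue Q (\<lambda>(t, x). G t x \<bullet> (- K1 t *\<^sub>R gradient \<Phi> x)) = ?J u K1 (laplacian \<Phi>)"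
  proof -
    define F where "F z = indicator Q z *\<^sub>R (case z of (t, x) \<Rightarrow> G t x \<bullet> (- K1 t *\<^sub>R gradient \<Phi> x))" for z
    have iF: "integrable lebesgue F" using W2 by (simp add: set_integrable_def F_def[abs_def])
    have sub: "{0..M} \<subseteq> time_interval T" using time_interval_downward[OF M] by auto
    have slice: "(LINT x|lebesgue. F (t, x)) = indicator {0..M} t *\<^sub>R (K1 t * (LINT x|lebesgue. u t x * laplacian \<Phi> x))" for t
    proof (cases "t \<in> {0..M}")
      case True
      then have t: "t \<in> time_interval T" using sub by auto
      have "(LINT x|lebesgue. F (t, x)) = (LINT x|lebesgue. - K1 t * (G t x \<bullet> gradient \<Phi> x))"
        using t by (simp add: F_def Q_def)
      also have "\<dots> = - K1 t * (LINT x|lebesgue. G t x \<bullet> gradient \<Phi> x)" by simp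
      also have "(LINT x|lebesgue. G t x \<bullet> gradient \<Phi> x) = - (LINT x|lebesgue. u t x * laplacian \<Phi> x)"
        using G[OF t] continuous_L2_D(1)[OF u t] by (intro weak_gradient_laplacian \<Phi>) auto
      finally show ?thesis using True by simp
    next
      case False
      then have "t \<notin> time_interval T \<or> K1 t = 0" using kz(2)[of t] by (auto simp: time_interval_def)
      then have "F (t, x) = 0" for x by (auto simp: F_def Q_def)
      then show ?thesis using False by simp
    qed
    have c: "continuous_on {0..M} (\<lambda>t. K1 t * (LINT x|lebesgue. u t x * laplacian \<Phi> x))"
      by (intro continuous_intros continuous_on_subset[OF continuous_L2_inner[OF u b3(1)] sub]
            continuous_on_subset[OF cK1]) auto
    have m: "(\<lambda>t. indicator {0..M} t *\<^sub>R (K1 t * (LINT x|lebesgue. u t x * laplacian \<Phi> x))) \<in> borel_measurable lborel"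
      by (rule borel_measurable_integrable[OF borel_integrable_compact[OF _ c]]) auto
    have "set_lebesgue_integral lebesgue Q (\<lambda>(t, x). G t x \<bullet> (- K1 t *\<^sub>R gradient \<Phi> x)) = integral\<^sup>L lebesgue F"
      by (simp add: set_lebesgue_integral_def F_def[abs_def])
    also have "\<dots> = (LINT t|lebesgue. indicator {0..M} t *\<^sub>R (K1 t * (LINT x|lebesgue. u t x * laplacian \<Phi> x)))"
      using integrable_lebesgue_pair(2)[OF iF] by (simp add: slice)
    also have "\<dots> = (LINT t|lborel. indicator {0..M} t *\<^sub>R (K1 t * (LINT x|lebesgue. u t x * laplacian \<Phi> x)))"
      by (rule integral_completion[OF m])
    also have "\<dots> = ?J u K1 (laplacian \<Phi>)"
      unfolding Q_def using spacetime_integral(2)[OF u mu[unfolded Q_def] cK1 kz(2) M b3] by simp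
    finally show ?thesis .
  qed
  have n1: "set_lebesgue_integral lebesgue Q (\<lambda>(t, x). v t x * (- K2 t * \<Phi> x)) = - ?J v K2 \<Phi>"
    unfolding set_integral_uminus[OF i1, symmetric]
    by (rule arg_cong[where f = "set_lebesgue_integral lebesgue Q"]) (auto simp: fun_eq_iff)
  have n2: "set_lebesgue_integral lebesgue Q (\<lambda>(t, x). ?a x * u t x * (- K2 t * \<Phi> x)) = - ?J u K2 (\<lambda>x. ?a x * \<Phi> x)"
  proof -
    have "set_integrable lebesgue Q (\<lambda>(t, x). u t x * (K2 t * (?a x * \<Phi> x)))"
      unfolding Q_def using spacetime_integral(1)[OF u mu[unfolded Q_def] cK2 kz(3) M b2] by simp
    from set_integral_uminus[OF this, symmetric] show ?thesis
      by (simp add: case_prod_unfold mult_ac)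
  qed
  have n3: "(LINT x|lebesgue. ?a x * f x * \<Phi> x) = (LINT x|lebesgue. f x * (?a x * \<Phi> x))"
    by (simp add: mult_ac)
  show "\<epsilon> * (LINT x|lebesgue. g x * \<Phi> x)
       + set_lebesgue_integral lebesgue Q (\<lambda>(t, x). \<bar>v t x\<bar> powr p * (- K1 t * \<Phi> x))
     = set_lebesgue_integral lebesgue Q (\<lambda>(t, x). v t x * (K2 t * \<Phi> x - K1 t * (?a x * \<Phi> x) - K t * laplacian \<Phi> x))
       - \<epsilon> * (LINT x|lebesgue. f x * laplacian \<Phi> x)"
    using W3 unfolding J GT ibp1 n1 n2 ibp2 n3 by linarith
qed

subsection \<open>The lifespan estimate\<close>

lemma indicator_cball_L2:
  "(indicator (cball 0 r) :: 'a::euclidean_space \<Rightarrow> real) \<in> L2"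
  "(indicator (cball 0 r) :: 'a::euclidean_space \<Rightarrow> real) \<in> borel_measurable borel"
proof -
  show m: "(indicator (cball 0 r) :: 'a::euclidean_space \<Rightarrow> real) \<in> borel_measurable borel"
    by (intro borel_measurable_indicator) auto
  have "integrable lborel (\<lambda>x::'a. indicator (cball 0 r) x *\<^sub>R (1::real))"
    by (rule borel_integrable_compact) auto
  moreover have "(\<lambda>x::'a. (norm (indicator (cball 0 r) x :: real))\<^sup>2) = (\<lambda>x. indicator (cball 0 r) x *\<^sub>R (1::real))"
    by (auto simp: indicator_def)
  ultimately show "(indicator (cball 0 r) :: 'a::euclidean_space \<Rightarrow> real) \<in> L2"
    using m unfolding L2_def by (auto simp: integrable_completion measurable_completion simp del: integrable_indicator_iff)
qed

text \<open>If the Laplacian is (1 + a) \<phi> + r, the undifferentiated h cancels and h2 - (2 + a)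
  h1 remains, whence the factor 2 + \<mu>. Young's inequality pairs |V| h^{1/p} with (2 + \<mu>) B;
  r contributes only the \<delta> term.\<close>

lemma pointwise_young:
  fixes V e h h1 h2 a \<mu> B \<phi> r \<delta> p q :: real
  assumes p: "p > 1" and q: "q = p / (p - 1)" and e: "e > 0" and h: "0 \<le> h" "h1 \<le> 0"
    and hB: "\<bar>h1\<bar> + \<bar>h2\<bar> \<le> B * h powr (1 / p)" and a: "0 \<le> a" "a \<le> \<mu>"
    and \<phi>: "0 \<le> \<phi>" and r: "\<bar>r\<bar> \<le> \<delta>" and B: "0 \<le> B"
  shows "V * (e * (h2 - 2 * h1 + h) * \<phi> - e * (h1 - h) * (a * \<phi>) - e * h * ((1 + a) * \<phi> + r))
    \<le> 1 / p * (\<bar>V\<bar> powr p * (- (e * (h1 - h)) * \<phi>)) + ((2 + \<mu>) * B) powr q / q * (e * \<phi>) + \<delta> * \<bar>V * (e * h)\<bar>"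
proof -
  have q1: "q > 1" "1 / p + 1 / q = 1" using p by (auto simp: q field_simps)
  have "V * (e * (h2 - 2 * h1 + h) * \<phi> - e * (h1 - h) * (a * \<phi>) - e * h * ((1 + a) * \<phi> + r))
    = V * (h2 - 2 * h1 - a * h1) * (e * \<phi>) - V * (e * h) * r"
    by (simp add: algebra_simps)
  also have "\<dots> \<le> \<bar>V\<bar> * ((2 + \<mu>) * (B * h powr (1 / p))) * (e * \<phi>) + \<bar>V * (e * h)\<bar> * \<delta>"
  proof -
    have "\<bar>h2 - 2 * h1 - a * h1\<bar> \<le> (2 + \<mu>) * (\<bar>h1\<bar> + \<bar>h2\<bar>)"
    proof -
      have "\<bar>a * h1\<bar> \<le> \<mu> * \<bar>h1\<bar>" using a by (simp add: abs_mult mult_right_mono)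
      moreover have "0 \<le> \<mu> * \<bar>h2\<bar>" using a by simp
      ultimately show ?thesis unfolding distrib_left distrib_right using h by linarith
    qed
    also have "\<dots> \<le> (2 + \<mu>) * (B * h powr (1 / p))"
      using a hB by (intro mult_left_mono) auto
    finally have "\<bar>V\<bar> * \<bar>h2 - 2 * h1 - a * h1\<bar> \<le> \<bar>V\<bar> * ((2 + \<mu>) * (B * h powr (1 / p)))"
      by (intro mult_left_mono) auto
    then have "V * (h2 - 2 * h1 - a * h1) \<le> \<bar>V\<bar> * ((2 + \<mu>) * (B * h powr (1 / p)))"
      unfolding abs_mult[symmetric] by linarith
    then have "V * (h2 - 2 * h1 - a * h1) * (e * \<phi>) \<le> \<bar>V\<bar> * ((2 + \<mu>) * (B * h powr (1 / p))) * (e * \<phi>)"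
      using e \<phi> by (intro mult_right_mono) auto
    moreover have "- (V * (e * h) * r) \<le> \<bar>V * (e * h)\<bar> * \<delta>"
    proof -
      have "- (V * (e * h) * r) \<le> \<bar>V * (e * h)\<bar> * \<bar>r\<bar>" unfolding abs_mult[symmetric] by linarith
      also have "\<dots> \<le> \<bar>V * (e * h)\<bar> * \<delta>" using r by (intro mult_left_mono) auto
      finally show ?thesis .
    qed
    ultimately show ?thesis by linarith
  qed
  also have "\<bar>V\<bar> * ((2 + \<mu>) * (B * h powr (1 / p))) = (\<bar>V\<bar> * h powr (1 / p)) * ((2 + \<mu>) * B)"
    by (simp add: mult_ac)
  also have "\<dots> * (e * \<phi>) \<le> (1 / p * (\<bar>V\<bar> powr p * (h - h1)) + ((2 + \<mu>) * B) powr q / q) * (e * \<phi>)"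
  proof (intro mult_right_mono)
    have "(\<bar>V\<bar> * h powr (1 / p)) * ((2 + \<mu>) * B) \<le>
      (\<bar>V\<bar> * h powr (1 / p)) powr p / p + ((2 + \<mu>) * B) powr q / q"
      using p q1 a B by (intro Youngs_inequality) auto
    also have "(\<bar>V\<bar> * h powr (1 / p)) powr p = \<bar>V\<bar> powr p * h"
      using p h by (simp add: powr_mult powr_powr)
    \<comment> \<open>h \<le> h - h1 turns the Young term into 1/p of the integrand that the
      nonlinearity contributes.\<close>
    also have "\<bar>V\<bar> powr p * h / p \<le> 1 / p * (\<bar>V\<bar> powr p * (h - h1))"
      using p h by (simp add: divide_right_mono mult_left_mono)
    finally show "(\<bar>V\<bar> * h powr (1 / p)) * ((2 + \<mu>) * B) \<le>
      1 / p * (\<bar>V\<bar> powr p * (h - h1)) + ((2 + \<mu>) * B) powr q / q" by simp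
  qed (use e \<phi> in auto)
  finally show ?thesis
    by (simp add: algebra_simps)
qed

text \<open>The weight e^{-t} cancels the growth e^{t+1} from \<open>ball_growth\<close>, so the
  cone costs only (1+t)^m. B stays arbitrary so that both cutoffs can be inserted.\<close>

lemma cone_majorant:
  assumes m: "m = (real DIM('a::euclidean_space) - 1) / 2"
  shows "\<exists>C>0. \<forall>M B q X. B \<in> borel_measurable borel \<longrightarrow> 0 \<le> X \<longrightarrow>
    (\<integral>\<^sup>+t. indicator {0..M} t * ennreal (B t powr q * (1 + t) powr m) \<partial>lborel) \<le> ennreal X \<longrightarrow>
    integrable lebesgue (\<lambda>z::real \<times> 'a. indicator {z. 0 \<le> fst z \<and> fst z \<le> M \<and> norm (snd z) \<le> fst z + 1} z *
      (B (fst z) powr q * exp (- fst z) * (exp (norm (snd z)) * (1 + norm (snd z)) powr (- m)))) \<and>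
    (LINT z::real \<times> 'a|lebesgue. indicator {z. 0 \<le> fst z \<and> fst z \<le> M \<and> norm (snd z) \<le> fst z + 1} z *
      (B (fst z) powr q * exp (- fst z) * (exp (norm (snd z)) * (1 + norm (snd z)) powr (- m)))) \<le> C * X"
proof -
  obtain D where D: "D > 0" and growth: "\<And>\<rho>. \<rho> \<ge> 0 \<Longrightarrow>
      (\<integral>\<^sup>+x. indicator (cball (0::'a) \<rho>) x * ennreal (exp (norm x) * (1 + norm x) powr (- m)) \<partial>lborel)
      \<le> ennreal (D * (1 + \<rho>) powr m * exp \<rho>)"
    using ball_growth[OF m] by blast
  have "0 \<le> (real N - 1) / 2" if "0 < N" for N using that by simp
  from this[OF DIM_positive[where 'a = 'a]] have m0: "m \<ge> 0" unfolding m .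
  \<comment> \<open>The ball at time t has radius t + 1: 2 + t \<le> 2(1 + t) gives the power of 2,
    and e^{t+1} gives the factor e.\<close>
  define C where "C = D * 2 powr m * exp 1"
  have C: "C > 0" using D by (simp add: C_def)
  show ?thesis
  proof (intro exI[of _ C] conjI[OF C] allI impI)
    fix M q X :: real and B :: "real \<Rightarrow> real"
    assume B[measurable]: "B \<in> borel_measurable borel" and X: "0 \<le> X"
      and le: "(\<integral>\<^sup>+t. indicator {0..M} t * ennreal (B t powr q * (1 + t) powr m) \<partial>lborel) \<le> ennreal X"
    let ?A = "{z::real \<times> 'a. 0 \<le> fst z \<and> fst z \<le> M \<and> norm (snd z) \<le> fst z + 1}"
    let ?e = "\<lambda>x::'a. exp (norm x) * (1 + norm x) powr (- m)"
    define Z where "Z z = indicator ?A z * (B (fst z) powr q * exp (- fst z) * ?e (snd z))" for z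
    have mZ: "Z \<in> borel_measurable (lborel \<Otimes>\<^sub>M lborel)"
    proof -
      have "closed ?A"
        by (intro closed_Collect_conj closed_Collect_le continuous_intros)
      then have "(indicator ?A :: _ \<Rightarrow> real) \<in> borel_measurable (borel :: (real \<times> 'a) measure)"
        by (intro borel_measurable_indicator) auto
      moreover have "(\<lambda>z::real \<times> 'a. B (fst z) powr q * exp (- fst z) * ?e (snd z)) \<in> borel_measurable (borel \<Otimes>\<^sub>M borel)"
        by measurable
      ultimately show ?thesis
        unfolding Z_def[abs_def] by (simp add: lborel_prod borel_prod borel_measurable_times)
    qed
    have Zn: "Z z \<ge> 0" for z by (simp add: Z_def)
    have "(\<integral>\<^sup>+z. ennreal (Z z) \<partial>lborel) = (\<integral>\<^sup>+t. \<integral>\<^sup>+x. ennreal (Z (t, x)) \<partial>lborel \<partial>lborel)"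
      using lborel.nn_integral_fst[of "\<lambda>z. ennreal (Z z)" lborel] mZ by (simp add: lborel_prod)
    also have "\<dots> \<le> (\<integral>\<^sup>+t. ennreal C * (indicator {0..M} t * ennreal (B t powr q * (1 + t) powr m)) \<partial>lborel)"
    proof (intro nn_integral_mono)
      fix t :: real
      show "(\<integral>\<^sup>+x. ennreal (Z (t, x)) \<partial>lborel) \<le> ennreal C * (indicator {0..M} t * ennreal (B t powr q * (1 + t) powr m))"
      proof (cases "t \<in> {0..M}")
        case True
        have "(\<integral>\<^sup>+x. ennreal (Z (t, x)) \<partial>lborel) =
          (\<integral>\<^sup>+x. ennreal (B t powr q * exp (- t)) * (indicator (cball (0::'a) (t + 1)) x * ennreal (?e x)) \<partial>lborel)"
          using True by (intro nn_integral_cong) (auto simp: Z_def indicator_def ennreal_mult)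
        also have "\<dots> = ennreal (B t powr q * exp (- t)) * (\<integral>\<^sup>+x. indicator (cball (0::'a) (t + 1)) x * ennreal (?e x) \<partial>lborel)"
        proof (rule nn_integral_cmult)
          have "(indicator (cball (0::'a) (t + 1)) :: 'a \<Rightarrow> ennreal) \<in> borel_measurable borel"
            by (intro borel_measurable_indicator) auto
          moreover have "(\<lambda>x. ennreal (?e x)) \<in> borel_measurable borel" by measurable
          ultimately show "(\<lambda>x. indicator (cball (0::'a) (t + 1)) x * ennreal (?e x)) \<in> borel_measurable lborel"
            by (simp add: borel_measurable_times)
        qed
        also have "\<dots> \<le> ennreal (B t powr q * exp (- t)) * ennreal (D * (1 + (t + 1)) powr m * exp (t + 1))"
          using True by (intro mult_left_mono growth) auto
        also have "\<dots> \<le> ennreal (B t powr q * exp (- t)) * ennreal (D * (2 powr m * (1 + t) powr m) * exp (t + 1))"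
        proof (intro mult_left_mono ennreal_leI mult_right_mono)
          have "(1 + (t + 1)) powr m \<le> (2 * (1 + t)) powr m"
            using True m0 by (intro powr_mono2) auto
          also have "\<dots> = 2 powr m * (1 + t) powr m" by (rule powr_mult)
          finally show "(1 + (t + 1)) powr m \<le> 2 powr m * (1 + t) powr m" .
        qed (use D in auto)
        also have "\<dots> = ennreal (B t powr q * exp (- t) * (D * (2 powr m * (1 + t) powr m) * exp (t + 1)))"
          using D by (simp add: ennreal_mult)
        also have "B t powr q * exp (- t) * (D * (2 powr m * (1 + t) powr m) * exp (t + 1)) =
          C * (B t powr q * (1 + t) powr m)"
        proof -
          have "exp (- t) * exp (t + 1) = exp 1" by (simp add: mult_exp_exp)
          then have "C = D * 2 powr m * (exp (- t) * exp (t + 1))" by (simp add: C_def)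
          then show ?thesis by (simp only: mult_ac)
        qed
        also have "ennreal (C * (B t powr q * (1 + t) powr m)) = ennreal C * ennreal (B t powr q * (1 + t) powr m)"
          using C by (simp add: ennreal_mult)
        finally show ?thesis using True by simp
      qed (auto simp: Z_def)
    qed
    also have "\<dots> = ennreal C * (\<integral>\<^sup>+t. indicator {0..M} t * ennreal (B t powr q * (1 + t) powr m) \<partial>lborel)"
      by (rule nn_integral_cmult) measurable
    also have "\<dots> \<le> ennreal C * ennreal X" by (intro mult_left_mono le) auto
    also have "\<dots> = ennreal (C * X)" using C X by (simp add: ennreal_mult)
    finally have nn: "(\<integral>\<^sup>+z. ennreal (Z z) \<partial>lborel) \<le> ennreal (C * X)" .
    have mZ': "Z \<in> borel_measurable lborel" using mZ by (simp only: lborel_prod)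
    have i: "integrable lborel Z"
      using nn Zn by (intro integrableI_nonneg[OF mZ']) (auto simp: top_unique less_top intro: le_less_trans)
    have "ennreal (integral\<^sup>L lborel Z) \<le> ennreal (C * X)"
      using nn nn_integral_eq_integral[OF i] Zn by simp
    then have "integral\<^sup>L lborel Z \<le> C * X"
      using C X by (simp add: ennreal_le_iff)
    then have "integrable lebesgue Z \<and> integral\<^sup>L lebesgue Z \<le> C * X"
      using i mZ' by (simp add: integrable_completion integral_completion)
    then show "integrable lebesgue (\<lambda>z. indicator ?A z * (B (fst z) powr q * exp (- fst z) * ?e (snd z))) \<and>
      (LINT z|lebesgue. indicator ?A z * (B (fst z) powr q * exp (- fst z) * ?e (snd z))) \<le> C * X"
      unfolding Z_def[abs_def] .
  qed
qed


text \<open>C precedes the quantifiers over \<epsilon>, T, u and the cutoff, so the cutoff may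
  afterwards be adapted to M. All dependence on the cutoff is collected in X.\<close>

lemma energy_estimate:
  fixes f g :: "'a::euclidean_space \<Rightarrow> real" and \<mu> \<beta> p m q :: real
  assumes \<mu>: "\<mu> > 0" and \<beta>: "\<beta> > 2" and p: "p > 1"
    and m: "m = (real DIM('a) - 1) / 2" and q: "q = p / (p - 1)"
    and f: "f \<in> L2" and g: "g \<in> L2"
    and f0: "AE x in lebesgue. 0 \<le> f x" and g0: "AE x in lebesgue. 0 \<le> g x"
    and f1: "AE x in lebesgue. 1 < norm x \<longrightarrow> f x = 0" and g1: "AE x in lebesgue. 1 < norm x \<longrightarrow> g x = 0"
  shows "\<exists>C>0. \<forall>\<epsilon> T u M B \<eta> \<eta>1 \<eta>2 X. 0 < \<epsilon> \<longrightarrow> energy_solution \<mu> \<beta> p \<epsilon> f g T u \<longrightarrow>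
     ess_support_on (time_interval T \<times> UNIV) (\<lambda>(t, x). u t x)
       \<subseteq> {(t, x). t \<in> time_interval T \<and> norm x \<le> t + 1} \<longrightarrow>
     M \<in> time_interval T \<longrightarrow> time_cutoff p M B \<eta> \<eta>1 \<eta>2 \<longrightarrow>
     B \<in> borel_measurable borel \<longrightarrow> (\<forall>t\<ge>0. 0 \<le> B t) \<longrightarrow> 0 \<le> X \<longrightarrow>
     (\<integral>\<^sup>+t. indicator {0..M} t * ennreal (B t powr q * (1 + t) powr m) \<partial>lborel) \<le> ennreal X \<longrightarrow>
     \<epsilon> * (LINT x|lebesgue. g x) \<le> C * X"
proof -
  have n: "DIM('a) \<ge> 1" using DIM_positive[where 'a = 'a] by (simp add: Suc_le_eq)
  have q1: "q > 1" using p by (simp add: q)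
  define k where "k = (m\<^sup>2 + \<mu> + 1) / 2"
  have k0: "k \<ge> 0" using \<mu> by (simp add: k_def)
  obtain C where C: "C > 0" and maj: "\<And>M (B :: real \<Rightarrow> real) q X. B \<in> borel_measurable borel \<Longrightarrow> 0 \<le> X \<Longrightarrow>
    (\<integral>\<^sup>+t. indicator {0..M} t * ennreal (B t powr q * (1 + t) powr m) \<partial>lborel) \<le> ennreal X \<Longrightarrow>
    integrable lebesgue (\<lambda>z::real \<times> 'a. indicator {z. 0 \<le> fst z \<and> fst z \<le> M \<and> norm (snd z) \<le> fst z + 1} z *
      (B (fst z) powr q * exp (- fst z) * (exp (norm (snd z)) * (1 + norm (snd z)) powr (- m)))) \<and>
    (LINT z::real \<times> 'a|lebesgue. indicator {z. 0 \<le> fst z \<and> fst z \<le> M \<and> norm (snd z) \<le> fst z + 1} z *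
      (B (fst z) powr q * exp (- fst z) * (exp (norm (snd z)) * (1 + norm (snd z)) powr (- m)))) \<le> C * X"
    using cone_majorant[OF m] by blast
  \<comment> \<open>The first factor comes from Young's inequality; e^k bounds
    \<open>eigen_bound\<close> by a multiple of e^r (1+r)^{-m}.\<close>
  define c0 where "c0 = (2 + \<mu>) powr q / q * exp k"
  have c0: "c0 > 0" using \<mu> q1 by (simp add: c0_def)
  show ?thesis
  proof (intro exI[of _ "c0 * C"] conjI allI impI)
    show "0 < c0 * C" using c0 C by simp
    fix \<epsilon> M X :: real and T :: ereal and u :: "real \<Rightarrow> 'a \<Rightarrow> real" and B \<eta> \<eta>1 \<eta>2 :: "real \<Rightarrow> real"
    assume \<epsilon>: "0 < \<epsilon>" and sol: "energy_solution \<mu> \<beta> p \<epsilon> f g T u"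
      and supp: "ess_support_on (time_interval T \<times> UNIV) (\<lambda>(t, x). u t x)
       \<subseteq> {(t, x). t \<in> time_interval T \<and> norm x \<le> t + 1}"
      and M: "M \<in> time_interval T" and cut: "time_cutoff p M B \<eta> \<eta>1 \<eta>2"
      and Bm: "B \<in> borel_measurable borel" and B0: "\<forall>t\<ge>0. 0 \<le> B t" and X: "0 \<le> X"
      and leX: "(\<integral>\<^sup>+t. indicator {0..M} t * ennreal (B t powr q * (1 + t) powr m) \<partial>lborel) \<le> ennreal X"
    let ?I = "time_interval T"
    define Q where "Q = ?I \<times> (UNIV :: 'a set)"
    have M0: "0 \<le> M" using M by (simp add: time_interval_def)
    obtain v G where uv: "C1_L2 ?I u v"
      and mu: "(\<lambda>(t, x). u t x) \<in> borel_measurable (lebesgue_on Q)"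
      and mv: "(\<lambda>(t, x). v t x) \<in> borel_measurable (lebesgue_on Q)"
      and G: "\<And>t. t \<in> ?I \<Longrightarrow> G t \<in> L2 \<and> has_weak_gradient (u t) (G t)"
      and u0: "AE x in lebesgue. u 0 x = \<epsilon> * f x"
      and weak: "weak_form \<mu> \<beta> p \<epsilon> f g T u v G"
      using sol unfolding energy_solution_def Let_def Q_def by blast
    have v: "continuous_L2 ?I v" using uv by (simp add: C1_L2_def)
    have QI: "Q \<in> sets lebesgue" unfolding Q_def by (rule spacetime_measurable)
    note cuts = cut[unfolded time_cutoff_def]
    have \<eta>c: "continuous_on UNIV \<eta>" using cuts smooth_continuous by blast
    have \<eta>01: "0 \<le> \<eta> t" "\<eta> t \<le> 1" and \<eta>z: "M \<le> \<bar>t\<bar> \<Longrightarrow> \<eta> t = 0" for t using cuts by auto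
    have \<eta>B: "\<bar>\<eta>1 t\<bar> + \<bar>\<eta>2 t\<bar> \<le> B t * \<eta> t powr (1 / p)" and \<eta>1n: "\<eta>1 t \<le> 0" if "t \<ge> 0" for t
      using cuts that by auto
    have z12: "\<eta>1 t = 0 \<and> \<eta>2 t = 0" if "M \<le> t" for t
      using \<eta>B[of t] \<eta>z[of t] that M0 by auto
    have outside: "AE z in lebesgue. z \<in> Q \<longrightarrow> fst z + 1 < norm (snd z) \<longrightarrow> (case z of (t, x) \<Rightarrow> v t x) = 0"
    proof -
      let ?F = "\<lambda>z. indicator {z. fst z + 1 < norm (snd z)} z * (indicator Q z *\<^sub>R (case z of (t, x) \<Rightarrow> v t x))"
      have "open {z::real \<times> 'a. fst z + 1 < norm (snd z)}"
        by (intro open_Collect_less continuous_intros)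
      then have "(indicator {z::real \<times> 'a. fst z + 1 < norm (snd z)} :: _ \<Rightarrow> real) \<in> borel_measurable lebesgue"
        by (intro borel_measurable_indicator sets_completionI_sets) auto
      moreover have "(\<lambda>z. indicator Q z *\<^sub>R (case z of (t, x) \<Rightarrow> v t x)) \<in> borel_measurable lebesgue"
        using mv QI by (subst (asm) borel_measurable_restrict_space_iff) auto
      ultimately have "?F \<in> borel_measurable lebesgue" by (rule borel_measurable_times)
      moreover have "AE t in lborel. AE x in lebesgue. ?F (t, x) = 0"
      proof (rule AE_I2)
        fix t show "AE x in lebesgue. ?F (t, x) = 0"
        proof (cases "t \<in> ?I")
          case True
          show ?thesis using solution_cone(2)[OF uv supp True] by eventually_elim auto
        qed (simp add: Q_def)
      qed
      ultimately have "AE z in lebesgue. ?F z = 0" by (rule AE_lebesgue_pairI)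
      then show ?thesis by eventually_elim auto
    qed
    have gi: "integrable lebesgue g"
    proof (rule integrable_cong_AE_imp[OF L2_mult_integrable[OF g indicator_cball_L2(1)[of 1]]])
      show "g \<in> borel_measurable lebesgue" by (rule L2_measurable[OF g])
      show "AE x in lebesgue. g x * indicator (cball 0 1) x = g x"
        using g1 by eventually_elim (auto simp: indicator_def)
    qed
    \<comment> \<open>Weight of the error term. It involves neither \<Phi> nor \<delta>, so its
      integral D is fixed before the approximate eigenfunction is chosen.\<close>
    define E where "E t x = v t x * (exp (- t) * \<eta> t * indicator (cball 0 (M + 1)) x)" for t and x :: 'a
    have Ei: "set_integrable lebesgue Q (\<lambda>(t, x). E t x)"
      unfolding Q_def E_def
    proof (rule spacetime_integral(1)[OF v mv[unfolded Q_def] _ _ M indicator_cball_L2])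
      show "continuous_on UNIV (\<lambda>t. exp (- t) * \<eta> t)" by (intro continuous_intros \<eta>c)
      show "M \<le> t \<Longrightarrow> exp (- t) * \<eta> t = 0" for t using \<eta>z[of t] M0 by simp
    qed
    have Ea: "set_integrable lebesgue Q (\<lambda>z. \<bar>case z of (t, x) \<Rightarrow> E t x\<bar>)"
      by (rule set_integrable_abs[OF Ei])
    define D where "D = set_lebesgue_integral lebesgue Q (\<lambda>z. \<bar>case z of (t, x) \<Rightarrow> E t x\<bar>)"
    have D0: "D \<ge> 0" unfolding D_def set_lebesgue_integral_def by (intro integral_nonneg_AE) auto
    define Z where "Z = (\<lambda>z::real \<times> 'a. indicator {z. 0 \<le> fst z \<and> fst z \<le> M \<and> norm (snd z) \<le> fst z + 1} z *
      (B (fst z) powr q * exp (- fst z) * (exp (norm (snd z)) * (1 + norm (snd z)) powr (- m))))"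
    have Zi: "integrable lebesgue Z" and ZX: "integral\<^sup>L lebesgue Z \<le> C * X"
      using maj[OF Bm X leX] by (auto simp: Z_def)
    have Z0: "Z z \<ge> 0" for z by (simp add: Z_def)
    have ZQ: "indicator Q z *\<^sub>R Z z = Z z" for z
      using time_interval_downward[OF M, of "fst z"] by (cases z) (auto simp: Z_def Q_def indicator_def)
    have ZiQ: "set_integrable lebesgue Q (\<lambda>z. c0 * Z z)"
      using Zi by (intro set_integrable_mult_right) (simp only: set_integrable_def ZQ)
    have ZXQ: "set_lebesgue_integral lebesgue Q (\<lambda>z. c0 * Z z) \<le> c0 * C * X"
    proof -
      have "set_lebesgue_integral lebesgue Q (\<lambda>z. c0 * Z z) = c0 * integral\<^sup>L lebesgue Z"
        unfolding set_integral_mult_right by (simp only: set_lebesgue_integral_def ZQ)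
      then show ?thesis using ZX c0 by (simp add: mult.assoc)
    qed
    have main: "\<epsilon> * (LINT x|lebesgue. g x) \<le> c0 * C * X + \<delta> * D" if \<delta>: "0 < \<delta>" "\<delta> \<le> 1" for \<delta>
    proof -
      \<comment> \<open>Up to time M the cone stays within radius M + 1, strictly inside the ball
        where \<Phi> is the polynomial; the unit ball carrying the data is also inside.\<close>
      define R where "R = M + 2"
      have R: "R > 0" "R \<ge> 2" using M0 by (auto simp: R_def)
      obtain P where P: "\<And>r. 0 \<le> r \<Longrightarrow> r \<le> R \<Longrightarrow> 1 \<le> poly P (r\<^sup>2) \<and> poly P (r\<^sup>2) \<le> eigen_bound k m r \<and>
          \<bar>poly (radial_laplacian DIM('a) P) (r\<^sup>2) - (1 + \<mu> / (1 + r) powr \<beta>) * poly P (r\<^sup>2)\<bar> \<le> \<delta>"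
        using approximate_eigenfunction[OF n \<mu> \<beta> m k_def R(1) \<delta>(1)] by blast
      obtain \<Phi> :: "'a \<Rightarrow> real" where \<Phi>: "smooth \<Phi>" "\<And>x. R + 1 \<le> norm x \<Longrightarrow> \<Phi> x = 0"
        "\<And>x. norm x \<le> R \<Longrightarrow> \<Phi> x = poly P (x \<bullet> x)"
        "\<And>x. norm x < R \<Longrightarrow> laplacian \<Phi> x = poly (radial_laplacian DIM('a) P) (x \<bullet> x)"
        using radial_cutoff[OF R(1), of P] by blast
      let ?a = "damping \<mu> \<beta> :: 'a \<Rightarrow> real"
      have \<Phi>1: "1 \<le> \<Phi> x" and \<Phi>W: "\<Phi> x \<le> eigen_bound k m (norm x)"
        and \<Phi>L: "\<bar>laplacian \<Phi> x - (1 + ?a x) * \<Phi> x\<bar> \<le> \<delta>" if "norm x < R" for x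
        using P[of "norm x"] \<Phi>(3)[of x] \<Phi>(4)[of x] that by (auto simp: damping_def dot_square_norm)
      have \<Phi>W': "\<Phi> x \<le> exp k * (exp (norm x) * (1 + norm x) powr (- m))" if "norm x < R" for x
      proof -
        have "exp (norm x + k - k / (1 + norm x)) \<le> exp (k + norm x)" using k0 by simp
        then have "eigen_bound k m (norm x) \<le> exp (k + norm x) * (1 + norm x) powr (- m)"
          unfolding eigen_bound_def by (intro mult_right_mono) auto
        with \<Phi>W[OF that] show ?thesis by (simp add: exp_add mult.assoc)
      qed
      define K where "K t = exp (- t) * \<eta> t" for t
      define K1 where "K1 t = exp (- t) * (\<eta>1 t - \<eta> t)" for t
      define K2 where "K2 t = exp (- t) * (\<eta>2 t - 2 * \<eta>1 t + \<eta> t)" for t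
      define N where "N = (\<lambda>(t, x). \<bar>v t x\<bar> powr p * (- K1 t * \<Phi> x))"
      define J where "J = (\<lambda>(t, x). v t x * (K2 t * \<Phi> x - K1 t * (?a x * \<Phi> x) - K t * laplacian \<Phi> x))"
      note id = weak_identity[OF \<mu> \<beta> uv mu[unfolded Q_def] mv[unfolded Q_def] G u0 f weak M cut \<Phi>(1,2)]
      note defs = N_def J_def K_def K1_def K2_def Q_def
      have Ni: "set_integrable lebesgue Q N"
        unfolding defs by (rule id(1))
      have Ji: "set_integrable lebesgue Q J"
        unfolding defs by (rule id(2))
      have eq: "\<epsilon> * (LINT x|lebesgue. g x * \<Phi> x) + set_lebesgue_integral lebesgue Q N =
          set_lebesgue_integral lebesgue Q J - \<epsilon> * (LINT x|lebesgue. f x * laplacian \<Phi> x)"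
        unfolding defs by (rule id(3))
      have \<Phi>L2: "\<Phi> \<in> L2"
        by (rule continuous_compact_support_L2(1)[OF smooth_continuous[OF \<Phi>(1)], of "R + 1"]) (use \<Phi>(2) in auto)
      have "(LINT x|lebesgue. g x) \<le> (LINT x|lebesgue. g x * \<Phi> x)"
      proof (rule integral_mono_AE[OF gi L2_mult_integrable[OF g \<Phi>L2]])
        show "AE x in lebesgue. g x \<le> g x * \<Phi> x"
          using g0 g1
        proof eventually_elim
          case (elim x)
          show ?case
          proof (cases "norm x \<le> 1")
            case True
            then show ?thesis using elim(1) \<Phi>1[of x] R by (simp add: mult_le_cancel_left1)
          qed (use elim in simp)
        qed
      qed
      then have gle: "\<epsilon> * (LINT x|lebesgue. g x) \<le> \<epsilon> * (LINT x|lebesgue. g x * \<Phi> x)"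
        using \<epsilon> by simp
      \<comment> \<open>On the unit ball the Laplacian is at least (1 + a) \<Phi> - \<delta> \<ge> 1
        - \<delta>, which is why \<delta> \<le> 1 is imposed.\<close>
      have "0 \<le> (LINT x|lebesgue. f x * laplacian \<Phi> x)"
      proof (rule integral_nonneg_AE)
        show "AE x in lebesgue. 0 \<le> f x * laplacian \<Phi> x"
          using f0 f1
        proof eventually_elim
          case (elim x)
          show ?case
          proof (cases "norm x \<le> 1")
            case True
            then have x: "norm x < R" using R by simp
            have "1 * 1 \<le> (1 + ?a x) * \<Phi> x"
              using damping_bounds(1)[OF \<mu> \<beta>, of x] \<Phi>1[OF x] by (intro mult_mono) auto
            then have "0 \<le> laplacian \<Phi> x" using \<Phi>L[OF x] \<delta>(2) by linarith
            then show ?thesis using elim(1) by simp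
          qed (use elim in simp)
        qed
      qed
      then have fl: "0 \<le> \<epsilon> * (LINT x|lebesgue. f x * laplacian \<Phi> x)" using \<epsilon> by simp
      have Kz: "K t = 0 \<and> K1 t = 0 \<and> K2 t = 0" if "M \<le> t" for t
        using z12[OF that] \<eta>z[of t] that M0 by (auto simp: K_def K1_def K2_def)
      have K1n: "0 \<le> - K1 t" if "0 \<le> t" for t
        using \<eta>1n[OF that] \<eta>01(1)[of t] by (simp add: K1_def mult_le_0_iff)
      have "AE z in lebesgue. z \<in> Q \<longrightarrow>
        0 \<le> N z \<and> J z \<le> 1 / p * N z + c0 * Z z + \<delta> * \<bar>case z of (t, x) \<Rightarrow> E t x\<bar>"
        using outside
      proof eventually_elim
        case (elim z)
        obtain t x where z: "z = (t, x)" by (cases z)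
        show ?case
        proof (intro impI)
          assume zQ: "z \<in> Q"
          then have t: "0 \<le> t" by (auto simp: Q_def z time_interval_def)
          \<comment> \<open>Outside the cone v vanishes, after time M the cutoff does; in the
            remaining region \<open>norm x < R\<close>, so the bounds on \<Phi> are
            available.\<close>
          consider "v t x = 0" | "M \<le> t" | "t < M" "norm x \<le> t + 1"
            using elim zQ by (cases "M \<le> t"; cases "norm x \<le> t + 1") (auto simp: z)
          then show "0 \<le> N z \<and> J z \<le> 1 / p * N z + c0 * Z z + \<delta> * \<bar>case z of (t, x) \<Rightarrow> E t x\<bar>"
          proof cases
            case 1
            then show ?thesis using Z0[of z] c0 by (simp add: N_def J_def E_def z)
          next
            case 2
            then show ?thesis using Kz[of t] Z0[of z] c0 \<delta>(1) by (simp add: N_def J_def z)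
          next
            case 3
            then have x: "norm x < R" by (simp add: R_def)
            have N0: "0 \<le> N z"
              using K1n[OF t] \<Phi>1[OF x] unfolding N_def z prod.case by (intro mult_nonneg_nonneg) auto
            define r where "r = laplacian \<Phi> x - (1 + ?a x) * \<Phi> x"
            have y: "v t x * (exp (- t) * (\<eta>2 t - 2 * \<eta>1 t + \<eta> t) * \<Phi> x - exp (- t) * (\<eta>1 t - \<eta> t) * (?a x * \<Phi> x)
                - exp (- t) * \<eta> t * ((1 + ?a x) * \<Phi> x + r))
              \<le> 1 / p * (\<bar>v t x\<bar> powr p * (- (exp (- t) * (\<eta>1 t - \<eta> t)) * \<Phi> x))
                + ((2 + \<mu>) * B t) powr q / q * (exp (- t) * \<Phi> x) + \<delta> * \<bar>v t x * (exp (- t) * \<eta> t)\<bar>"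
              using damping_bounds[OF \<mu> \<beta>, of x] \<Phi>1[OF x] \<Phi>L[OF x] B0 t
              by (intro pointwise_young p q \<eta>01 \<eta>1n \<eta>B) (auto simp: r_def)
            have e1: "v t x * (exp (- t) * (\<eta>2 t - 2 * \<eta>1 t + \<eta> t) * \<Phi> x - exp (- t) * (\<eta>1 t - \<eta> t) * (?a x * \<Phi> x)
                - exp (- t) * \<eta> t * ((1 + ?a x) * \<Phi> x + r)) = J z"
              by (simp add: J_def K_def K1_def K2_def r_def z)
            have e2: "\<bar>v t x\<bar> powr p * (- (exp (- t) * (\<eta>1 t - \<eta> t)) * \<Phi> x) = N z"
              by (simp add: N_def K1_def z)
            have e3: "v t x * (exp (- t) * \<eta> t) = E t x"
              using 3 by (simp add: E_def indicator_def)
            have e4: "((2 + \<mu>) * B t) powr q / q * (exp (- t) * \<Phi> x) \<le> c0 * Z z"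
            proof -
              have "((2 + \<mu>) * B t) powr q / q * (exp (- t) * \<Phi> x) \<le>
                ((2 + \<mu>) * B t) powr q / q * (exp (- t) * (exp k * (exp (norm x) * (1 + norm x) powr (- m))))"
                using q1 \<Phi>W'[OF x] by (intro mult_left_mono) auto
              also have "((2 + \<mu>) * B t) powr q / q * (exp (- t) * (exp k * (exp (norm x) * (1 + norm x) powr (- m)))) = c0 * Z z"
                unfolding powr_mult using 3 t by (simp add: c0_def Z_def z)
              finally show ?thesis .
            qed
            have "J z \<le> 1 / p * N z + c0 * Z z + \<delta> * \<bar>E t x\<bar>"
              using y e4 unfolding e1 e2 e3 by linarith
            then show ?thesis using N0 by (simp add: z)
          qed
        qed
      qed
      then have ae: "AE z\<in>Q in lebesgue. 0 \<le> N z"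
        and ae2: "AE z\<in>Q in lebesgue. J z \<le> 1 / p * N z + c0 * Z z + \<delta> * \<bar>case z of (t, x) \<Rightarrow> E t x\<bar>"
        by (auto elim: eventually_mono)
      have N0: "0 \<le> set_lebesgue_integral lebesgue Q N"
        unfolding set_lebesgue_integral_def
        by (rule integral_nonneg_AE) (use ae in \<open>auto elim!: eventually_mono simp: indicator_def\<close>)
      have i1: "set_integrable lebesgue Q (\<lambda>z. 1 / p * N z)" and i3: "set_integrable lebesgue Q (\<lambda>z. \<delta> * \<bar>case z of (t, x) \<Rightarrow> E t x\<bar>)"
        using Ni Ea by (auto intro: set_integrable_mult_right)
      have "set_lebesgue_integral lebesgue Q J \<le>
        set_lebesgue_integral lebesgue Q (\<lambda>z. 1 / p * N z + c0 * Z z + \<delta> * \<bar>case z of (t, x) \<Rightarrow> E t x\<bar>)"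
        by (intro set_integral_mono_AE Ji set_integral_add(1) i1 i3 ZiQ ae2)
      also have "\<dots> = set_lebesgue_integral lebesgue Q (\<lambda>z. 1 / p * N z) + set_lebesgue_integral lebesgue Q (\<lambda>z. c0 * Z z)
          + set_lebesgue_integral lebesgue Q (\<lambda>z. \<delta> * \<bar>case z of (t, x) \<Rightarrow> E t x\<bar>)"
        unfolding set_integral_add(2)[OF set_integral_add(1)[OF i1 ZiQ] i3] set_integral_add(2)[OF i1 ZiQ] ..
      also have "\<dots> \<le> 1 / p * set_lebesgue_integral lebesgue Q N + c0 * C * X + \<delta> * D"
        using ZXQ unfolding D_def by simp
      \<comment> \<open>N is integrable by the weak form, so after 1/p is enlarged to 1 its integral
        can be subtracted from both sides of \<open>eq\<close>.\<close>
      also have "\<dots> \<le> set_lebesgue_integral lebesgue Q N + c0 * C * X + \<delta> * D"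
        using N0 p by (simp add: divide_le_eq mult_le_cancel_left1)
      finally show ?thesis using eq gle fl by linarith
    qed
    have "\<epsilon> * (LINT x|lebesgue. g x) \<le> c0 * C * X + e" if e: "e > 0" for e
    proof -
      \<comment> \<open>D does not depend on \<delta>, so the error can be pushed below any
        e.\<close>
      define \<delta> where "\<delta> = min 1 (e / (D + 1))"
      have \<delta>: "0 < \<delta>" "\<delta> \<le> 1" using e D0 by (auto simp: \<delta>_def)
      have "\<delta> * D \<le> e / (D + 1) * D" using D0 by (intro mult_right_mono) (auto simp: \<delta>_def)
      also have "\<dots> \<le> e" using D0 e by (simp add: field_simps)
      finally show ?thesis using main[OF \<delta>] by linarith
    qed
    then show "\<epsilon> * (LINT x|lebesgue. g x) \<le> c0 * C * X"
      by (rule field_le_epsilon)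
  qed
qed

section \<open>From the energy estimate to the lifespan\<close>

lemma le_of_dense_below:
  fixes T :: ereal
  assumes Y: "1 \<le> Y" and le: "\<And>M. 1 \<le> M \<Longrightarrow> ereal M < T \<Longrightarrow> M \<le> Y"
  shows "T \<le> ereal Y"
proof (rule ccontr)
  assume "\<not> T \<le> ereal Y"
  then obtain M where M: "ereal Y < ereal M" "ereal M < T"
    using ereal_dense2[of "ereal Y" T] by (auto simp: not_le)
  \<comment> \<open>Y \<ge> 1 makes this M admissible; it also settles T \<le> 1, where no
    admissible M exists below T.\<close>
  then have "M \<le> Y" using Y by (intro le) auto
  with M(1) show False by simp
qed

text \<open>On [0, M] one has 1 + t \<le> 2M, and the interval has length M: the exponents -q, m and
  1 add up.\<close>

lemma power_cutoff_majorant: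
  fixes m q D M :: real
  assumes "0 \<le> m" "0 < D" "1 \<le> M"
  shows "(\<integral>\<^sup>+t. indicator {0..M} t * ennreal ((D / M) powr q * (1 + t) powr m) \<partial>lborel)
    \<le> ennreal (D powr q * 2 powr m * M powr (m + 1 - q))"
proof -
  have "(\<integral>\<^sup>+t. indicator {0..M} t * ennreal ((D / M) powr q * (1 + t) powr m) \<partial>lborel) \<le>
    (\<integral>\<^sup>+t. ennreal ((D / M) powr q * (2 * M) powr m) * indicator {0..M} t \<partial>lborel)"
  proof (intro nn_integral_mono)
    fix t :: real
    have "(D / M) powr q * (1 + t) powr m \<le> (D / M) powr q * (2 * M) powr m" if "0 \<le> t" "t \<le> M"
      using that assms by (intro mult_left_mono powr_mono2) auto
    then show "indicator {0..M} t * ennreal ((D / M) powr q * (1 + t) powr m) \<le>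
      ennreal ((D / M) powr q * (2 * M) powr m) * indicator {0..M} t"
      by (auto simp: indicator_def intro!: ennreal_leI)
  qed
  also have "\<dots> = ennreal ((D / M) powr q * (2 * M) powr m) * ennreal M"
    using assms by (subst nn_integral_cmult_indicator) auto
  also have "\<dots> = ennreal ((D / M) powr q * (2 * M) powr m * M)"
    using assms by (simp add: ennreal_mult)
  also have "(D / M) powr q * (2 * M) powr m * M = D powr q * 2 powr m * M powr (m + 1 - q)"
    using assms by (simp add: powr_divide powr_mult powr_diff powr_add)
  finally show ?thesis .
qed

text \<open>For q = m + 1 the powers of 1 + t collapse to 1/(1+t), whose integral ln(1 + M) is at
  most L = ln(1 + M^2). Together with L^{-q} this leaves L^{1-q} = L^{-m}.\<close>

lemma log_cutoff_majorant:
  fixes m q D M :: real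
  assumes "q = m + 1" "0 < D" "1 \<le> M"
  shows "(\<integral>\<^sup>+t. indicator {0..M} t * ennreal ((D / ((1 + t) * ln (1 + M\<^sup>2))) powr q * (1 + t) powr m) \<partial>lborel)
    \<le> ennreal (D powr q * ln (1 + M\<^sup>2) powr (- m))"
proof -
  define L where "L = ln (1 + M\<^sup>2)"
  have "1 \<le> M\<^sup>2" using assms by simp
  then have L: "L > 0" unfolding L_def by (intro ln_gt_zero) linarith
  have "(\<integral>\<^sup>+t. indicator {0..M} t * ennreal ((D / ((1 + t) * L)) powr q * (1 + t) powr m) \<partial>lborel) =
    (\<integral>\<^sup>+t. ennreal (D powr q * L powr (- q) * inverse (1 + t)) * indicator {0..M} t \<partial>lborel)"
  proof (intro nn_integral_cong)
    fix t :: real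
    have "(D / ((1 + t) * L)) powr q * (1 + t) powr m = D powr q * L powr (- q) * inverse (1 + t)" if "0 \<le> t"
    proof -
      have "(1 + t) powr q = (1 + t) powr m * (1 + t)" using that by (simp add: assms(1) powr_add)
      moreover have "(1 + t) powr m > 0" using that by simp
      ultimately show ?thesis
        unfolding powr_divide powr_mult by (simp add: powr_minus divide_inverse)
    qed
    then show "indicator {0..M} t * ennreal ((D / ((1 + t) * L)) powr q * (1 + t) powr m) =
      ennreal (D powr q * L powr (- q) * inverse (1 + t)) * indicator {0..M} t"
      by (auto simp: indicator_def)
  qed
  also have "\<dots> = ennreal (D powr q * L powr (- q) * ln (1 + M) - D powr q * L powr (- q) * ln (1 + 0))"
    using assms by (intro nn_integral_FTC_Icc) (auto intro!: derivative_eq_intros simp: divide_inverse)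
  also have "\<dots> \<le> ennreal (D powr q * L powr (- q) * L)"
  proof (intro ennreal_leI)
    have "(M - 1)\<^sup>2 \<ge> 0" by simp
    then have "1 + M \<le> 1 + M\<^sup>2" using assms(3) by (simp add: power2_eq_square mult_le_cancel_left1)
    then have "ln (1 + M) \<le> L" using assms(3) by (simp add: L_def)
    then show "D powr q * L powr (- q) * ln (1 + M) - D powr q * L powr (- q) * ln (1 + 0) \<le> D powr q * L powr (- q) * L"
      by (simp add: mult_left_mono)
  qed
  also have "D powr q * L powr (- q) * L = D powr q * L powr (- m)"
    using L by (simp add: assms(1) powr_add powr_minus powr_diff field_simps)
  finally show ?thesis unfolding L_def .
qed

theorem theorem2p3:
  fixes f g :: "'a::euclidean_space \<Rightarrow> real" and \<mu> \<beta> p :: real and n :: nat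
  assumes "n = DIM('a)"
    and "\<mu> > 0" and "\<beta> > 2"
    and "1 < p" and "ereal p \<le> glassey_exponent n"
    and "f \<in> H1" and "g \<in> L2"
    and "AE x in lebesgue. 0 \<le> f x" and "AE x in lebesgue. 0 \<le> g x"
    and "\<not> (AE x in lebesgue. f x = 0)" and "\<not> (AE x in lebesgue. g x = 0)"
    and "ess_support_on UNIV f \<subseteq> {x. norm x \<le> 1}"
    and "ess_support_on UNIV g \<subseteq> {x. norm x \<le> 1}"
  shows "\<exists>\<epsilon>\<^sub>0>0. \<exists>C>0. \<forall>\<epsilon> (T::ereal) (u :: real \<Rightarrow> 'a \<Rightarrow> real).
     0 < \<epsilon> \<and> \<epsilon> \<le> \<epsilon>\<^sub>0 \<and> energy_solution \<mu> \<beta> p \<epsilon> f g T u \<and>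
     ess_support_on (time_interval T \<times> UNIV) (\<lambda>(t, x). u t x)
       \<subseteq> {(t, x). t \<in> time_interval T \<and> norm x \<le> t + 1}
     \<longrightarrow> (ereal p < glassey_exponent n \<longrightarrow>
            T \<le> ereal (C * \<epsilon> powr (- inverse (1 / (p - 1) - (real n - 1) / 2)))) \<and>
         (ereal p = glassey_exponent n \<longrightarrow>
            T \<le> ereal (exp (C * \<epsilon> powr (- (p - 1)))))"
proof -
  define m where "m = (real DIM('a) - 1) / 2"
  define q where "q = p / (p - 1)"
  note p = \<open>1 < p\<close>
  have n1: "n \<ge> 1" using DIM_positive[where 'a = 'a] assms(1) by (simp add: Suc_le_eq)
  have m0: "m \<ge> 0" using n1 by (simp add: m_def assms(1)[symmetric])
  have qm: "q - 1 = 1 / (p - 1)" using p by (simp add: q_def field_simps)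
  have f: "f \<in> L2" using assms(6) by (simp add: H1_def)
  have f1: "AE x in lebesgue. 1 < norm x \<longrightarrow> f x = 0"
    using AE_not_in_ess_support[of UNIV f] by eventually_elim (use assms(12) in force)
  have g1: "AE x in lebesgue. 1 < norm x \<longrightarrow> g x = 0"
    using AE_not_in_ess_support[of UNIV g] by eventually_elim (use assms(13) in force)
  define \<gamma> where "\<gamma> = (LINT x|lebesgue. g x)"
  \<comment> \<open>Compact support makes g integrable, so being nonnegative and not null gives it
    positive mass; dividing by \<gamma> below isolates \<epsilon>.\<close>
  have \<gamma>: "\<gamma> > 0"
  proof -
    have gi: "integrable lebesgue g"
    proof (rule integrable_cong_AE_imp[OF L2_mult_integrable[OF assms(7) indicator_cball_L2(1)[of 1]]])
      show "g \<in> borel_measurable lebesgue" by (rule L2_measurable[OF assms(7)])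
      show "AE x in lebesgue. g x * indicator (cball 0 1) x = g x"
        using g1 by eventually_elim (auto simp: indicator_def)
    qed
    have "\<gamma> \<noteq> 0"
      using integral_nonneg_eq_0_iff_AE[OF gi assms(9)] assms(11) by (simp add: \<gamma>_def)
    moreover have "\<gamma> \<ge> 0" unfolding \<gamma>_def using assms(9) by (rule integral_nonneg_AE)
    ultimately show ?thesis by simp
  qed
  obtain C where C: "C > 0" and est: "\<And>\<epsilon> T (u :: real \<Rightarrow> 'a \<Rightarrow> real) M B \<eta> \<eta>1 \<eta>2 X.
     0 < \<epsilon> \<Longrightarrow> energy_solution \<mu> \<beta> p \<epsilon> f g T u \<Longrightarrow>
     ess_support_on (time_interval T \<times> UNIV) (\<lambda>(t, x). u t x)
       \<subseteq> {(t, x). t \<in> time_interval T \<and> norm x \<le> t + 1} \<Longrightarrow>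
     M \<in> time_interval T \<Longrightarrow> time_cutoff p M B \<eta> \<eta>1 \<eta>2 \<Longrightarrow>
     B \<in> borel_measurable borel \<Longrightarrow> \<forall>t\<ge>0. 0 \<le> B t \<Longrightarrow> 0 \<le> X \<Longrightarrow>
     (\<integral>\<^sup>+t. indicator {0..M} t * ennreal (B t powr q * (1 + t) powr m) \<partial>lborel) \<le> ennreal X \<Longrightarrow>
     \<epsilon> * \<gamma> \<le> C * X"
    using energy_estimate[OF assms(2,3) p m_def q_def f assms(7-9) f1 g1] unfolding \<gamma>_def by blast
  \<comment> \<open>Since q - 1 = 1/(p - 1), this says q > m + 1: the power of M in
    \<open>power_cutoff_majorant\<close> is then negative.\<close>
  have subcrit: "1 / (p - 1) > m" if "ereal p < glassey_exponent n"
  proof (cases "n = 1")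
    case True
    then show ?thesis using p by (simp add: m_def assms(1)[symmetric])
  next
    case False
    then have "p < (real n + 1) / (real n - 1)" using that by (simp add: glassey_exponent_def)
    then have "p * (real n - 1) < real n + 1" using False n1 by (simp add: pos_less_divide_eq)
    then have "(p - 1) * m < 1" by (simp add: m_def assms(1)[symmetric] algebra_simps)
    then show ?thesis using p by (simp add: pos_less_divide_eq mult.commute)
  qed
  have crit: "1 / (p - 1) = m \<and> m > 0" if "ereal p = glassey_exponent n"
  proof -
    have n: "n \<noteq> 1" using that by (auto simp: glassey_exponent_def)
    then have "p = (real n + 1) / (real n - 1)" using that by (simp add: glassey_exponent_def)
    then have "p - 1 = 2 / (real n - 1)" using n n1 by (simp add: field_simps)
    then show ?thesis using n n1 by (simp add: m_def assms(1)[symmetric])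
  qed
  show ?thesis
  proof (cases "ereal p < glassey_exponent n")
    case True
    define \<theta> where "\<theta> = 1 / (p - 1) - (real n - 1) / 2"
    have \<theta>: "\<theta> > 0" using subcrit[OF True] by (simp add: \<theta>_def m_def assms(1))
    have \<theta>q: "m + 1 - q = - \<theta>" using qm by (simp add: \<theta>_def m_def assms(1))
    obtain D where D: "D > 0" and cut: "\<And>M. M \<ge> 1 \<Longrightarrow> \<exists>\<eta> \<eta>1 \<eta>2. time_cutoff p M (\<lambda>t. D / M) \<eta> \<eta>1 \<eta>2"
      using time_cutoff_power[OF p] by blast
    define A where "A = C * (D powr q * 2 powr m) / \<gamma>"
    have A: "A > 0" using C D \<gamma> by (simp add: A_def)
    \<comment> \<open>The maximum with 1 makes the claimed bound at least 1 for every \<epsilon>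
      \<le> 1, as \<open>le_of_dense_below\<close> requires; hence the threshold 1 for
      \<epsilon>.\<close>
    define C' where "C' = max 1 (A powr (1 / \<theta>))"
    have "T \<le> ereal (C' * \<epsilon> powr (- inverse \<theta>))"
      if \<epsilon>: "0 < \<epsilon>" "\<epsilon> \<le> 1" and sol: "energy_solution \<mu> \<beta> p \<epsilon> f g T u"
        and supp: "ess_support_on (time_interval T \<times> UNIV) (\<lambda>(t, x). u t x)
          \<subseteq> {(t, x). t \<in> time_interval T \<and> norm x \<le> t + 1}" for \<epsilon> T and u :: "real \<Rightarrow> 'a \<Rightarrow> real"
    proof (rule le_of_dense_below)
      have "1 powr (- inverse \<theta>) \<le> \<epsilon> powr (- inverse \<theta>)"
        using \<epsilon> \<theta> by (intro powr_mono2') auto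
      then have "1 * 1 \<le> C' * \<epsilon> powr (- inverse \<theta>)"
        by (intro mult_mono) (auto simp: C'_def)
      then show "1 \<le> C' * \<epsilon> powr (- inverse \<theta>)" by simp
      fix M :: real assume M: "1 \<le> M" "ereal M < T"
      obtain \<eta> \<eta>1 \<eta>2 where "time_cutoff p M (\<lambda>t. D / M) \<eta> \<eta>1 \<eta>2" using cut[OF M(1)] by blast
      then have "\<epsilon> * \<gamma> \<le> C * (D powr q * 2 powr m * M powr (m + 1 - q))"
        using M D by (intro est[OF \<epsilon>(1) sol supp _ _ _ _ _ power_cutoff_majorant[OF m0 D M(1)]])
          (auto simp: time_interval_def)
      then have "\<epsilon> \<le> A * M powr (- \<theta>)"
        using \<gamma> unfolding \<theta>q by (simp add: A_def field_simps)
      then have "M powr \<theta> \<le> A / \<epsilon>"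
        using M \<epsilon> by (simp add: powr_minus field_simps)
      then have "(M powr \<theta>) powr (1 / \<theta>) \<le> (A / \<epsilon>) powr (1 / \<theta>)"
        using \<theta> by (intro powr_mono2) auto
      also have "(M powr \<theta>) powr (1 / \<theta>) = M" using M \<theta> by (simp add: powr_powr)
      also have "(A / \<epsilon>) powr (1 / \<theta>) = A powr (1 / \<theta>) * \<epsilon> powr (- inverse \<theta>)"
        unfolding powr_divide by (simp add: powr_minus divide_inverse)
      also have "\<dots> \<le> C' * \<epsilon> powr (- inverse \<theta>)"
        by (intro mult_right_mono) (auto simp: C'_def)
      finally show "M \<le> C' * \<epsilon> powr (- inverse \<theta>)" .
    qed
    moreover have "C' > 0" by (simp add: C'_def)
    ultimately show ?thesis
      using True unfolding \<theta>_def by (intro exI[of _ 1] exI[of _ C'] conjI) auto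
  next
    case False
    obtain D where D: "D > 0" and cut: "\<And>M. M \<ge> 1 \<Longrightarrow>
        \<exists>\<eta> \<eta>1 \<eta>2. time_cutoff p M (\<lambda>t. D / ((1 + t) * ln (1 + M\<^sup>2))) \<eta> \<eta>1 \<eta>2"
      using time_cutoff_log[OF p] by blast
    define A where "A = C * D powr q / \<gamma>"
    have A: "A > 0" using C D \<gamma> by (simp add: A_def)
    \<comment> \<open>At the critical exponent m (p - 1) = 1, so raising L^m \<le> A/\<epsilon> to
      the power p - 1 isolates L.\<close>
    define C' where "C' = A powr (p - 1)"
    have "T \<le> ereal (exp (C' * \<epsilon> powr (- (p - 1))))"
      if eq: "ereal p = glassey_exponent n" and \<epsilon>: "0 < \<epsilon>" and sol: "energy_solution \<mu> \<beta> p \<epsilon> f g T u"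
        and supp: "ess_support_on (time_interval T \<times> UNIV) (\<lambda>(t, x). u t x)
          \<subseteq> {(t, x). t \<in> time_interval T \<and> norm x \<le> t + 1}" for \<epsilon> T and u :: "real \<Rightarrow> 'a \<Rightarrow> real"
    proof (rule le_of_dense_below)
      have mp: "m = 1 / (p - 1)" "m > 0" using crit[OF eq] by auto
      have q1: "q = m + 1" using qm mp by simp
      show "1 \<le> exp (C' * \<epsilon> powr (- (p - 1)))" by (simp add: C'_def)
      fix M :: real assume M: "1 \<le> M" "ereal M < T"
      define L where "L = ln (1 + M\<^sup>2)"
      have M2: "1 \<le> M\<^sup>2" using M by simp
      then have L: "L > 0" unfolding L_def by (intro ln_gt_zero) linarith
      obtain \<eta> \<eta>1 \<eta>2 where "time_cutoff p M (\<lambda>t. D / ((1 + t) * ln (1 + M\<^sup>2))) \<eta> \<eta>1 \<eta>2"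
        using cut[OF M(1)] by blast
      then have "\<epsilon> * \<gamma> \<le> C * (D powr q * ln (1 + M\<^sup>2) powr (- m))"
        using M D L by (intro est[OF \<epsilon>(1) sol supp _ _ _ _ _ log_cutoff_majorant[OF q1 D M(1)]])
          (auto simp: time_interval_def L_def)
      then have "\<epsilon> \<le> A * L powr (- m)"
        using \<gamma> by (simp add: A_def L_def field_simps)
      then have "L powr m \<le> A / \<epsilon>"
        using L \<epsilon> by (simp add: powr_minus field_simps)
      then have "(L powr m) powr (p - 1) \<le> (A / \<epsilon>) powr (p - 1)"
        using p by (intro powr_mono2) auto
      also have "(L powr m) powr (p - 1) = L" using L p by (simp add: powr_powr mp)
      also have "(A / \<epsilon>) powr (p - 1) = C' * \<epsilon> powr (- (p - 1))"
        unfolding powr_divide C'_def by (simp only: powr_minus divide_inverse)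
      finally have "exp L \<le> exp (C' * \<epsilon> powr (- (p - 1)))" by simp
      \<comment> \<open>exp L is 1 + M^2, which exceeds M for M \<ge> 1.\<close>
      moreover have "M \<le> exp L"
      proof -
        have "M * 1 \<le> M * M" using M by (intro mult_left_mono) auto
        then show ?thesis using M2 by (simp add: L_def power2_eq_square)
      qed
      ultimately show "M \<le> exp (C' * \<epsilon> powr (- (p - 1)))" by linarith
    qed
    moreover have "C' > 0" using A by (simp add: C'_def)
    ultimately show ?thesis
      using False by (intro exI[of _ 1] exI[of _ C'] conjI) auto
  qed
qed

end
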